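(* Let $\mathcal{C}$ be the class of general halfspaces $\mathbf{x}\mapsto\mathrm{sign}(\mathbf{v}\cdot\mathbf{x}-\tau)$ ($\mathbf{v}\in\mathbb{S}^{d-1},\tau\in\mathbb{R}$) over $\mathbb{R}^d$ and $C>0$ a sufficiently large universal constant. Then there is an algorithm which, given $|S_{\mathrm{train}}|=|X_{\mathrm{test}}|=Cd^{C\log(1/\epsilon)}$ samples, is a TDS learning algorithm for $\mathcal{C}$ w.r.t. the standard Gaussian $\mathcal{N}(0,I_d)$ in the realizable setting with run-time $d^{O(\log(1/\epsilon))}$, where $\epsilon$ is the accuracy parameter and the failure probability $\delta$ is at most $0.01$.
   Context: Realizable TDS learning w.r.t. a distribution $\mathcal{D}$: an algorithm receives i.i.d. labelled samples $S_{\mathrm{train}}$ from a distribution over $\mathbb{R}^d\times\{\pm1\}$ whose $\mathbb{R}^d$-marginal is $\mathcal{D}$, and i.i.d. unlabelled samples $X_{\mathrm{test}}$ from a test marginal $\mathcal{D}^{\mathrm{test}}_{\mathcal{X}}$, where some $f^*\in\mathcal{C}$ labels both training and test examples; it either rejects or accepts and outputs $h$. Soundness: with probability at least $1-\delta$, if it accepts then $\Pr_{\mathbf{x}\sim\mathcal{D}^{\mathrm{test}}_{\mathcal{X}}}[h(\mathbf{x})\ne f^*(\mathbf{x})]\le\epsilon$. Completeness: if $\mathcal{D}^{\mathrm{test}}_{\mathcal{X}}=\mathcal{D}$, it accepts with probability at least $1-\delta$.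
   Formalization: The dimension is taken to be d ≥ 2 (for d = 1 the sample size does not depend on ε and the claim fails for small ε), and the run-time d^{O(log(1/ε))} is read as K·d^{K log(1/ε)}, with a leading constant needed as ε → 1. *)

theory Defs
  imports "HOL-Probability.Probability"
begin

section \<open>A uniform real RAM\<close>

text \<open>
  Run-times are measured on a uniform real RAM: exact real arithmetic and comparisons at unit cost,
  indirectly addressed memory, no rounding from reals to integers.  Memory consists of named arrays,
  each with two indices; a program mentions only finitely many names.  A scalar is entry (0, 0).
  Index arithmetic has only + and truncated subtraction, so after t steps the integers have O(t)
  more bits than initially.  Program constants are naturals and rationals.
\<close>

record ram =
  ints :: "string \<Rightarrow> nat \<Rightarrow> nat \<Rightarrow> nat"
  reals :: "string \<Rightarrow> nat \<Rightarrow> nat \<Rightarrow> real"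

datatype iexp =
  INum nat | IVar string iexp iexp | IAdd iexp iexp | ISub iexp iexp

datatype rexp =
  RRat rat | RVar string iexp iexp | ROfNat iexp
  | RAdd rexp rexp | RSub rexp rexp | RMul rexp rexp | RDiv rexp rexp

datatype bexp =
  ILess iexp iexp | RLess rexp rexp | BNot bexp | BAnd bexp bexp

datatype com =
  Skip
  | IAssign string iexp iexp iexp
  | RAssign string iexp iexp rexp
  | Seq com com
  | If bexp com com
  | While bexp com

fun ival :: "iexp \<Rightarrow> ram \<Rightarrow> nat" where
  "ival (INum k) s = k"
| "ival (IVar a i j) s = ints s a (ival i s) (ival j s)"
| "ival (IAdd e e') s = ival e s + ival e' s"
| "ival (ISub e e') s = ival e s - ival e' s"

fun rval :: "rexp \<Rightarrow> ram \<Rightarrow> real" where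
  "rval (RRat q) s = of_rat q"
| "rval (RVar a i j) s = reals s a (ival i s) (ival j s)"
| "rval (ROfNat e) s = real (ival e s)"
| "rval (RAdd e e') s = rval e s + rval e' s"
| "rval (RSub e e') s = rval e s - rval e' s"
| "rval (RMul e e') s = rval e s * rval e' s"
| "rval (RDiv e e') s = rval e s / rval e' s"

fun bval :: "bexp \<Rightarrow> ram \<Rightarrow> bool" where
  "bval (ILess e e') s \<longleftrightarrow> ival e s < ival e' s"
| "bval (RLess e e') s \<longleftrightarrow> rval e s < rval e' s"
| "bval (BNot b) s \<longleftrightarrow> \<not> bval b s"
| "bval (BAnd b b') s \<longleftrightarrow> bval b s \<and> bval b' s"

definition upd :: "(string \<Rightarrow> nat \<Rightarrow> nat \<Rightarrow> 'a) \<Rightarrow> string \<Rightarrow> nat \<Rightarrow> nat \<Rightarrow> 'a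
    \<Rightarrow> (string \<Rightarrow> nat \<Rightarrow> nat \<Rightarrow> 'a)" where
  "upd m a i j v = m(a := (m a)(i := (m a i)(j := v)))"

text \<open>
  exec c s t s': started in memory s, the program c halts in memory s' after t steps.  Every
  assignment and every evaluation of a guard costs one step; expressions are part of the program
  text, so this is the number of elementary operations up to a factor depending on the program only.
\<close>

inductive exec :: "com \<Rightarrow> ram \<Rightarrow> nat \<Rightarrow> ram \<Rightarrow> bool" where
  "exec Skip s 1 s"
| "exec (IAssign a i j e) s 1 (s\<lparr>ints := upd (ints s) a (ival i s) (ival j s) (ival e s)\<rparr>)"
| "exec (RAssign a i j e) s 1 (s\<lparr>reals := upd (reals s) a (ival i s) (ival j s) (rval e s)\<rparr>)"
| "exec c s t s' \<Longrightarrow> exec c' s' t' s'' \<Longrightarrow> exec (Seq c c') s (t + t') s''"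
| "bval b s \<Longrightarrow> exec c s t s' \<Longrightarrow> exec (If b c c') s (Suc t) s'"
| "\<not> bval b s \<Longrightarrow> exec c' s t s' \<Longrightarrow> exec (If b c c') s (Suc t) s'"
| "\<not> bval b s \<Longrightarrow> exec (While b c) s 1 s"
| "bval b s \<Longrightarrow> exec c s t s' \<Longrightarrow> exec (While b c) s' t' s''
    \<Longrightarrow> exec (While b c) s (Suc (t + t')) s''"

lemma exec_deterministic:
  "exec c s t s' \<Longrightarrow> exec c s u s'' \<Longrightarrow> t = u \<and> s' = s''"
proof (induction arbitrary: u s'' rule: exec.induct)
  case (4 c s t s' c' t' s2)
  obtain t1 s1 t2 where "exec c s t1 s1" "exec c' s1 t2 s''" "u = t1 + t2"
    using "4.prems" by (rule exec.cases) simp_all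
  then show ?case using "4.IH" by metis
next
  case (5 b s c t s' c')
  obtain t1 where "exec c s t1 s''" "u = Suc t1"
    using "5.prems" "5.hyps" by (auto elim: exec.cases)
  then show ?case using "5.IH" by metis
next
  case (6 b s c' t s' c)
  obtain t1 where "exec c' s t1 s''" "u = Suc t1"
    using "6.prems" "6.hyps" by (auto elim: exec.cases)
  then show ?case using "6.IH" by metis
next
  case (8 b s c t s' t' s2)
  obtain t1 s1 t2 where "exec c s t1 s1" "exec (While b c) s1 t2 s''" "u = Suc (t1 + t2)"
    using "8.prems" "8.hyps"(1) by (auto elim: exec.cases)
  then show ?case using "8.IH" by metis
qed (auto elim: exec.cases)

definition halts_within :: "com \<Rightarrow> ram \<Rightarrow> real \<Rightarrow> bool" where
  "halts_within c s T \<longleftrightarrow> (\<exists>t s'. exec c s t s' \<and> real t \<le> T)"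

text \<open>Only used for programs that halt on s; the result is then unique by the lemma above.\<close>

definition final :: "com \<Rightarrow> ram \<Rightarrow> ram" where
  "final c s = (THE s'. \<exists>t. exec c s t s')"

section \<open>Points, Gaussian marginal, halfspaces\<close>

text \<open>
  Since one algorithm must serve all dimensions, a point of d-dimensional space is a function
  nat \<Rightarrow> real, extensional on \<open>{..<d}\<close>.
\<close>

definition std_gaussian :: "nat \<Rightarrow> (nat \<Rightarrow> real) measure" where
  "std_gaussian d = (\<Pi>\<^sub>M i\<in>{..<d}. std_normal_distribution)"

definition sgn_pm :: "real \<Rightarrow> real" where
  "sgn_pm t = (if t \<ge> 0 then 1 else -1)"

definition halfspaces :: "nat \<Rightarrow> ((nat \<Rightarrow> real) \<Rightarrow> real) set" where
  "halfspaces d = {\<lambda>x. sgn_pm ((\<Sum>i<d. v i * x i) - \<tau>) | v \<tau>. (\<Sum>i<d. (v i)\<^sup>2) = 1}"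

section \<open>Realizable TDS learning\<close>

definition labelled :: "'a measure \<Rightarrow> ('a \<Rightarrow> real) \<Rightarrow> ('a \<times> real) measure" where
  "labelled D f = distr D (D \<Otimes>\<^sub>M count_space {-1, 1}) (\<lambda>x. (x, f x))"

text \<open>The law of the pair (training sample, test sample), n independent draws each.\<close>

definition samples :: "nat \<Rightarrow> 'a measure \<Rightarrow> 'a measure \<Rightarrow> ('a \<Rightarrow> real)
    \<Rightarrow> ((nat \<Rightarrow> 'a \<times> real) \<times> (nat \<Rightarrow> 'a)) measure" where
  "samples n D D' f = (\<Pi>\<^sub>M i\<in>{..<n}. labelled D f) \<Otimes>\<^sub>M (\<Pi>\<^sub>M i\<in>{..<n}. D')"

text \<open>
  None means reject, Some h means accept and output h.  A nonmeasurable set has measure 0, so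
  measurability of the error region is demanded explicitly; all other events occur in lower bounds,
  where the value 0 is harmless.
\<close>

definition tds_learner :: "((nat \<Rightarrow> 'a \<times> real) \<Rightarrow> (nat \<Rightarrow> 'a) \<Rightarrow> ('a \<Rightarrow> real) option)
    \<Rightarrow> nat \<Rightarrow> ('a \<Rightarrow> real) set \<Rightarrow> 'a measure \<Rightarrow> real \<Rightarrow> real \<Rightarrow> bool" where
  "tds_learner A n \<C> D \<epsilon> \<delta> \<longleftrightarrow>
    (\<forall>f\<in>\<C>.
      (\<forall>D'. prob_space D' \<and> sets D' = sets D \<longrightarrow>
        \<P>((S, X) in samples n D D' f.
          \<forall>h. A S X = Some h \<longrightarrow>
            {x \<in> space D'. h x \<noteq> f x} \<in> sets D' \<and> \<P>(x in D'. h x \<noteq> f x) \<le> \<epsilon>) \<ge> 1 - \<delta>) \<and>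
      \<P>((S, X) in samples n D D f. A S X \<noteq> None) \<ge> 1 - \<delta>)"

section \<open>Real RAM programs as learning algorithms\<close>

text \<open>
  A learning algorithm is a pair of programs.  The learner L halts in a memory that holds its decision
  and, if it accepts, a description of the hypothesis h.  The evaluator H, started in that memory with
  a point x added, computes h(x).  Both programs are run-time bounded, so that the description is one
  from which labels can be computed efficiently.
\<close>

definition input :: "nat \<Rightarrow> nat \<Rightarrow> real \<Rightarrow> (nat \<Rightarrow> (nat \<Rightarrow> real) \<times> real)
    \<Rightarrow> (nat \<Rightarrow> nat \<Rightarrow> real) \<Rightarrow> ram" where
  "input d n \<epsilon> S X =
    \<lparr>ints = (\<lambda>_ _ _. 0)
       (''d'' := (\<lambda>i j. if i = 0 \<and> j = 0 then d else 0),
        ''n'' := (\<lambda>i j. if i = 0 \<and> j = 0 then n else 0)),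
     reals = (\<lambda>_ _ _. 0)
       (''eps'' := (\<lambda>i j. if i = 0 \<and> j = 0 then \<epsilon> else 0),
        ''train'' := (\<lambda>i j. if i < n \<and> j < d then fst (S i) j else 0),
        ''label'' := (\<lambda>i j. if i < n \<and> j = 0 then snd (S i) else 0),
        ''test'' := (\<lambda>i j. if i < n \<and> j < d then X i j else 0))\<rparr>"

definition accepting :: "ram \<Rightarrow> bool" where
  "accepting s \<longleftrightarrow> ints s ''accept'' 0 0 \<noteq> 0"

definition load_point :: "nat \<Rightarrow> (nat \<Rightarrow> real) \<Rightarrow> ram \<Rightarrow> ram" where
  "load_point d x s = s\<lparr>reals := (reals s)(''x'' := (\<lambda>i j. if i = 0 \<and> j < d then x j else 0))\<rparr>"

definition hypothesis :: "com \<Rightarrow> nat \<Rightarrow> ram \<Rightarrow> (nat \<Rightarrow> real) \<Rightarrow> real" where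
  "hypothesis H d s x = (if ints (final H (load_point d x s)) ''out'' 0 0 \<noteq> 0 then 1 else -1)"

definition learn :: "com \<Rightarrow> com \<Rightarrow> nat \<Rightarrow> nat \<Rightarrow> real \<Rightarrow> (nat \<Rightarrow> (nat \<Rightarrow> real) \<times> real)
    \<Rightarrow> (nat \<Rightarrow> nat \<Rightarrow> real) \<Rightarrow> ((nat \<Rightarrow> real) \<Rightarrow> real) option" where
  "learn L H d n \<epsilon> S X =
    (let s = final L (input d n \<epsilon> S X)
     in if accepting s then Some (hypothesis H d s) else None)"

text \<open>Worst-case run-time over all samples of n points with labels in \<open>{-1, 1}\<close>.\<close>

definition runs_within :: "com \<Rightarrow> com \<Rightarrow> nat \<Rightarrow> nat \<Rightarrow> real \<Rightarrow> real \<Rightarrow> bool" where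
  "runs_within L H d n \<epsilon> T \<longleftrightarrow>
    (\<forall>S X. (\<forall>i<n. snd (S i) \<in> {-1, 1}) \<longrightarrow>
      halts_within L (input d n \<epsilon> S X) T \<and>
      (let s = final L (input d n \<epsilon> S X)
       in accepting s \<longrightarrow> (\<forall>x. halts_within H (load_point d x s) T)))"

section \<open>Well-formedness of the sample space\<close>

lemma prob_space_std_gaussian: "prob_space (std_gaussian d)"
  unfolding std_gaussian_def
  by (intro prob_space_PiM prob_space_normal_density) simp

lemma measurable_label:
  assumes "f \<in> halfspaces d"
  shows "(\<lambda>x. (x, f x)) \<in> std_gaussian d \<rightarrow>\<^sub>M std_gaussian d \<Otimes>\<^sub>M count_space {-1, 1}"
proof -
  obtain v \<tau> where f: "f = (\<lambda>x. sgn_pm ((\<Sum>i<d. v i * x i) - \<tau>))"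
    using assms by (auto simp: halfspaces_def)
  have "sets (std_gaussian d) = sets (PiM {..<d} (\<lambda>_. borel :: real measure))"
    unfolding std_gaussian_def by (intro sets_PiM_cong) auto
  then have [measurable]: "(\<lambda>x. x i) \<in> borel_measurable (std_gaussian d)" if "i < d" for i
    using measurable_component_singleton[of i "{..<d}" "\<lambda>_. borel :: real measure"] that
    by (simp cong: measurable_cong_sets)
  have "(\<lambda>x. (\<Sum>i<d. v i * x i) - \<tau>) \<in> borel_measurable (std_gaussian d)"
    by measurable
  then have "f \<in> std_gaussian d \<rightarrow>\<^sub>M count_space {-1, 1}"
    unfolding f sgn_pm_def by measurable
  then show ?thesis
    by measurable
qed

lemma prob_space_samples:
  assumes "f \<in> halfspaces d" "prob_space D'"
  shows "prob_space (samples n (std_gaussian d) D' f)"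
proof -
  have l: "prob_space (labelled (std_gaussian d) f)"
    unfolding labelled_def
    by (rule prob_space.prob_space_distr[OF prob_space_std_gaussian measurable_label[OF assms(1)]])
  show ?thesis
    unfolding samples_def by (intro prob_space_pair prob_space_PiM l assms(2))
qed

end

theory Submission
  imports Defs "HOL-Real_Asymp.Real_Asymp"
begin

text \<open>
  For \<open>f x = sign (v \<bullet> x - \<tau>)\<close> and Gaussian x, \<open>E (f x * x) = c v\<close> and
  \<open>E (f x * (\<bar>x\<bar>\<^sup>2 - d)) = c \<tau>\<close> with \<open>c = 2 \<phi>(\<tau>) > 0\<close>, so these two expectations, estimated by
  averages, describe f without normalisation.  A point on which the estimated halfspace and f
  disagree has a margin small enough to be recognised without its label, so the learner may count
  such points in the test sample.

  If \<open>\<bar>\<tau>\<bar>\<close> is too large for the estimate to be useful, almost all training labels agree, and the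
  constant hypothesis is wrong only where \<open>\<bar>v \<bullet> x\<bar>\<close> is large.  On the test sample this is rare
  provided that its moment tensor of degree \<open>2k = O(log (1/\<epsilon>))\<close> is close to that of the training
  sample; the squared distance of the tensors is a double sum of powers of inner products, hence
  computable without enumerating monomials.

  If \<open>\<epsilon>\<close> is close to 1, the run-time bound does not even allow to read a whole point.  Then the first
  coordinate is cut into cells, every cell gets a random label taken from the training sample, and
  the learner rejects if two test points share a cell.  If no cell carries much test mass, then the
  random labelling agrees with f on at least a quarter of it.
\<close>

section \<open>Time-bounded reasoning on the real RAM\<close>

text \<open>Everything is tuned to \<open>k = deg \<epsilon>\<close> and to an overlap of the two
  regimes of the threshold. If the square of \<open>\<tau>\<close> is at most 64k, then
  \<open>amp\<close> is at least of order exp(-32k), and about 2^(131k) d^3 samples separate signal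
  from sampling noise outside a set of Gaussian mass \<open>\<epsilon> / 2000\<close>; this dictates
  the exponent 150. If it is larger, the rare label has mass at most 65536^(-k), far below the rate
  16384^(-k) that the learner tests. Conversely, once the rare label is observed at most at that
  rate, with high probability all its points satisfy (v . x)^2 \<ge> 4k, and a moment of size (2k)^k
  against (4k)^k leaves only a fraction of order 2^(-k) of such points in the test sample. The
  regime matters for completeness only. For soundness nothing is known about the test marginal, so
  for \<open>\<epsilon> < 3 / 4\<close> each acceptance condition bounds the disagreements on the
  test sample itself. Each candidate hypothesis depends on the training sample alone, but the choice
  among them also depends on the test sample; hence the generalisation bound is taken for every
  candidate.\<close>

definition runs :: "com \<Rightarrow> ram \<Rightarrow> nat \<Rightarrow> (ram \<Rightarrow> bool) \<Rightarrow> bool" where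
  "runs c s T Q \<longleftrightarrow> (\<exists>t s'. exec c s t s' \<and> t \<le> T \<and> Q s')"

fun iwrites :: "com \<Rightarrow> string set" where
  "iwrites Skip = {}"
| "iwrites (IAssign a i j e) = {a}"
| "iwrites (RAssign a i j e) = {}"
| "iwrites (Seq c c') = iwrites c \<union> iwrites c'"
| "iwrites (If b c c') = iwrites c \<union> iwrites c'"
| "iwrites (While b c) = iwrites c"

fun rwrites :: "com \<Rightarrow> string set" where
  "rwrites Skip = {}"
| "rwrites (IAssign a i j e) = {}"
| "rwrites (RAssign a i j e) = {a}"
| "rwrites (Seq c c') = rwrites c \<union> rwrites c'"
| "rwrites (If b c c') = rwrites c \<union> rwrites c'"
| "rwrites (While b c) = rwrites c"

text \<open>Frame condition at the granularity of whole arrays: \<open>iwrites\<close> and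
  \<open>rwrites\<close> are syntactic, so an indirectly addressed write counts against its entire
  array and no reasoning about indices is needed.\<close>

definition agree_off :: "string set \<Rightarrow> string set \<Rightarrow> ram \<Rightarrow> ram \<Rightarrow> bool" where
  "agree_off V W s s' \<longleftrightarrow>
    (\<forall>a. a \<notin> V \<longrightarrow> ints s' a = ints s a) \<and> (\<forall>a. a \<notin> W \<longrightarrow> reals s' a = reals s a)"

lemma agree_off_trans:
  "agree_off V W s s' \<Longrightarrow> agree_off V' W' s' s'' \<Longrightarrow> V \<subseteq> U \<Longrightarrow> V' \<subseteq> U \<Longrightarrow> W \<subseteq> Z \<Longrightarrow> W' \<subseteq> Z
    \<Longrightarrow> agree_off U Z s s''"
  unfolding agree_off_def by (metis subsetD)

lemma exec_agree_off: "exec c s t s' \<Longrightarrow> agree_off (iwrites c) (rwrites c) s s'"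
proof (induction rule: exec.induct)
  case (8 b s c t s' t' s'')
  then show ?case by (auto intro: agree_off_trans)
next
  case (4 c s t s' c' t' s'')
  then show ?case by (auto intro: agree_off_trans)
qed (auto simp: agree_off_def upd_def)

lemma runs_agree_off:
  "runs c s T Q \<Longrightarrow> runs c s T (\<lambda>s'. Q s' \<and> agree_off (iwrites c) (rwrites c) s s')"
  unfolding runs_def using exec_agree_off by blast

lemma runs_mono: "runs c s T Q \<Longrightarrow> T \<le> T' \<Longrightarrow> (\<And>s'. Q s' \<Longrightarrow> Q' s') \<Longrightarrow> runs c s T' Q'"
  unfolding runs_def using le_trans by blast

lemma runs_Skip: "Q s \<Longrightarrow> 1 \<le> T \<Longrightarrow> runs Skip s T Q"
  unfolding runs_def using exec.intros(1) by blast

lemma runs_IAssign: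
  "Q (s\<lparr>ints := upd (ints s) a (ival i s) (ival j s) (ival e s)\<rparr>) \<Longrightarrow> 1 \<le> T
    \<Longrightarrow> runs (IAssign a i j e) s T Q"
  unfolding runs_def using exec.intros(2) by blast

lemma runs_RAssign:
  "Q (s\<lparr>reals := upd (reals s) a (ival i s) (ival j s) (rval e s)\<rparr>) \<Longrightarrow> 1 \<le> T
    \<Longrightarrow> runs (RAssign a i j e) s T Q"
  unfolding runs_def using exec.intros(3) by blast

text \<open>The continuation is handed the frame of \<open>c\<close> together with \<open>R\<close>,
  so an intermediate assertion records only what \<open>c\<close> computes and never repeats what it
  leaves alone.\<close>

lemma runs_Seq:
  assumes "runs c s T1 R"
    and "\<And>s'. R s' \<Longrightarrow> agree_off (iwrites c) (rwrites c) s s' \<Longrightarrow> runs c' s' T2 Q"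
    and "T1 + T2 \<le> T"
  shows "runs (Seq c c') s T Q"
proof -
  obtain t s' where 1: "exec c s t s'" "t \<le> T1" "R s'"
    using assms(1) by (auto simp: runs_def)
  obtain t' s'' where 2: "exec c' s' t' s''" "t' \<le> T2" "Q s''"
    using assms(2)[OF 1(3) exec_agree_off[OF 1(1)]] by (auto simp: runs_def)
  show ?thesis
    unfolding runs_def using exec.intros(4)[OF 1(1) 2(1)] 1(2) 2(2,3) assms(3) by fastforce
qed

lemma runs_If:
  assumes "bval b s \<Longrightarrow> runs c s T Q" and "\<not> bval b s \<Longrightarrow> runs c' s T Q" and "Suc T \<le> T'"
  shows "runs (If b c c') s T' Q"
proof (cases "bval b s")
  case True
  then obtain t s' where "exec c s t s'" "t \<le> T" "Q s'"
    using assms(1) by (auto simp: runs_def)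
  then show ?thesis
    unfolding runs_def using exec.intros(5)[OF True] assms(3) by (meson Suc_le_mono le_trans)
next
  case False
  then obtain t s' where "exec c' s t s'" "t \<le> T" "Q s'"
    using assms(2) by (auto simp: runs_def)
  then show ?thesis
    unfolding runs_def using exec.intros(6)[OF False] assms(3) by (meson Suc_le_mono le_trans)
qed

abbreviation iscal :: "string \<Rightarrow> iexp" where
  "iscal a \<equiv> IVar a (INum 0) (INum 0)"

abbreviation rscal :: "string \<Rightarrow> rexp" where
  "rscal a \<equiv> RVar a (INum 0) (INum 0)"

abbreviation iset :: "string \<Rightarrow> iexp \<Rightarrow> com" where
  "iset a \<equiv> IAssign a (INum 0) (INum 0)"

abbreviation rset :: "string \<Rightarrow> rexp \<Rightarrow> com" where
  "rset a \<equiv> RAssign a (INum 0) (INum 0)"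

definition For :: "string \<Rightarrow> iexp \<Rightarrow> com \<Rightarrow> com" where
  "For x e c = Seq (iset x (INum 0))
    (While (ILess (iscal x) e) (Seq c (iset x (IAdd (iscal x) (INum 1)))))"

lemma iwrites_For [simp]: "iwrites (For x e c) = insert x (iwrites c)"
  by (auto simp: For_def)

lemma rwrites_For [simp]: "rwrites (For x e c) = rwrites c"
  by (auto simp: For_def)

text \<open>The counter is incremented after the body, so the invariant is indexed from outside and,
  by \<open>indep\<close>, insensitive to the counter; the body learns its value from a separate
  premise. Each round pays for the guard and the increment besides \<open>T\<close>, and 2 pays for
  the initialisation and the last guard.\<close>

lemma runs_For:
  assumes x: "x \<notin> iwrites c"
    and bound: "\<And>s'. agree_off (insert x (iwrites c)) (rwrites c) s s' \<Longrightarrow> ival e s' = N"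
    and init: "I 0 s"
    and indep: "\<And>i s' k. I i s' \<Longrightarrow> I i (s'\<lparr>ints := upd (ints s') x 0 0 k\<rparr>)"
    and step: "\<And>i s'. i < N \<Longrightarrow> agree_off (insert x (iwrites c)) (rwrites c) s s' \<Longrightarrow>
      ints s' x 0 0 = i \<Longrightarrow> I i s' \<Longrightarrow> runs c s' T (I (Suc i))"
    and time: "2 + N * (T + 2) \<le> T'"
  shows "runs (For x e c) s T' (I N)"
proof -
  let ?A = "agree_off (insert x (iwrites c)) (rwrites c) s"
  let ?W = "While (ILess (iscal x) e) (Seq c (iset x (IAdd (iscal x) (INum 1))))"
  \<comment> \<open>Induction on the number \<open>m\<close> of remaining rounds, with the counter
    at \<open>N - m\<close>.\<close>
  have loop: "runs ?W s' (1 + m * (T + 2)) (I N)"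
    if "?A s'" "ints s' x 0 0 = i" "I i s'" "i + m = N" for i m s'
    using that
  proof (induction m arbitrary: i s')
    case 0
    then have "\<not> bval (ILess (iscal x) e) s'"
      using bound by auto
    from exec.intros(7)[OF this] show ?case
      using 0 unfolding runs_def by auto
  next
    case (Suc m)
    from Suc.prems have b: "bval (ILess (iscal x) e) s'"
      using bound by auto
    obtain t s1 where s1: "exec c s' t s1" "t \<le> T" "I (Suc i) s1"
      using step[of i s'] Suc.prems by (auto simp: runs_def)
    have a1: "agree_off (iwrites c) (rwrites c) s' s1"
      using exec_agree_off[OF s1(1)] .
    have i1: "ints s1 x 0 0 = i"
      using a1 x Suc.prems(2) by (simp add: agree_off_def)
    define s2 where "s2 = s1\<lparr>ints := upd (ints s1) x 0 0 (Suc i)\<rparr>"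
    have e2: "exec (Seq c (iset x (IAdd (iscal x) (INum 1)))) s' (t + 1) s2"
      using exec.intros(4)[OF s1(1) exec.intros(2)[of x "INum 0" "INum 0" "IAdd (iscal x) (INum 1)"]]
      by (simp add: s2_def i1)
    have "?A s2"
      using Suc.prems(1) a1 by (auto simp: agree_off_def s2_def upd_def)
    moreover have "ints s2 x 0 0 = Suc i" "I (Suc i) s2"
      using indep s1(3) by (auto simp: s2_def upd_def)
    ultimately obtain t' s3 where s3: "exec ?W s2 t' s3" "t' \<le> 1 + m * (T + 2)" "I N s3"
      using Suc.IH[of s2 "Suc i"] Suc.prems(4) by (auto simp: runs_def)
    from exec.intros(8)[OF b e2 s3(1)] have "exec ?W s' (Suc (t + 1 + t')) s3" .
    moreover have "Suc (t + 1 + t') \<le> 1 + Suc m * (T + 2)"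
      using s1(2) s3(2) by simp
    ultimately show ?case
      using s3(3) unfolding runs_def by blast
  qed
  show ?thesis
    unfolding For_def
  proof (rule runs_Seq)
    show "runs (iset x (INum 0)) s 1
        (\<lambda>s'. s' = s\<lparr>ints := upd (ints s) x 0 0 0\<rparr>)"
      by (rule runs_IAssign) auto
    show "runs ?W s' (1 + N * (T + 2)) (I N)"
      if "s' = s\<lparr>ints := upd (ints s) x 0 0 0\<rparr>" for s'
      using loop[of s' 0 N] indep[OF init, of 0] that by (auto simp: agree_off_def upd_def)
  qed (use time in simp)
qed

lemma upd_apply [simp]:
  "upd m a i j v a' = (if a' = a then (m a)(i := (m a i)(j := v)) else m a')"
  by (simp add: upd_def)

section \<open>The subroutines of the learner\<close>

fun ivars :: "iexp \<Rightarrow> string set" where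
  "ivars (INum k) = {}"
| "ivars (IVar a i j) = insert a (ivars i \<union> ivars j)"
| "ivars (IAdd e e') = ivars e \<union> ivars e'"
| "ivars (ISub e e') = ivars e \<union> ivars e'"

lemma ival_agree_off:
  "agree_off V W s s' \<Longrightarrow> ivars e \<inter> V = {} \<Longrightarrow> ival e s' = ival e s"
  by (induction e) (simp_all add: agree_off_def Int_Un_distrib2)

definition dot_prog :: "string \<Rightarrow> string \<Rightarrow> iexp \<Rightarrow> string \<Rightarrow> iexp \<Rightarrow> com" where
  "dot_prog a u i v j = Seq (rset a (RRat 0)) (For ''l'' (iscal ''d'')
    (rset a (RAdd (rscal a) (RMul (RVar u i (iscal ''l'')) (RVar v j (iscal ''l''))))))"

lemma writes_dot_prog [simp]:
  "iwrites (dot_prog a u i v j) = {''l''}" "rwrites (dot_prog a u i v j) = {a}"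
  by (auto simp: dot_prog_def)

text \<open>The row expressions \<open>i\<close> and \<open>j\<close> are evaluated again in every
  round while the loop overwrites \<open>''l''\<close>; hence the conditions on
  \<open>ivars\<close>.\<close>

lemma runs_dot_prog:
  assumes "a \<noteq> u" "a \<noteq> v" "''l'' \<notin> ivars i" "''l'' \<notin> ivars j" "ints s ''d'' 0 0 = d" "5 + 3 * d \<le> T"
  shows "runs (dot_prog a u i v j) s T
    (\<lambda>s'. reals s' a 0 0 = (\<Sum>l<d. reals s u (ival i s) l * reals s v (ival j s) l))"
  unfolding dot_prog_def
proof (rule runs_Seq)
  let ?c = "rset a (RRat 0)"
  show "runs ?c s 1 (\<lambda>s'. reals s' a 0 0 = 0)"
    by (rule runs_RAssign) auto
  fix s1 assume a0: "reals s1 a 0 0 = 0" and "agree_off (iwrites ?c) (rwrites ?c) s s1"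
  then have A: "agree_off {} {a} s s1" by simp
  have ij: "ival i s1 = ival i s" "ival j s1 = ival j s"
    by (rule ival_agree_off[OF A]; simp)+
  have uv: "reals s1 u = reals s u" "reals s1 v = reals s v" "ints s1 ''d'' 0 0 = d"
    using A assms by (auto simp: agree_off_def)
  show "runs (For ''l'' (iscal ''d'')
      (rset a (RAdd (rscal a) (RMul (RVar u i (iscal ''l'')) (RVar v j (iscal ''l'')))))) s1 (2 + d * 3)
    (\<lambda>s'. reals s' a 0 0 = (\<Sum>l<d. reals s u (ival i s) l * reals s v (ival j s) l))"
  proof (rule runs_For[where T = 1 and N = d and
      I = "\<lambda>k s'. reals s' a 0 0 = (\<Sum>l<k. reals s u (ival i s) l * reals s v (ival j s) l)"])
    fix k s2
    assume B: "agree_off (insert ''l'' (iwrites (rset a (RAdd (rscal a) (RMul (RVar u i (iscal ''l'')) (RVar v j (iscal ''l'')))))))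
       (rwrites (rset a (RAdd (rscal a) (RMul (RVar u i (iscal ''l'')) (RVar v j (iscal ''l'')))))) s1 s2"
      and k: "ints s2 ''l'' 0 0 = k"
      and I: "reals s2 a 0 0 = (\<Sum>l<k. reals s u (ival i s) l * reals s v (ival j s) l)"
    then have B: "agree_off {''l''} {a} s1 s2" by simp
    have "ival i s2 = ival i s" "ival j s2 = ival j s"
      using ij assms by (auto simp: ival_agree_off[OF B])
    moreover have "reals s2 u = reals s u" "reals s2 v = reals s v"
      using B uv assms by (auto simp: agree_off_def)
    ultimately show "runs (rset a (RAdd (rscal a) (RMul (RVar u i (iscal ''l'')) (RVar v j (iscal ''l'')))))
          s2 1 (\<lambda>s'. reals s' a 0 0 = (\<Sum>l<Suc k. reals s u (ival i s) l * reals s v (ival j s) l))"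
      using I k by (intro runs_RAssign) auto
  qed (use a0 uv in \<open>auto simp: agree_off_def\<close>)
qed (use assms in auto)

definition kernel_prog :: "string \<Rightarrow> string \<Rightarrow> string \<Rightarrow> com" where
  "kernel_prog p u v = Seq (dot_prog ''a'' u (iscal ''i'') v (iscal ''j''))
    (Seq (rset p (RRat 1)) (For ''l'' (IAdd (iscal ''k'') (iscal ''k''))
      (rset p (RMul (rscal p) (RDiv (rscal ''a'') (ROfNat (IAdd (iscal ''k'') (iscal ''k''))))))))"

lemma writes_kernel_prog [simp]:
  "iwrites (kernel_prog p u v) = {''l''}" "rwrites (kernel_prog p u v) = {''a'', p}"
  by (auto simp: kernel_prog_def)

text \<open>Gaussian moments of degree 2k in a fixed direction are at most \<open>(2k)^k\<close>; dividing by 2k makes this the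
  unit of measurement of the discrepancy.\<close>

definition kernel :: "nat \<Rightarrow> nat \<Rightarrow> (nat \<Rightarrow> real) \<Rightarrow> (nat \<Rightarrow> real) \<Rightarrow> real" where
  "kernel d k x y = ((\<Sum>l<d. x l * y l) / real (2 * k)) ^ (2 * k)"

lemma runs_kernel_prog:
  assumes "''a'' \<noteq> u" "''a'' \<noteq> v" "p \<noteq> ''a''" "ints s ''d'' 0 0 = d" "ints s ''k'' 0 0 = k"
    "8 + 3 * d + 6 * k \<le> T"
  shows "runs (kernel_prog p u v) s T
    (\<lambda>s'. reals s' p 0 0 = kernel d k (reals s u (ints s ''i'' 0 0)) (reals s v (ints s ''j'' 0 0)))"
  unfolding kernel_prog_def
proof (rule runs_Seq[OF runs_dot_prog[OF _ _ _ _ assms(4) order.refl]])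
  let ?D = "\<Sum>l<d. reals s u (ival (iscal ''i'') s) l * reals s v (ival (iscal ''j'') s) l"
  let ?b = "rset p (RMul (rscal p) (RDiv (rscal ''a'') (ROfNat (IAdd (iscal ''k'') (iscal ''k'')))))"
  let ?d = "dot_prog ''a'' u (iscal ''i'') v (iscal ''j'')"
  fix s1 assume D: "reals s1 ''a'' 0 0 = ?D" and "agree_off (iwrites ?d) (rwrites ?d) s s1"
  then have A: "ints s1 ''k'' 0 0 = k" using assms by (auto simp: agree_off_def)
  show "runs (Seq (rset p (RRat 1)) (For ''l'' (IAdd (iscal ''k'') (iscal ''k'')) ?b)) s1 (3 + 6 * k)
      (\<lambda>s'. reals s' p 0 0 = kernel d k (reals s u (ints s ''i'' 0 0)) (reals s v (ints s ''j'' 0 0)))"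
  proof (rule runs_Seq)
    show "runs (rset p (RRat 1)) s1 1 (\<lambda>s'. reals s' p 0 0 = 1)"
      by (rule runs_RAssign) auto
    fix s2 assume p1: "reals s2 p 0 0 = 1"
      and "agree_off (iwrites (rset p (RRat 1))) (rwrites (rset p (RRat 1))) s1 s2"
    then have B: "ints s2 ''k'' 0 0 = k" "reals s2 ''a'' 0 0 = ?D"
      using A D assms by (auto simp: agree_off_def)
    have "runs (For ''l'' (IAdd (iscal ''k'') (iscal ''k'')) ?b) s2 (2 + 6 * k)
      (\<lambda>s'. reals s' p 0 0 = (?D / real (2 * k)) ^ (2 * k))"
    proof (rule runs_For[where T = 1 and N = "2 * k" and I = "\<lambda>i s'. reals s' p 0 0 = (?D / real (2 * k)) ^ i"])
      fix i s3
      assume C: "agree_off (insert ''l'' (iwrites ?b)) (rwrites ?b) s2 s3"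
        and p: "reals s3 p 0 0 = (?D / real (2 * k)) ^ i"
      have "ints s3 ''k'' 0 0 = k" "reals s3 ''a'' 0 0 = ?D"
        using C B assms by (auto simp: agree_off_def)
      then show "runs ?b s3 1 (\<lambda>s'. reals s' p 0 0 = (?D / real (2 * k)) ^ Suc i)"
        using p by (intro runs_RAssign) (simp_all add: mult_2[symmetric])
    qed (use p1 B in \<open>auto simp: agree_off_def\<close>)
    then show "runs (For ''l'' (IAdd (iscal ''k'') (iscal ''k'')) ?b) s2 (2 + 6 * k)
      (\<lambda>s'. reals s' p 0 0 = kernel d k (reals s u (ints s ''i'' 0 0)) (reals s v (ints s ''j'' 0 0)))"
      by (simp add: kernel_def)
  qed simp
qed (use assms in auto)

definition mmd_prog :: com where
  "mmd_prog = Seq (rset ''t'' (RRat 0)) (For ''i'' (iscal ''n'') (For ''j'' (iscal ''n'')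
    (Seq (kernel_prog ''f'' ''test'' ''test'') (Seq (kernel_prog ''g'' ''test'' ''train'')
    (Seq (kernel_prog ''h'' ''train'' ''train'')
      (rset ''t'' (RAdd (rscal ''t'') (RAdd (RSub (rscal ''f'') (RMul (RRat 2) (rscal ''g''))) (rscal ''h'')))))))))"

lemma writes_mmd_prog [simp]:
  "iwrites mmd_prog = {''i'', ''j'', ''l''}" "rwrites mmd_prog = {''t'', ''a'', ''f'', ''g'', ''h''}"
  by (auto simp: mmd_prog_def)

text \<open>This is n squared times the empirical (V-statistic) squared maximum mean discrepancy of
  the two samples for the polynomial \<open>kernel\<close>. Working with sums instead of averages
  makes n squared the natural threshold.\<close>

definition mmd :: "nat \<Rightarrow> nat \<Rightarrow> nat \<Rightarrow> (nat \<Rightarrow> nat \<Rightarrow> real) \<Rightarrow> (nat \<Rightarrow> nat \<Rightarrow> real) \<Rightarrow> real" where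
  "mmd d k n x z = (\<Sum>i<n. \<Sum>j<n.
    kernel d k (z i) (z j) - 2 * kernel d k (z i) (x j) + kernel d k (x i) (x j))"

lemma runs_mmd_prog:
  assumes s: "ints s ''d'' 0 0 = d" "ints s ''k'' 0 0 = k" "ints s ''n'' 0 0 = n"
    and T: "3 + n * (4 + n * (27 + 9 * d + 18 * k)) \<le> T"
  shows "runs mmd_prog s T (\<lambda>s'. reals s' ''t'' 0 0 = mmd d k n (reals s ''train'') (reals s ''test''))"
  unfolding mmd_prog_def
proof (rule runs_Seq)
  let ?x = "reals s ''train''" and ?z = "reals s ''test''"
  let ?b = "(Seq (kernel_prog ''f'' ''test'' ''test'') (Seq (kernel_prog ''g'' ''test'' ''train'')
    (Seq (kernel_prog ''h'' ''train'' ''train'')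
      (rset ''t'' (RAdd (rscal ''t'') (RAdd (RSub (rscal ''f'') (RMul (RRat 2) (rscal ''g''))) (rscal ''h'')))))))"
  let ?V = "{''i'', ''j'', ''l''}" and ?W = "{''t'', ''a'', ''f'', ''g'', ''h''}"
  define t where "t i j = kernel d k (?z i) (?z j) - 2 * kernel d k (?z i) (?x j) + kernel d k (?x i) (?x j)" for i j
  show "runs (rset ''t'' (RRat 0)) s 1 (\<lambda>s'. reals s' ''t'' 0 0 = 0)"
    by (rule runs_RAssign) auto
  fix s1 assume t0: "reals s1 ''t'' 0 0 = 0"
    and "agree_off (iwrites (rset ''t'' (RRat 0))) (rwrites (rset ''t'' (RRat 0))) s s1"
  then have A: "agree_off ?V ?W s s1" by (auto simp: agree_off_def)
  \<comment> \<open>Three kernel evaluations at \<open>8 + 3 * d + 6 * k\<close> each, plus one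
    assignment.\<close>
  have body: "runs ?b s2 (25 + 9 * d + 18 * k) (\<lambda>s'. reals s' ''t'' 0 0 = r + t i j)"
    if B: "agree_off ?V ?W s s2" "ints s2 ''i'' 0 0 = i" "ints s2 ''j'' 0 0 = j" "reals s2 ''t'' 0 0 = r"
    for s2 r i j
  proof -
    have u: "reals s2 ''test'' = ?z" "reals s2 ''train'' = ?x" "ints s2 ''d'' 0 0 = d" "ints s2 ''k'' 0 0 = k"
      using B(1) s by (auto simp: agree_off_def)
    show ?thesis
      apply (rule runs_Seq[OF runs_kernel_prog[where d = d and k = k, OF _ _ _ _ _ order.refl],
            where ?T2.0 = "17 + (6 * d + 12 * k)"])
            apply (simp_all add: u B)
      subgoal for s3
        apply (rule runs_Seq[OF runs_kernel_prog[where d = d and k = k, OF _ _ _ _ _ order.refl],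
             where ?T2.0 = "8 + 3 * d + 6 * k + 1"])
              apply (simp_all add: agree_off_def u B)
        subgoal for s4
          apply (rule runs_Seq[OF runs_kernel_prog[where d = d and k = k, OF _ _ _ _ _ order.refl],
               where ?T2.0 = 1])
                apply (simp_all add: agree_off_def u B)
          apply (rule runs_RAssign)
           apply (simp_all add: u B t_def)
          done
        done
      done
  qed
  show "runs (For ''i'' (iscal ''n'') (For ''j'' (iscal ''n'') ?b)) s1 (2 + n * (4 + n * (27 + 9 * d + 18 * k)))
     (\<lambda>s'. reals s' ''t'' 0 0 = mmd d k n ?x ?z)"
    unfolding mmd_def t_def[symmetric]
  proof (rule runs_For[where T = "2 + n * (27 + 9 * d + 18 * k)" and N = n and
      I = "\<lambda>i s'. reals s' ''t'' 0 0 = (\<Sum>i<i. \<Sum>j<n. t i j)"])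
    fix i s2
    assume "agree_off (insert ''i'' (iwrites (For ''j'' (iscal ''n'') ?b))) (rwrites (For ''j'' (iscal ''n'') ?b)) s1 s2"
      and i: "ints s2 ''i'' 0 0 = i" and r: "reals s2 ''t'' 0 0 = (\<Sum>i<i. \<Sum>j<n. t i j)"
    then have B: "agree_off ?V ?W s s2"
      using A by (auto simp: agree_off_def)
    show "runs (For ''j'' (iscal ''n'') ?b) s2 (2 + n * (27 + 9 * d + 18 * k))
       (\<lambda>s'. reals s' ''t'' 0 0 = (\<Sum>i<Suc i. \<Sum>j<n. t i j))"
      unfolding sum.lessThan_Suc r[symmetric]
    proof (rule runs_For[where T = "25 + 9 * d + 18 * k" and N = n and
        I = "\<lambda>j s'. reals s' ''t'' 0 0 = reals s2 ''t'' 0 0 + (\<Sum>j<j. t i j)"])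
      fix j s3
      assume C: "agree_off (insert ''j'' (iwrites ?b)) (rwrites ?b) s2 s3"
        and j: "ints s3 ''j'' 0 0 = j" and "reals s3 ''t'' 0 0 = reals s2 ''t'' 0 0 + (\<Sum>j<j. t i j)"
      moreover from C B have "agree_off ?V ?W s s3" "ints s3 ''i'' 0 0 = i"
        using i by (auto simp: agree_off_def)
      ultimately show "runs ?b s3 (25 + 9 * d + 18 * k)
          (\<lambda>s'. reals s' ''t'' 0 0 = reals s2 ''t'' 0 0 + (\<Sum>j<Suc j. t i j))"
        using body[of s3 i j] by (simp add: add.assoc)
    qed (use B s in \<open>simp_all add: agree_off_def\<close>)
  qed (use A s t0 in \<open>simp_all add: agree_off_def algebra_simps\<close>)
qed (use T in simp)

text \<open>The machine has neither logarithm nor rounding, so the degree is found by repeated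
  doubling; the rate 16384^(-k) is built up in the same loop because powers are not primitive
  either.\<close>

definition scale_prog :: com where
  "scale_prog = Seq (rset ''e'' (RDiv (rscal ''eps'') (RRat 1000000))) (Seq (rset ''q'' (RRat 1))
    (Seq (iset ''k'' (INum 0)) (While (RLess (rscal ''e'') (RRat 1))
      (Seq (rset ''e'' (RMul (rscal ''e'') (RRat 2))) (Seq (rset ''q'' (RDiv (rscal ''q'') (RRat 16384)))
        (iset ''k'' (IAdd (iscal ''k'') (INum 1))))))))"

lemma writes_scale_prog [simp]:
  "iwrites scale_prog = {''k''}" "rwrites scale_prog = {''e'', ''q''}"
  by (auto simp: scale_prog_def)

text \<open>The factor \<open>10\<^sup>6\<close> makes \<open>2 ^ deg \<epsilon>\<close> absorb every absolute constant of the analysis.\<close>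

definition deg :: "real \<Rightarrow> nat" where
  "deg \<epsilon> = (LEAST k. 1000000 \<le> \<epsilon> * 2 ^ k)"

lemma deg_ge: "0 < \<epsilon> \<Longrightarrow> 1000000 \<le> \<epsilon> * 2 ^ deg \<epsilon>"
proof -
  assume "0 < \<epsilon>"
  obtain k where "1000000 / \<epsilon> < 2 ^ k"
    using real_arch_pow[of 2 "1000000 / \<epsilon>"] by auto
  then have "1000000 \<le> \<epsilon> * 2 ^ k"
    using \<open>0 < \<epsilon>\<close> by (simp add: field_simps)
  then show ?thesis
    unfolding deg_def by (rule LeastI)
qed

lemma less_deg: "k < deg \<epsilon> \<Longrightarrow> \<epsilon> * 2 ^ k < 1000000"
  unfolding deg_def using not_less_Least by force

lemma runs_scale_prog:
  assumes "0 < reals s ''eps'' 0 0" "4 + 4 * deg (reals s ''eps'' 0 0) \<le> T"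
  shows "runs scale_prog s T (\<lambda>s'. ints s' ''k'' 0 0 = deg (reals s ''eps'' 0 0) \<and>
    reals s' ''q'' 0 0 = (1 / 16384) ^ deg (reals s ''eps'' 0 0))"
proof -
  define \<epsilon> where "\<epsilon> = reals s ''eps'' 0 0"
  let ?b = "Seq (rset ''e'' (RMul (rscal ''e'') (RRat 2))) (Seq (rset ''q'' (RDiv (rscal ''q'') (RRat 16384)))
        (iset ''k'' (IAdd (iscal ''k'') (INum 1))))"
  let ?W = "While (RLess (rscal ''e'') (RRat 1)) ?b"
  let ?I = "\<lambda>k s. reals s ''e'' 0 0 = \<epsilon> * 2 ^ k / 1000000 \<and> ints s ''k'' 0 0 = k \<and>
    reals s ''q'' 0 0 = (1 / 16384) ^ k"
  have loop: "runs ?W s' (1 + 4 * m) (?I (deg \<epsilon>))" if "?I k s'" "k + m = deg \<epsilon>" for m k s'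
    using that
  proof (induction m arbitrary: k s')
    case 0
    then have "\<not> bval (RLess (rscal ''e'') (RRat 1)) s'"
      using deg_ge[of \<epsilon>] assms(1) by (auto simp: \<epsilon>_def)
    from exec.intros(7)[OF this] show ?case
      using 0 unfolding runs_def by auto
  next
    case (Suc m)
    then have b: "bval (RLess (rscal ''e'') (RRat 1)) s'"
      using less_deg[of k \<epsilon>] by auto
    have "runs ?b s' 3 (?I (Suc k))"
      apply (rule runs_Seq[where R = "\<lambda>s1. s1 = s'\<lparr>reals := upd (reals s') ''e'' 0 0 (reals s' ''e'' 0 0 * 2)\<rparr>" and ?T1.0 = 1 and ?T2.0 = 2])
        apply (rule runs_RAssign; simp)
       apply (rule runs_Seq[where R = "\<lambda>s1. s1 = s'\<lparr>reals := upd (upd (reals s') ''e'' 0 0 (reals s' ''e'' 0 0 * 2)) ''q'' 0 0 (reals s' ''q'' 0 0 / 16384)\<rparr>" and ?T1.0 = 1 and ?T2.0 = 1])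
         apply (rule runs_RAssign; simp)
        apply (rule runs_IAssign)
      using Suc.prems(1) by simp_all
    then obtain t s1 where s1: "exec ?b s' t s1" "t \<le> 3" "?I (Suc k) s1"
      by (auto simp: runs_def)
    obtain t' s2 where s2: "exec ?W s1 t' s2" "t' \<le> 1 + 4 * m" "?I (deg \<epsilon>) s2"
      using Suc.IH[OF s1(3)] Suc.prems(2) unfolding runs_def by auto
    show ?case
      unfolding runs_def using exec.intros(8)[OF b s1(1) s2(1)] s1(2) s2(2,3)
      by (intro exI[of _ "Suc (t + t')"] exI[of _ s2]) simp
  qed
  have all: "runs ?W s' (1 + 4 * deg \<epsilon>) (?I (deg \<epsilon>))" if "?I 0 s'" for s'
    using loop[OF that, of "deg \<epsilon>"] by simp
  show ?thesis
    unfolding scale_prog_def \<epsilon>_def[symmetric]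
    apply (rule runs_Seq[where R = "\<lambda>s1. reals s1 ''e'' 0 0 = \<epsilon> / 1000000" and ?T1.0 = 1 and ?T2.0 = "3 + 4 * deg \<epsilon>"])
      apply (rule runs_RAssign; simp add: \<epsilon>_def)
     apply (rule runs_Seq[where R = "\<lambda>s1. reals s1 ''q'' 0 0 = 1 \<and> reals s1 ''e'' 0 0 = \<epsilon> / 1000000" and ?T1.0 = 1 and ?T2.0 = "2 + 4 * deg \<epsilon>"])
       apply (rule runs_RAssign; simp)
      apply (rule runs_Seq[where R = "?I 0" and ?T1.0 = 1 and ?T2.0 = "1 + 4 * deg \<epsilon>"])
        apply (rule runs_IAssign; simp)
       apply (rule runs_mono[OF all order.refl])
    using assms(2) by (simp_all add: \<epsilon>_def)
qed

definition chow_prog :: com where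
  "chow_prog = For ''j'' (iscal ''d'') (Seq (rset ''a'' (RRat 0)) (Seq (For ''i'' (iscal ''n'')
      (rset ''a'' (RAdd (rscal ''a'') (RMul (RVar ''label'' (iscal ''i'') (INum 0)) (RVar ''train'' (iscal ''i'') (iscal ''j''))))))
      (RAssign ''c'' (INum 0) (iscal ''j'') (rscal ''a''))))"

definition offset_prog :: com where
  "offset_prog = Seq (rset ''m'' (RRat 0)) (For ''i'' (iscal ''n'')
    (Seq (dot_prog ''a'' ''train'' (iscal ''i'') ''train'' (iscal ''i''))
      (rset ''m'' (RAdd (rscal ''m'') (RMul (RVar ''label'' (iscal ''i'') (INum 0)) (RSub (rscal ''a'') (ROfNat (iscal ''d''))))))))"

lemma writes_chow_prog [simp]:
  "iwrites chow_prog = {''j'', ''i''}" "rwrites chow_prog = {''a'', ''c''}"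
  by (auto simp: chow_prog_def)

lemma writes_offset_prog [simp]:
  "iwrites offset_prog = {''i'', ''l''}" "rwrites offset_prog = {''m'', ''a''}"
  by (auto simp: offset_prog_def)

lemma runs_chow_prog:
  assumes s: "ints s ''d'' 0 0 = d" "ints s ''n'' 0 0 = n" and T: "2 + d * (6 + 3 * n) \<le> T"
  shows "runs chow_prog s T (\<lambda>s'. \<forall>l<d. reals s' ''c'' 0 l =
    (\<Sum>i<n. reals s ''label'' i 0 * reals s ''train'' i l))"
  unfolding chow_prog_def
proof (rule runs_For[where T = "4 + 3 * n" and N = d and
    I = "\<lambda>j s'. \<forall>l<j. reals s' ''c'' 0 l = (\<Sum>i<n. reals s ''label'' i 0 * reals s ''train'' i l)"])
  let ?f = "rset ''a'' (RAdd (rscal ''a'') (RMul (RVar ''label'' (iscal ''i'') (INum 0)) (RVar ''train'' (iscal ''i'') (iscal ''j''))))"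
  let ?b = "Seq (rset ''a'' (RRat 0)) (Seq (For ''i'' (iscal ''n'') ?f)
      (RAssign ''c'' (INum 0) (iscal ''j'') (rscal ''a'')))"
  let ?c = "\<lambda>l. \<Sum>i<n. reals s ''label'' i 0 * reals s ''train'' i l"
  fix j s1
  assume A: "agree_off (insert ''j'' (iwrites ?b)) (rwrites ?b) s s1" and j: "ints s1 ''j'' 0 0 = j"
    and I: "\<forall>l<j. reals s1 ''c'' 0 l = ?c l"
  have a: "ints s1 ''n'' 0 0 = n" "reals s1 ''label'' = reals s ''label''" "reals s1 ''train'' = reals s ''train''"
    using A s by (auto simp: agree_off_def)
  show "runs ?b s1 (4 + 3 * n) (\<lambda>s'. \<forall>l<Suc j. reals s' ''c'' 0 l = ?c l)"
  proof (rule runs_Seq[where R = "\<lambda>s'. reals s' ''a'' 0 0 = 0" and ?T1.0 = 1 and ?T2.0 = "3 + 3 * n"])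
    fix s2 assume a0: "reals s2 ''a'' 0 0 = 0"
      and "agree_off (iwrites (rset ''a'' (RRat 0))) (rwrites (rset ''a'' (RRat 0))) s1 s2"
    then have b: "ints s2 ''n'' 0 0 = n" "reals s2 ''label'' = reals s ''label''" "reals s2 ''train'' = reals s ''train''"
      "ints s2 ''j'' 0 0 = j" "reals s2 ''c'' = reals s1 ''c''"
      using a j by (auto simp: agree_off_def)
    show "runs (Seq (For ''i'' (iscal ''n'') ?f) (RAssign ''c'' (INum 0) (iscal ''j'') (rscal ''a''))) s2 (3 + 3 * n)
       (\<lambda>s'. \<forall>l<Suc j. reals s' ''c'' 0 l = ?c l)"
    proof (rule runs_Seq[where R = "\<lambda>s'. reals s' ''a'' 0 0 = ?c j" and ?T1.0 = "2 + 3 * n" and ?T2.0 = 1])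
      show "runs (For ''i'' (iscal ''n'') ?f) s2 (2 + 3 * n) (\<lambda>s'. reals s' ''a'' 0 0 = ?c j)"
      proof (rule runs_For[where T = 1 and N = n and
        I = "\<lambda>i s'. reals s' ''a'' 0 0 = (\<Sum>i<i. reals s ''label'' i 0 * reals s ''train'' i j)"])
        fix i s3 assume "agree_off (insert ''i'' (iwrites ?f)) (rwrites ?f) s2 s3" "ints s3 ''i'' 0 0 = i"
          "reals s3 ''a'' 0 0 = (\<Sum>i<i. reals s ''label'' i 0 * reals s ''train'' i j)"
        then show "runs ?f s3 1 (\<lambda>s'. reals s' ''a'' 0 0 = (\<Sum>i<Suc i. reals s ''label'' i 0 * reals s ''train'' i j))"
          using b by (intro runs_RAssign) (simp_all add: agree_off_def)
      qed (use b a0 in \<open>auto simp: agree_off_def\<close>)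
      fix s3 assume "reals s3 ''a'' 0 0 = ?c j"
        and "agree_off (iwrites (For ''i'' (iscal ''n'') ?f)) (rwrites (For ''i'' (iscal ''n'') ?f)) s2 s3"
      then have "reals s3 ''a'' 0 0 = ?c j" "reals s3 ''c'' = reals s1 ''c''" "ints s3 ''j'' 0 0 = j"
        using b by (simp_all add: agree_off_def)
      then show "runs (RAssign ''c'' (INum 0) (iscal ''j'') (rscal ''a'')) s3 1 (\<lambda>s'. \<forall>l<Suc j. reals s' ''c'' 0 l = ?c l)"
        using I by (intro runs_RAssign) (simp_all add: less_Suc_eq)
    qed simp
  qed (auto intro: runs_RAssign)
qed (use s T in \<open>auto simp: agree_off_def\<close>)

lemma runs_offset_prog:
  assumes s: "ints s ''d'' 0 0 = d" "ints s ''n'' 0 0 = n" and T: "3 + n * (8 + 3 * d) \<le> T"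
  shows "runs offset_prog s T (\<lambda>s'. reals s' ''m'' 0 0 =
    (\<Sum>i<n. reals s ''label'' i 0 * ((\<Sum>l<d. reals s ''train'' i l * reals s ''train'' i l) - real d)))"
  unfolding offset_prog_def
proof (rule runs_Seq[where R = "\<lambda>s'. reals s' ''m'' 0 0 = 0" and ?T1.0 = 1 and ?T2.0 = "2 + n * (8 + 3 * d)"])
  let ?x = "reals s ''train''" and ?y = "reals s ''label''"
  let ?e = "rset ''m'' (RAdd (rscal ''m'') (RMul (RVar ''label'' (iscal ''i'') (INum 0)) (RSub (rscal ''a'') (ROfNat (iscal ''d'')))))"
  let ?b = "Seq (dot_prog ''a'' ''train'' (iscal ''i'') ''train'' (iscal ''i'')) ?e"
  define m where "m i = ?y i 0 * ((\<Sum>l<d. ?x i l * ?x i l) - real d)" for i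
  fix s1 assume m0: "reals s1 ''m'' 0 0 = 0"
    and "agree_off (iwrites (rset ''m'' (RRat 0))) (rwrites (rset ''m'' (RRat 0))) s s1"
  then have a: "ints s1 ''d'' 0 0 = d" "ints s1 ''n'' 0 0 = n" "reals s1 ''train'' = ?x" "reals s1 ''label'' = ?y"
    using s by (auto simp: agree_off_def)
  show "runs (For ''i'' (iscal ''n'') ?b) s1 (2 + n * (8 + 3 * d)) (\<lambda>s'. reals s' ''m'' 0 0 = (\<Sum>i<n. ?y i 0 * ((\<Sum>l<d. ?x i l * ?x i l) - real d)))"
    unfolding m_def[symmetric]
  proof (rule runs_For[where T = "6 + 3 * d" and N = n and I = "\<lambda>i s'. reals s' ''m'' 0 0 = (\<Sum>i<i. m i)"])
    fix i s2 assume A: "agree_off (insert ''i'' (iwrites ?b)) (rwrites ?b) s1 s2"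
      and i: "ints s2 ''i'' 0 0 = i" "reals s2 ''m'' 0 0 = (\<Sum>i<i. m i)"
    have b: "ints s2 ''d'' 0 0 = d" "reals s2 ''train'' = ?x" "reals s2 ''label'' = ?y"
      using A a by (auto simp: agree_off_def)
    show "runs ?b s2 (6 + 3 * d) (\<lambda>s'. reals s' ''m'' 0 0 = (\<Sum>i<Suc i. m i))"
      apply (rule runs_Seq[OF runs_dot_prog[where d = d, OF _ _ _ _ _ order.refl], where ?T2.0 = 1])
      by (simp_all add: b i agree_off_def m_def runs_RAssign)
  qed (use a m0 in \<open>auto simp: agree_off_def\<close>)
qed (use T in \<open>auto intro: runs_RAssign\<close>)

text \<open>Comparing squares avoids a square root: \<open>''a''\<close> receives the inner product
  of c with the test point and \<open>''b''\<close> the squared norm of the point.\<close>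

definition flag_prog :: com where
  "flag_prog = Seq (iset ''w'' (INum 0)) (For ''j'' (iscal ''n'')
    (Seq (dot_prog ''a'' ''c'' (INum 0) ''test'' (iscal ''j''))
    (Seq (dot_prog ''b'' ''test'' (iscal ''j'') ''test'' (iscal ''j''))
      (If (RLess (RMul (RMul (RMul (RRat 18000) (ROfNat (iscal ''n''))) (RMul (ROfNat (iscal ''d'')) (ROfNat (iscal ''d''))))
          (RAdd (rscal ''b'') (RRat 1)))
        (RMul (RSub (rscal ''a'') (rscal ''m'')) (RSub (rscal ''a'') (rscal ''m''))))
       Skip (iset ''w'' (IAdd (iscal ''w'') (INum 1)))))))"

lemma writes_flag_prog [simp]:
  "iwrites flag_prog = {''w'', ''j'', ''l''}" "rwrites flag_prog = {''a'', ''b''}"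
  by (auto simp: flag_prog_def)

lemma card_Collect_less_Suc:
  "card {i. i < Suc n \<and> P i} = card {i. i < n \<and> P i} + (if P n then 1 else 0)"
proof -
  have "{i. i < Suc n \<and> P i} = (if P n then insert n {i. i < n \<and> P i} else {i. i < n \<and> P i})"
    by (auto simp: less_Suc_eq)
  then show ?thesis by simp
qed

text \<open>c and m are sums, not averages, and by Chebyshev the squared error of (c, m) is at most \<open>18000 n d\<^sup>2\<close>,
  so Cauchy-Schwarz bounds the squared error of \<open>c \<bullet> z - m\<close> by the right-hand side.\<close>

definition flagged :: "nat \<Rightarrow> nat \<Rightarrow> (nat \<Rightarrow> real) \<Rightarrow> real \<Rightarrow> (nat \<Rightarrow> real) \<Rightarrow> bool" where
  "flagged d n c m z \<longleftrightarrow> ((\<Sum>l<d. c l * z l) - m)\<^sup>2 \<le> 18000 * real n * (real d)\<^sup>2 * ((\<Sum>l<d. (z l)\<^sup>2) + 1)"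

lemma runs_flag_prog:
  assumes s: "ints s ''d'' 0 0 = d" "ints s ''n'' 0 0 = n" and T: "3 + n * (14 + 6 * d) \<le> T"
  shows "runs flag_prog s T (\<lambda>s'. ints s' ''w'' 0 0 =
    card {j. j < n \<and> flagged d n (reals s ''c'' 0) (reals s ''m'' 0 0) (reals s ''test'' j)})"
  unfolding flag_prog_def
proof (rule runs_Seq[where R = "\<lambda>s'. ints s' ''w'' 0 0 = 0" and ?T1.0 = 1 and ?T2.0 = "2 + n * (14 + 6 * d)"])
  let ?c = "reals s ''c''" and ?z = "reals s ''test''" and ?m = "reals s ''m''"
  let ?e = "If (RLess (RMul (RMul (RMul (RRat 18000) (ROfNat (iscal ''n''))) (RMul (ROfNat (iscal ''d'')) (ROfNat (iscal ''d''))))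
          (RAdd (rscal ''b'') (RRat 1)))
        (RMul (RSub (rscal ''a'') (rscal ''m'')) (RSub (rscal ''a'') (rscal ''m''))))
       Skip (iset ''w'' (IAdd (iscal ''w'') (INum 1)))"
  let ?b = "Seq (dot_prog ''a'' ''c'' (INum 0) ''test'' (iscal ''j''))
    (Seq (dot_prog ''b'' ''test'' (iscal ''j'') ''test'' (iscal ''j'')) ?e)"
  let ?Q = "\<lambda>j. flagged d n (?c 0) (?m 0 0) (?z j)"
  fix s1 assume w0: "ints s1 ''w'' 0 0 = 0"
    and "agree_off (iwrites (iset ''w'' (INum 0))) (rwrites (iset ''w'' (INum 0))) s s1"
  then have a: "ints s1 ''d'' 0 0 = d" "ints s1 ''n'' 0 0 = n" "reals s1 ''c'' = ?c" "reals s1 ''m'' = ?m" "reals s1 ''test'' = ?z"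
    using s by (auto simp: agree_off_def)
  show "runs (For ''j'' (iscal ''n'') ?b) s1 (2 + n * (14 + 6 * d)) (\<lambda>s'. ints s' ''w'' 0 0 = card {j. j < n \<and> ?Q j})"
  proof (rule runs_For[where T = "12 + 6 * d" and N = n and I = "\<lambda>i s'. ints s' ''w'' 0 0 = card {j. j < i \<and> ?Q j}"])
    fix j s2 assume A: "agree_off (insert ''j'' (iwrites ?b)) (rwrites ?b) s1 s2"
      and j: "ints s2 ''j'' 0 0 = j" "ints s2 ''w'' 0 0 = card {i. i < j \<and> ?Q i}"
    have b: "ints s2 ''d'' 0 0 = d" "ints s2 ''n'' 0 0 = n" "reals s2 ''c'' = ?c" "reals s2 ''m'' = ?m" "reals s2 ''test'' = ?z"
      using A a by (auto simp: agree_off_def)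
    show "runs ?b s2 (12 + 6 * d) (\<lambda>s'. ints s' ''w'' 0 0 = card {i. i < Suc j \<and> ?Q i})"
      apply (rule runs_Seq[OF runs_dot_prog[where d = d, OF _ _ _ _ _ order.refl], where ?T2.0 = "7 + 3 * d"])
            apply (simp_all add: b j)
      subgoal for s3
        apply (rule runs_Seq[OF runs_dot_prog[where d = d, OF _ _ _ _ _ order.refl], where ?T2.0 = 2])
              apply (simp_all add: agree_off_def b j)
        apply (rule runs_If[where T = 1])
          apply (rule runs_Skip)
           apply (simp_all add: b j card_Collect_less_Suc flagged_def power2_eq_square)
        apply (rule runs_IAssign)
         apply (simp_all add: b j card_Collect_less_Suc flagged_def power2_eq_square)
        done
      done
  qed (use a w0 in \<open>auto simp: agree_off_def\<close>)
qed (use T in \<open>auto intro: runs_IAssign\<close>)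

definition neg_prog :: com where
  "neg_prog = Seq (iset ''v'' (INum 0)) (For ''i'' (iscal ''n'')
    (If (RLess (RVar ''label'' (iscal ''i'') (INum 0)) (RRat 0)) (iset ''v'' (IAdd (iscal ''v'') (INum 1))) Skip))"

lemma writes_neg_prog [simp]:
  "iwrites neg_prog = {''v'', ''i''}" "rwrites neg_prog = {}"
  by (auto simp: neg_prog_def)

lemma runs_neg_prog:
  assumes s: "ints s ''n'' 0 0 = n" and T: "3 + n * 4 \<le> T"
  shows "runs neg_prog s T (\<lambda>s'. ints s' ''v'' 0 0 = card {i. i < n \<and> reals s ''label'' i 0 < 0})"
  unfolding neg_prog_def
proof (rule runs_Seq[where R = "\<lambda>s'. ints s' ''v'' 0 0 = 0" and ?T1.0 = 1 and ?T2.0 = "2 + n * 4"])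
  let ?y = "reals s ''label''"
  let ?b = "If (RLess (RVar ''label'' (iscal ''i'') (INum 0)) (RRat 0)) (iset ''v'' (IAdd (iscal ''v'') (INum 1))) Skip"
  fix s1 assume v0: "ints s1 ''v'' 0 0 = 0"
    and "agree_off (iwrites (iset ''v'' (INum 0))) (rwrites (iset ''v'' (INum 0))) s s1"
  then have a: "ints s1 ''n'' 0 0 = n" "reals s1 ''label'' = ?y"
    using s by (auto simp: agree_off_def)
  show "runs (For ''i'' (iscal ''n'') ?b) s1 (2 + n * 4) (\<lambda>s'. ints s' ''v'' 0 0 = card {i. i < n \<and> ?y i 0 < 0})"
  proof (rule runs_For[where T = 2 and N = n and I = "\<lambda>k s'. ints s' ''v'' 0 0 = card {i. i < k \<and> ?y i 0 < 0}"])
    fix i s2 assume A: "agree_off (insert ''i'' (iwrites ?b)) (rwrites ?b) s1 s2"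
      and i: "ints s2 ''i'' 0 0 = i" "ints s2 ''v'' 0 0 = card {k. k < i \<and> ?y k 0 < 0}"
    have b: "reals s2 ''label'' = ?y"
      using A a by (auto simp: agree_off_def)
    show "runs ?b s2 2 (\<lambda>s'. ints s' ''v'' 0 0 = card {k. k < Suc i \<and> ?y k 0 < 0})"
      by (rule runs_If[where T = 1])
        (auto simp: b i card_Collect_less_Suc intro!: runs_IAssign runs_Skip)
  qed (use a v0 in \<open>auto simp: agree_off_def\<close>)
qed (use T in \<open>auto intro: runs_IAssign\<close>)

section \<open>Learner and evaluator\<close>

text \<open>The grid has spacing \<open>1 / hash_width\<close> on an interval of half-width
  \<open>hash_width\<close>, which takes \<open>hash_cells\<close> thresholds. A Gaussian cell then
  has mass at most \<open>1 / hash_width\<close>, and the birthday bound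
  \<open>hash_tests\<^sup>2 / hash_width\<close> equals 1/100. \<open>hash_tests\<close> is large
  enough that a cell of mass above 1/1000 is hit twice with probability at least 99/100.\<close>

definition hash_width :: nat where "hash_width = 10 ^ 14"
definition hash_cells :: nat where "hash_cells = 2 * hash_width\<^sup>2 + 1"
definition hash_tests :: nat where "hash_tests = 10 ^ 6"

text \<open>Counting the thresholds below t replaces rounding to an integer. The values 0 and
  \<open>hash_cells\<close> are the two unbounded cells, so \<open>hash_cells + 1\<close> labels are
  needed.\<close>

definition cell :: "real \<Rightarrow> nat" where
  "cell t = card {k. k < hash_cells \<and> real k / real hash_width - real hash_width < t}"

definition cell_prog :: "rexp \<Rightarrow> com" where
  "cell_prog r = Seq (iset ''b'' (INum 0)) (For ''l'' (INum hash_cells)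
    (If (RLess (RSub (RDiv (ROfNat (iscal ''l'')) (ROfNat (INum hash_width))) (ROfNat (INum hash_width))) r)
      (iset ''b'' (IAdd (iscal ''b'') (INum 1))) Skip))"

lemma writes_cell_prog [simp]:
  "iwrites (cell_prog r) = {''b'', ''l''}" "rwrites (cell_prog r) = {}"
  by (auto simp: cell_prog_def)

lemma runs_cell_prog:
  assumes r: "\<And>s'. agree_off {''b'', ''l''} {} s s' \<Longrightarrow> rval r s' = t"
    and T: "3 + hash_cells * 4 \<le> T"
  shows "runs (cell_prog r) s T (\<lambda>s'. ints s' ''b'' 0 0 = cell t)"
  unfolding cell_prog_def
proof (rule runs_Seq[where R = "\<lambda>s'. ints s' ''b'' 0 0 = 0" and ?T1.0 = 1 and ?T2.0 = "2 + hash_cells * 4"])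
  let ?b = "If (RLess (RSub (RDiv (ROfNat (iscal ''l'')) (ROfNat (INum hash_width))) (ROfNat (INum hash_width))) r)
      (iset ''b'' (IAdd (iscal ''b'') (INum 1))) Skip"
  fix s1 assume b0: "ints s1 ''b'' 0 0 = 0"
    and A: "agree_off (iwrites (iset ''b'' (INum 0))) (rwrites (iset ''b'' (INum 0))) s s1"
  show "runs (For ''l'' (INum hash_cells) ?b) s1 (2 + hash_cells * 4) (\<lambda>s'. ints s' ''b'' 0 0 = cell t)"
    unfolding cell_def
  proof (rule runs_For[where T = 2 and N = hash_cells and
     I = "\<lambda>i s'. ints s' ''b'' 0 0 = card {k. k < i \<and> real k / real hash_width - real hash_width < t}"])
    fix k s2 assume B: "agree_off (insert ''l'' (iwrites ?b)) (rwrites ?b) s1 s2"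
      and i: "ints s2 ''l'' 0 0 = k" "ints s2 ''b'' 0 0 = card {i. i < k \<and> real i / real hash_width - real hash_width < t}"
    have "rval r s2 = t"
      by (rule r) (use A B in \<open>auto simp: agree_off_def\<close>)
    then show "runs ?b s2 2 (\<lambda>s'. ints s' ''b'' 0 0 = card {i. i < Suc k \<and> real i / real hash_width - real hash_width < t})"
      by (intro runs_If[where T = 1] runs_IAssign runs_Skip)
        (simp_all add: i card_Collect_less_Suc)
  qed (use b0 in \<open>auto simp: agree_off_def\<close>)
qed (use T in \<open>auto intro: runs_IAssign\<close>)

text \<open>Only the first coordinates of the first \<open>hash_tests\<close> test points are read,
  so the time is a constant that depends on neither d nor n.\<close>

definition collision_prog :: com where
  "collision_prog = Seq (iset ''w'' (INum 0)) (For ''i'' (INum hash_tests)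
    (Seq (cell_prog (RVar ''test'' (iscal ''i'') (INum 0)))
    (Seq (IAssign ''u'' (INum 0) (iscal ''b'') (IAdd (IVar ''u'' (INum 0) (iscal ''b'')) (INum 1)))
      (If (ILess (INum 1) (IVar ''u'' (INum 0) (iscal ''b''))) (iset ''w'' (INum 1)) Skip))))"

lemma writes_collision_prog [simp]:
  "iwrites collision_prog = {''b'', ''l'', ''i'', ''u'', ''w''}" "rwrites collision_prog = {}"
  by (auto simp: collision_prog_def)

lemma inj_on_lessThan_Suc:
  "inj_on f {..<Suc i} \<longleftrightarrow> inj_on f {..<i} \<and> {k. k < i \<and> f k = f i} = {}"
  by (auto simp: lessThan_Suc image_iff) (metis lessThan_iff)

lemma runs_collision_prog:
  assumes u: "\<And>b. ints s ''u'' 0 b = 0" and T: "3 + hash_tests * (8 + hash_cells * 4) \<le> T"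
  shows "runs collision_prog s T
    (\<lambda>s'. ints s' ''w'' 0 0 = 0 \<longleftrightarrow> inj_on (\<lambda>i. cell (reals s ''test'' i 0)) {..<hash_tests})"
  unfolding collision_prog_def
proof (rule runs_Seq[where R = "\<lambda>s'. ints s' ''w'' 0 0 = 0" and ?T1.0 = 1 and
    ?T2.0 = "2 + hash_tests * (8 + hash_cells * 4)"])
  let ?f = "\<lambda>i. cell (reals s ''test'' i 0)"
  let ?e1 = "IAssign ''u'' (INum 0) (iscal ''b'') (IAdd (IVar ''u'' (INum 0) (iscal ''b'')) (INum 1))"
  let ?e2 = "If (ILess (INum 1) (IVar ''u'' (INum 0) (iscal ''b''))) (iset ''w'' (INum 1)) Skip"
  let ?b = "Seq (cell_prog (RVar ''test'' (iscal ''i'') (INum 0))) (Seq ?e1 ?e2)"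
  \<comment> \<open>The array \<open>''u''\<close> records the occupancy of every cell; injectivity
    breaks exactly when the cell of the new point is already occupied.\<close>
  let ?I = "\<lambda>i s'. (\<forall>b. ints s' ''u'' 0 b = card {k. k < i \<and> ?f k = b}) \<and>
    (ints s' ''w'' 0 0 = 0 \<longleftrightarrow> inj_on ?f {..<i})"
  fix s1 assume w0: "ints s1 ''w'' 0 0 = 0"
    and "agree_off (iwrites (iset ''w'' (INum 0))) (rwrites (iset ''w'' (INum 0))) s s1"
  then have a: "\<And>b. ints s1 ''u'' 0 b = 0" "reals s1 = reals s"
    using u by (auto simp: agree_off_def)
  show "runs (For ''i'' (INum hash_tests) ?b) s1 (2 + hash_tests * (8 + hash_cells * 4))
    (\<lambda>s'. ints s' ''w'' 0 0 = 0 \<longleftrightarrow> inj_on ?f {..<hash_tests})"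
  proof (rule runs_mono[OF runs_For[where T = "6 + hash_cells * 4" and N = hash_tests and I = ?I, OF _ _ _ _ _ order.refl]])
    fix i s2 assume A: "agree_off (insert ''i'' (iwrites ?b)) (rwrites ?b) s1 s2"
      and i: "ints s2 ''i'' 0 0 = i" and I: "?I i s2"
    have x: "reals s2 = reals s"
      using A a by (auto simp: agree_off_def)
    show "runs ?b s2 (6 + hash_cells * 4) (?I (Suc i))"
    proof (rule runs_Seq[where ?T2.0 = 3, OF runs_cell_prog[where t = "reals s ''test'' i 0", OF _ order.refl]])
      fix s' assume "agree_off {''b'', ''l''} {} s2 s'"
      then show "rval (RVar ''test'' (iscal ''i'') (INum 0)) s' = reals s ''test'' i 0"
        using x i by (simp add: agree_off_def)
    next
      fix s3 assume b: "ints s3 ''b'' 0 0 = ?f i"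
        and "agree_off (iwrites (cell_prog (RVar ''test'' (iscal ''i'') (INum 0))))
           (rwrites (cell_prog (RVar ''test'' (iscal ''i'') (INum 0)))) s2 s3"
      then have y: "ints s3 ''u'' = ints s2 ''u''" "ints s3 ''w'' = ints s2 ''w''"
        by (auto simp: agree_off_def)
      define N where "N b = card {k. k < i \<and> ?f k = b}" for b
      have N: "{k. k < i \<and> ?f k = ?f i} = {} \<longleftrightarrow> N (?f i) = 0"
        unfolding N_def by (subst card_0_eq) auto
      have u3: "\<And>b. ints s3 ''u'' 0 b = N b" and w3: "ints s3 ''w'' 0 0 = 0 \<longleftrightarrow> inj_on ?f {..<i}"
        using I y by (auto simp: N_def)
      show "runs (Seq ?e1 ?e2) s3 3 (?I (Suc i))"
        unfolding inj_on_lessThan_Suc card_Collect_less_Suc N N_def[symmetric]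
      proof (rule runs_Seq[where R = "\<lambda>s'. (\<forall>b. ints s' ''u'' 0 b = N b + (if ?f i = b then 1 else 0)) \<and>
          (ints s' ''w'' 0 0 = 0 \<longleftrightarrow> inj_on ?f {..<i}) \<and> ints s' ''b'' 0 0 = ?f i" and ?T1.0 = 1 and ?T2.0 = 2])
        show "runs ?e1 s3 1 (\<lambda>s'. (\<forall>b. ints s' ''u'' 0 b = N b + (if ?f i = b then 1 else 0)) \<and>
          (ints s' ''w'' 0 0 = 0 \<longleftrightarrow> inj_on ?f {..<i}) \<and> ints s' ''b'' 0 0 = ?f i)"
          by (rule runs_IAssign) (simp_all add: b u3 w3)
        fix s4 :: ram assume "(\<forall>b. ints s4 ''u'' 0 b = N b + (if ?f i = b then 1 else 0)) \<and>
          (ints s4 ''w'' 0 0 = 0 \<longleftrightarrow> inj_on ?f {..<i}) \<and> ints s4 ''b'' 0 0 = ?f i"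
        then show "runs ?e2 s4 2 (\<lambda>s'. (\<forall>b. ints s' ''u'' 0 b = N b + (if ?f i = b then 1 else 0)) \<and>
          (ints s' ''w'' 0 0 = 0 \<longleftrightarrow> inj_on ?f {..<i} \<and> N (?f i) = 0))"
          by (intro runs_If[where T = 1] runs_IAssign runs_Skip) simp_all
      qed simp
    qed simp_all
  qed (use a w0 in \<open>simp_all add: agree_off_def\<close>)
qed (use T in \<open>auto intro: runs_IAssign\<close>)

definition main_prog :: com where
  "main_prog = Seq scale_prog (Seq chow_prog (Seq offset_prog (Seq flag_prog (Seq neg_prog
    (If (RLess (RMul (rscal ''eps'') (ROfNat (iscal ''n''))) (ROfNat (IAdd (iscal ''w'') (iscal ''w''))))
      (Seq mmd_prog
        (If (RLess (RMul (ROfNat (iscal ''n'')) (ROfNat (iscal ''n''))) (rscal ''t''))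
          Skip
          (If (RLess (RMul (rscal ''q'') (ROfNat (iscal ''n''))) (ROfNat (iscal ''v'')))
            (If (RLess (RMul (rscal ''q'') (ROfNat (iscal ''n''))) (ROfNat (ISub (iscal ''n'') (iscal ''v''))))
              Skip (iset ''accept'' (INum 3)))
            (iset ''accept'' (INum 2)))))
      (iset ''accept'' (INum 1)))))))"

text \<open>\<open>accept\<close> is 0 for rejection, 1 for the estimated halfspace, 2 and 3 for the constants 1 and -1,
  and 4 for the random labelling of the cells.\<close>

definition learner :: com where
  "learner = If (RLess (rscal ''eps'') (RRat (3 / 4))) main_prog
    (Seq collision_prog (If (ILess (INum 0) (iscal ''w'')) Skip (iset ''accept'' (INum 4))))"

text \<open>The training array survives in memory and serves as the table of cell labels, so that
  accepting with 4 requires no further output.\<close>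

definition evaluator :: com where
  "evaluator = If (ILess (iscal ''accept'') (INum 2))
    (Seq (dot_prog ''h'' ''c'' (INum 0) ''x'' (INum 0))
      (If (RLess (rscal ''h'') (rscal ''m'')) (iset ''out'' (INum 0)) (iset ''out'' (INum 1))))
    (If (ILess (iscal ''accept'') (INum 3)) (iset ''out'' (INum 1))
      (If (ILess (iscal ''accept'') (INum 4)) (iset ''out'' (INum 0))
        (Seq (cell_prog (RVar ''x'' (INum 0) (INum 0)))
          (If (RLess (RVar ''train'' (iscal ''b'') (INum 0)) (RRat 0))
            (iset ''out'' (INum 0)) (iset ''out'' (INum 1))))))"

definition chow :: "nat \<Rightarrow> (nat \<Rightarrow> (nat \<Rightarrow> real) \<times> real) \<Rightarrow> nat \<Rightarrow> real" where
  "chow n S l = (\<Sum>i<n. snd (S i) * fst (S i) l)"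

definition offset :: "nat \<Rightarrow> nat \<Rightarrow> (nat \<Rightarrow> (nat \<Rightarrow> real) \<times> real) \<Rightarrow> real" where
  "offset d n S = (\<Sum>i<n. snd (S i) * ((\<Sum>l<d. (fst (S i) l)\<^sup>2) - real d))"

text \<open>The verdict as a function of the data, with the programming stripped off; the
  probabilistic part works with \<open>outcome\<close> and \<open>answer\<close>.\<close>

definition outcome :: "nat \<Rightarrow> nat \<Rightarrow> real \<Rightarrow> (nat \<Rightarrow> (nat \<Rightarrow> real) \<times> real) \<Rightarrow> (nat \<Rightarrow> nat \<Rightarrow> real) \<Rightarrow> nat" where
  "outcome d n \<epsilon> S X =
    (if \<epsilon> < 3 / 4 then
       if 2 * real (card {j. j < n \<and> flagged d n (chow n S) (offset d n S) (X j)}) \<le> \<epsilon> * real n then 1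
       else if mmd d (deg \<epsilon>) n (\<lambda>i. fst (S i)) X \<le> (real n)\<^sup>2 then
         if real (card {i. i < n \<and> snd (S i) < 0}) \<le> (1 / 16384) ^ deg \<epsilon> * real n then 2
         else if real (card {i. i < n \<and> \<not> snd (S i) < 0}) \<le> (1 / 16384) ^ deg \<epsilon> * real n then 3
         else 0
       else 0
     else if inj_on (\<lambda>i. cell (X i 0)) {..<hash_tests} then 4 else 0)"

text \<open>In the last case the label of a cell is the sign of the first coordinate of the training
  point with that index, not the given label of this point: under the Gaussian marginal these signs
  are independent fair coins that carry no bias towards or against \<open>f\<close>.\<close>

definition answer :: "nat \<Rightarrow> nat \<Rightarrow> (nat \<Rightarrow> (nat \<Rightarrow> real) \<times> real) \<Rightarrow> nat \<Rightarrow> (nat \<Rightarrow> real) \<Rightarrow> real" where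
  "answer d n S m x =
    (if m = 1 then sgn_pm ((\<Sum>l<d. chow n S l * x l) - offset d n S)
     else if m = 2 then 1 else if m = 3 then -1 else sgn_pm (fst (S (cell (x 0))) 0))"

definition time :: "nat \<Rightarrow> nat \<Rightarrow> nat \<Rightarrow> nat" where
  "time d n k = 100 + 4 * k + d * (6 + 3 * n) + n * (30 + 9 * d) + n * (4 + n * (27 + 9 * d + 18 * k))"

definition hash_time :: nat where
  "hash_time = 10 + hash_tests * (8 + hash_cells * 4)"

lemma main_run:
  assumes \<epsilon>: "0 < \<epsilon>" "\<epsilon> < 3 / 4"
  shows "runs main_prog (input d n \<epsilon> S X) (time d n (deg \<epsilon>))
    (\<lambda>s. ints s ''accept'' 0 0 = outcome d n \<epsilon> S X \<and>
      (\<forall>l<d. reals s ''c'' 0 l = chow n S l) \<and> reals s ''m'' 0 0 = offset d n S)"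
  unfolding main_prog_def time_def
proof (rule runs_Seq[OF runs_scale_prog[OF _ order.refl]])
  let ?s = "input d n \<epsilon> S X" and ?k = "deg \<epsilon>"
  let ?L = "\<lambda>i j. if i < n \<and> j = 0 then snd (S i) else 0"
  let ?Tr = "\<lambda>i j. if i < n \<and> j < d then fst (S i) j else 0"
  let ?Te = "\<lambda>i j. if i < n \<and> j < d then X i j else 0"
  show "0 < reals ?s ''eps'' 0 0"
    using \<epsilon> by (simp add: input_def)
  \<comment> \<open>\<open>P\<close> collects the data that the phases share and that no phase
    before the verdict overwrites; \<open>P_mono\<close> carries it through each phase by
    disjointness of array names.\<close>
  define P where "P s \<longleftrightarrow> ints s ''k'' 0 0 = ?k \<and> reals s ''q'' 0 0 = (1 / 16384) ^ ?k \<and>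
    reals s ''eps'' 0 0 = \<epsilon> \<and> ints s ''d'' 0 0 = d \<and> ints s ''n'' 0 0 = n \<and> reals s ''train'' = ?Tr \<and>
    reals s ''label'' = ?L \<and> reals s ''test'' = ?Te \<and> ints s ''accept'' 0 0 = 0" for s :: ram
  have P_mono: "P s'" if "P s" "agree_off V W s s'" "V \<inter> {''k'', ''d'', ''n'', ''accept''} = {}"
    "W \<inter> {''q'', ''eps'', ''train'', ''label'', ''test''} = {}" for s s' :: ram and V W
    using that unfolding P_def agree_off_def by auto
  fix s1 assume "ints s1 ''k'' 0 0 = deg (reals ?s ''eps'' 0 0) \<and> reals s1 ''q'' 0 0 = (1 / 16384) ^ deg (reals ?s ''eps'' 0 0)"
    "agree_off (iwrites scale_prog) (rwrites scale_prog) ?s s1"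
  then have P1: "P s1"
    unfolding P_def agree_off_def by (simp add: input_def)
  note P1[unfolded P_def, simp]
  let ?few = "RLess (RMul (rscal ''eps'') (ROfNat (iscal ''n''))) (ROfNat (IAdd (iscal ''w'') (iscal ''w'')))"
  let ?const = "If (RLess (RMul (ROfNat (iscal ''n'')) (ROfNat (iscal ''n''))) (rscal ''t''))
    Skip
    (If (RLess (RMul (rscal ''q'') (ROfNat (iscal ''n''))) (ROfNat (iscal ''v'')))
      (If (RLess (RMul (rscal ''q'') (ROfNat (iscal ''n''))) (ROfNat (ISub (iscal ''n'') (iscal ''v''))))
        Skip (iset ''accept'' (INum 3)))
      (iset ''accept'' (INum 2)))"
  let ?if = "If ?few (Seq mmd_prog ?const) (iset ''accept'' (INum 1))"
  let ?Q = "\<lambda>s. ints s ''accept'' 0 0 = outcome d n \<epsilon> S X \<and>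
      (\<forall>l<d. reals s ''c'' 0 l = chow n S l) \<and> reals s ''m'' 0 0 = offset d n S"
  let ?T5 = "5 + (3 + n * (4 + n * (27 + 9 * d + 18 * ?k)))"
  let ?T4 = "(3 + n * 4) + ?T5"
  let ?T3 = "(3 + n * (14 + 6 * d)) + ?T4"
  let ?T2 = "(3 + n * (8 + 3 * d)) + ?T3"
  let ?T1 = "(2 + d * (6 + 3 * n)) + ?T2"
  show "runs (Seq chow_prog (Seq offset_prog (Seq flag_prog (Seq neg_prog ?if)))) s1 ?T1 ?Q"
  proof (rule runs_Seq[OF runs_chow_prog[where d = d and n = n, OF _ _ order.refl]])
    fix s2 assume A: "\<forall>l<d. reals s2 ''c'' 0 l = (\<Sum>i<n. reals s1 ''label'' i 0 * reals s1 ''train'' i l)"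
      and B: "agree_off (iwrites chow_prog) (rwrites chow_prog) s1 s2"
    have P2: "P s2" by (rule P_mono[OF P1 B]) auto
    note P2[unfolded P_def, simp]
    have c: "\<forall>l<d. reals s2 ''c'' 0 l = chow n S l"
      using A by (auto simp: chow_def)
    show "runs (Seq offset_prog (Seq flag_prog (Seq neg_prog ?if))) s2 ?T2 ?Q"
    proof (rule runs_Seq[OF runs_offset_prog[where d = d and n = n, OF _ _ order.refl]])
      fix s3 assume A: "reals s3 ''m'' 0 0 =
        (\<Sum>i<n. reals s2 ''label'' i 0 * ((\<Sum>l<d. reals s2 ''train'' i l * reals s2 ''train'' i l) - real d))"
        and B: "agree_off (iwrites offset_prog) (rwrites offset_prog) s2 s3"
      have P3: "P s3" by (rule P_mono[OF P2 B]) auto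
      note P3[unfolded P_def, simp]
      have c3: "\<forall>l<d. reals s3 ''c'' 0 l = chow n S l" "reals s3 ''m'' 0 0 = offset d n S"
        using A B c by (auto simp: offset_def agree_off_def power2_eq_square)
      show "runs (Seq flag_prog (Seq neg_prog ?if)) s3 ?T3 ?Q"
      proof (rule runs_Seq[OF runs_flag_prog[where d = d and n = n, OF _ _ order.refl]])
        fix s4 assume A: "ints s4 ''w'' 0 0 = card {j. j < n \<and> flagged d n (reals s3 ''c'' 0) (reals s3 ''m'' 0 0) (reals s3 ''test'' j)}"
          and B: "agree_off (iwrites flag_prog) (rwrites flag_prog) s3 s4"
        have P4: "P s4" by (rule P_mono[OF P3 B]) auto
        note P4[unfolded P_def, simp]
        have "j < n \<Longrightarrow> flagged d n (reals s3 ''c'' 0) (reals s3 ''m'' 0 0) (reals s3 ''test'' j) \<longleftrightarrow>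
           flagged d n (chow n S) (offset d n S) (X j)" for j
          using c3 by (simp add: flagged_def)
        then have w: "ints s4 ''w'' 0 0 = card {j. j < n \<and> flagged d n (chow n S) (offset d n S) (X j)}"
          unfolding A by (metis (no_types, lifting))
        have c4: "\<forall>l<d. reals s4 ''c'' 0 l = chow n S l" "reals s4 ''m'' 0 0 = offset d n S"
          using B c3 by (auto simp: agree_off_def)
        show "runs (Seq neg_prog ?if) s4 ?T4 ?Q"
        proof (rule runs_Seq[OF runs_neg_prog[where n = n, OF _ order.refl]])
          fix s5 assume A: "ints s5 ''v'' 0 0 = card {i. i < n \<and> reals s4 ''label'' i 0 < 0}"
            and B: "agree_off (iwrites neg_prog) (rwrites neg_prog) s4 s5"
          have P5: "P s5" by (rule P_mono[OF P4 B]) auto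
          note P5[unfolded P_def, simp]
          have "{i. i < n \<and> reals s4 ''label'' i 0 < 0} = {i. i < n \<and> snd (S i) < 0}"
            by auto
          then have v: "ints s5 ''v'' 0 0 = card {i. i < n \<and> snd (S i) < 0}"
            using A by simp
          have w5: "ints s5 ''w'' 0 0 = card {j. j < n \<and> flagged d n (chow n S) (offset d n S) (X j)}"
            and c5: "\<forall>l<d. reals s5 ''c'' 0 l = chow n S l" "reals s5 ''m'' 0 0 = offset d n S"
            using B w c4 by (auto simp: agree_off_def)
          \<comment> \<open>The program obtains this count by truncated subtraction, which is exact
            because the negative labels are among the first n.\<close>
          have "{i. i < n \<and> \<not> snd (S i) < 0} = {..<n} - {i. i < n \<and> snd (S i) < 0}"
            by auto
          then have nv: "card {i. i < n \<and> \<not> snd (S i) < 0} = n - card {i. i < n \<and> snd (S i) < 0}"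
            by (simp add: card_Diff_subset subset_eq)
          show "runs ?if s5 ?T5 ?Q"
          proof (rule runs_If[where T = "4 + (3 + n * (4 + n * (27 + 9 * d + 18 * ?k)))"])
            assume b: "bval ?few s5"
            show "runs (Seq mmd_prog ?const) s5 (4 + (3 + n * (4 + n * (27 + 9 * d + 18 * ?k)))) ?Q"
            proof (rule runs_Seq[OF runs_mmd_prog[where d = d and n = n and k = ?k, OF _ _ _ order.refl], where ?T2.0 = 4])
              fix s6 assume A: "reals s6 ''t'' 0 0 = mmd d ?k n (reals s5 ''train'') (reals s5 ''test'')"
                and B: "agree_off (iwrites mmd_prog) (rwrites mmd_prog) s5 s6"
              have P6: "P s6" by (rule P_mono[OF P5 B]) auto
              note P6[unfolded P_def, simp]
              have t: "reals s6 ''t'' 0 0 = mmd d ?k n (\<lambda>i. fst (S i)) X"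
                using A by (auto simp: mmd_def kernel_def intro!: sum.cong)
              have v6: "ints s6 ''v'' 0 0 = card {i. i < n \<and> snd (S i) < 0}"
                and c6: "\<forall>l<d. reals s6 ''c'' 0 l = chow n S l" "reals s6 ''m'' 0 0 = offset d n S"
                using B v c5 by (auto simp: agree_off_def)
              show "runs ?const s6 4 ?Q"
                apply (rule runs_If[where T = 3])
                  apply (rule runs_Skip)
                   apply (use b c6 \<epsilon> in \<open>simp add: outcome_def w5 t power2_eq_square\<close>)
                  apply simp
                 apply (rule runs_If[where T = 2])
                   apply (rule runs_If[where T = 1])
                     apply (rule runs_Skip)
                      apply (use b c6 \<epsilon> in \<open>simp add: outcome_def w5 t v6 nv power2_eq_square\<close>)
                     apply simp
                    apply (rule runs_IAssign)
                     apply (use b c6 \<epsilon> in \<open>simp add: outcome_def w5 t v6 nv power2_eq_square\<close>)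
                    apply simp
                   apply simp
                  apply (rule runs_IAssign)
                   apply (use b c6 \<epsilon> in \<open>simp add: outcome_def w5 t v6 nv power2_eq_square\<close>)
                  apply simp_all
                done
            qed simp_all
          next
            assume b: "\<not> bval ?few s5"
            show "runs (iset ''accept'' (INum 1)) s5 (4 + (3 + n * (4 + n * (27 + 9 * d + 18 * ?k)))) ?Q"
              by (rule runs_IAssign) (use b c5 \<epsilon> in \<open>simp_all add: outcome_def w5\<close>)
          qed simp
        qed simp_all
      qed simp_all
    qed simp_all
  qed simp_all
qed (simp_all add: input_def algebra_simps)

text \<open>\<open>input\<close> pads the arrays with zeros, so \<open>hash_tests \<le> n\<close>
  and \<open>0 < d\<close> ensure that the collision test reads genuine coordinates.\<close>

lemma learner_run:
  assumes \<epsilon>: "0 < \<epsilon>" and n: "hash_tests \<le> n" and d: "0 < d"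
  shows "runs learner (input d n \<epsilon> S X) (if \<epsilon> < 3 / 4 then Suc (time d n (deg \<epsilon>)) else hash_time)
    (\<lambda>s. ints s ''accept'' 0 0 = outcome d n \<epsilon> S X \<and> ints s ''d'' 0 0 = d \<and>
      reals s ''train'' = (\<lambda>i j. if i < n \<and> j < d then fst (S i) j else 0) \<and>
      (\<epsilon> < 3 / 4 \<longrightarrow> (\<forall>l<d. reals s ''c'' 0 l = chow n S l) \<and> reals s ''m'' 0 0 = offset d n S))"
    (is "runs _ ?s _ ?Q")
proof (cases "\<epsilon> < 3 / 4")
  case True
  have "runs main_prog ?s (time d n (deg \<epsilon>)) ?Q"
    by (rule runs_mono[OF runs_agree_off[OF main_run[OF \<epsilon> True]] order.refl])
      (auto simp: agree_off_def main_prog_def input_def)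
  then show ?thesis
    unfolding learner_def using True
    by (intro runs_If[where T = "time d n (deg \<epsilon>)"]) (simp_all add: input_def of_rat_divide)
next
  case False
  let ?if = "If (ILess (INum 0) (iscal ''w'')) Skip (iset ''accept'' (INum 4))"
  have "runs (Seq collision_prog ?if) ?s (hash_time - 1) ?Q"
  proof (rule runs_Seq[OF runs_collision_prog[OF _ order.refl], where ?T2.0 = 2])
    fix s1 assume w: "ints s1 ''w'' 0 0 = 0 \<longleftrightarrow> inj_on (\<lambda>i. cell (reals ?s ''test'' i 0)) {..<hash_tests}"
      and A: "agree_off (iwrites collision_prog) (rwrites collision_prog) ?s s1"
    have "inj_on (\<lambda>i. cell (reals ?s ''test'' i 0)) {..<hash_tests} \<longleftrightarrow> inj_on (\<lambda>i. cell (X i 0)) {..<hash_tests}"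
      by (rule inj_on_cong) (use n d in \<open>simp add: input_def\<close>)
    with w have w: "ints s1 ''w'' 0 0 = 0 \<longleftrightarrow> inj_on (\<lambda>i. cell (X i 0)) {..<hash_tests}"
      by simp
    have a: "ints s1 ''accept'' 0 0 = 0" "ints s1 ''d'' 0 0 = d"
      "reals s1 ''train'' = (\<lambda>i j. if i < n \<and> j < d then fst (S i) j else 0)"
      using A by (auto simp: agree_off_def input_def)
    show "runs ?if s1 2 ?Q"
      by (intro runs_If[where T = 1] runs_Skip runs_IAssign)
        (use w a False in \<open>simp_all add: outcome_def\<close>)
  qed (simp_all add: input_def hash_time_def)
  then have "runs learner ?s (Suc (hash_time - 1)) ?Q"
    unfolding learner_def using False
    by (intro runs_If[where T = "hash_time - 1"]) (simp_all add: input_def of_rat_divide)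
  then show ?thesis
    using False by (simp add: hash_time_def)
qed

lemma sgn_pm_le: "sgn_pm (a - b) = (if a < b then -1 else 1)"
  by (simp add: sgn_pm_def)

lemma cell_le: "cell t \<le> hash_cells"
proof -
  have "cell t \<le> card {..<hash_cells}"
    unfolding cell_def by (rule card_mono) auto
  then show ?thesis by simp
qed

text \<open>Cell numbers can reach \<open>hash_cells\<close> itself, hence the strict inequality
  \<open>hash_cells < n\<close>: every cell must own a training point.\<close>

lemma evaluator_run:
  assumes acc: "ints s ''accept'' 0 0 = a" "a \<noteq> 0" and d: "ints s ''d'' 0 0 = d" "0 < d"
    and train: "reals s ''train'' = (\<lambda>i j. if i < n \<and> j < d then fst (S i) j else 0)"
    and chow: "a = 1 \<Longrightarrow> \<forall>l<d. reals s ''c'' 0 l = chow n S l" "a = 1 \<Longrightarrow> reals s ''m'' 0 0 = offset d n S"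
    and cells: "hash_cells < n" and a: "a \<le> 4"
  shows "runs evaluator (load_point d x s) (if a < 4 then 20 + 3 * d else hash_time)
    (\<lambda>s. (if ints s ''out'' 0 0 \<noteq> 0 then 1 else -1) = answer d n S a x)" (is "runs _ ?s _ ?Q")
proof -
  have s: "ints ?s = ints s" "reals ?s ''c'' = reals s ''c''" "reals ?s ''m'' = reals s ''m''"
    "reals ?s ''train'' = reals s ''train''" "reals ?s ''x'' = (\<lambda>i j. if i = 0 \<and> j < d then x j else 0)"
    by (simp_all add: load_point_def)
  let ?lin = "Seq (dot_prog ''h'' ''c'' (INum 0) ''x'' (INum 0))
      (If (RLess (rscal ''h'') (rscal ''m'')) (iset ''out'' (INum 0)) (iset ''out'' (INum 1)))"
  let ?cell = "Seq (cell_prog (RVar ''x'' (INum 0) (INum 0)))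
          (If (RLess (RVar ''train'' (iscal ''b'') (INum 0)) (RRat 0))
            (iset ''out'' (INum 0)) (iset ''out'' (INum 1)))"
  consider "a = 1" | "a = 2" | "a = 3" | "a = 4"
    using a acc(2) by linarith
  then show ?thesis
  proof cases
    case 1
    have "runs ?lin ?s (10 + 3 * d) ?Q"
    proof (rule runs_Seq[OF runs_dot_prog[where d = d, OF _ _ _ _ _ order.refl], where ?T2.0 = 2])
      fix s1 assume "reals s1 ''h'' 0 0 = (\<Sum>l<d. reals ?s ''c'' (ival (INum 0) ?s) l * reals ?s ''x'' (ival (INum 0) ?s) l)"
        and A: "agree_off (iwrites (dot_prog ''h'' ''c'' (INum 0) ''x'' (INum 0))) (rwrites (dot_prog ''h'' ''c'' (INum 0) ''x'' (INum 0))) ?s s1"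
      moreover have "reals s1 ''m'' = reals s ''m''"
        using A s by (auto simp: agree_off_def)
      ultimately have "reals s1 ''h'' 0 0 = (\<Sum>l<d. chow n S l * x l)" "reals s1 ''m'' 0 0 = offset d n S"
        using chow 1 s by simp_all
      then show "runs (If (RLess (rscal ''h'') (rscal ''m'')) (iset ''out'' (INum 0)) (iset ''out'' (INum 1))) s1 2 ?Q"
        by (intro runs_If[where T = 1] runs_IAssign) (simp_all add: 1 answer_def sgn_pm_le)
    qed (use s d in simp_all)
    then show ?thesis
      unfolding evaluator_def using 1 acc s
      by (intro runs_If[where T = "10 + 3 * d"]) simp_all
  next
    case 2
    have "runs (iset ''out'' (INum 1)) ?s 1 ?Q"
      by (rule runs_IAssign) (simp_all add: 2 answer_def)
    then show ?thesis
      unfolding evaluator_def using 2 acc s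
      by (intro runs_If[where T = 2] runs_If[where T = 1]) simp_all
  next
    case 3
    have "runs (iset ''out'' (INum 0)) ?s 1 ?Q"
      by (rule runs_IAssign) (simp_all add: 3 answer_def)
    then show ?thesis
      unfolding evaluator_def using 3 acc s
      by (intro runs_If[where T = 3] runs_If[where T = 2] runs_If[where T = 1]) simp_all
  next
    case 4
    have "runs ?cell ?s (5 + hash_cells * 4) ?Q"
    proof (rule runs_Seq[OF runs_cell_prog[where t = "x 0", OF _ order.refl], where ?T2.0 = 2])
      fix s1 assume b: "ints s1 ''b'' 0 0 = cell (x 0)"
        and A: "agree_off (iwrites (cell_prog (RVar ''x'' (INum 0) (INum 0)))) (rwrites (cell_prog (RVar ''x'' (INum 0) (INum 0)))) ?s s1"
      have "cell (x 0) < n"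
        using cell_le[of "x 0"] cells by simp
      moreover have "reals s1 ''train'' = reals s ''train''"
        using A s by (auto simp: agree_off_def)
      ultimately have "reals s1 ''train'' (cell (x 0)) 0 = fst (S (cell (x 0))) 0"
        using train d by simp
      then show "runs (If (RLess (RVar ''train'' (iscal ''b'') (INum 0)) (RRat 0))
            (iset ''out'' (INum 0)) (iset ''out'' (INum 1))) s1 2 ?Q"
        using b by (intro runs_If[where T = 1] runs_IAssign) (simp_all add: 4 answer_def sgn_pm_def)
    next
      fix s' assume "agree_off {''b'', ''l''} {} ?s s'"
      then show "rval (RVar ''x'' (INum 0) (INum 0)) s' = x 0"
        using s d by (simp add: agree_off_def)
    qed simp
    then have "runs ?cell ?s (hash_time - 3) ?Q"
      by (rule runs_mono) (simp_all add: hash_time_def hash_tests_def)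
    then show ?thesis
      unfolding evaluator_def using 4 acc s
      by (intro runs_If[where T = "hash_time - 1"] runs_If[where T = "hash_time - 2"] runs_If[where T = "hash_time - 3"])
       (simp_all add: hash_time_def)
  qed
qed

section \<open>From executions to the learning algorithm as a function\<close>

lemma runs_final:
  assumes "runs c s T Q"
  shows "Q (final c s)" "halts_within c s (real T)"
proof -
  obtain t s' where *: "exec c s t s'" "t \<le> T" "Q s'"
    using assms by (auto simp: runs_def)
  then have "final c s = s'"
    unfolding final_def by (blast intro: the_equality dest: exec_deterministic)
  then show "Q (final c s)" "halts_within c s (real T)"
    using * by (auto simp: halts_within_def)
qed

lemma outcome_le: "outcome d n \<epsilon> S X \<le> 4"
  and outcome_eq_1: "outcome d n \<epsilon> S X = 1 \<Longrightarrow> \<epsilon> < 3 / 4"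
  and outcome_less_4: "outcome d n \<epsilon> S X \<noteq> 0 \<Longrightarrow> outcome d n \<epsilon> S X < 4 \<longleftrightarrow> \<epsilon> < 3 / 4"
  by (auto simp: outcome_def split: if_splits)

text \<open>The interface between programs and probability: the correctness argument needs nothing
  about the programs beyond this equation.\<close>

lemma learn_eq:
  assumes "0 < \<epsilon>" "hash_tests \<le> n" "hash_cells < n" "0 < d"
  shows "learn learner evaluator d n \<epsilon> S X =
    (if outcome d n \<epsilon> S X = 0 then None else Some (answer d n S (outcome d n \<epsilon> S X)))"
proof -
  note L = runs_final(1)[OF learner_run[OF assms(1,2,4), of S X]]
  have "hypothesis evaluator d (final learner (input d n \<epsilon> S X)) x = answer d n S (outcome d n \<epsilon> S X) x"
    if "outcome d n \<epsilon> S X \<noteq> 0" for x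
    unfolding hypothesis_def
    by (rule runs_final(1)[OF evaluator_run[where a = "outcome d n \<epsilon> S X"]])
      (use L that assms outcome_le outcome_eq_1 in auto)
  then show ?thesis
    unfolding learn_def Let_def accepting_def using L by auto
qed

lemma runs_within_learner:
  assumes "0 < \<epsilon>" "hash_tests \<le> n" "hash_cells < n" "0 < d"
    and T: "real (if \<epsilon> < 3 / 4 then Suc (time d n (deg \<epsilon>)) else hash_time) \<le> T"
  shows "runs_within learner evaluator d n \<epsilon> T"
  unfolding runs_within_def Let_def accepting_def
proof (intro allI impI conjI)
  fix S X x
  note R = learner_run[OF assms(1,2,4), of S X]
  have mono: "halts_within c s a \<Longrightarrow> a \<le> b \<Longrightarrow> halts_within c s b" for c s a b
    unfolding halts_within_def by force
  show "halts_within learner (input d n \<epsilon> S X) T"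
    by (rule mono[OF runs_final(2)[OF R] T])
  note L = runs_final(1)[OF R]
  assume "ints (final learner (input d n \<epsilon> S X)) ''accept'' 0 0 \<noteq> 0"
  then have nz: "outcome d n \<epsilon> S X \<noteq> 0"
    using L by simp
  have "halts_within evaluator (load_point d x (final learner (input d n \<epsilon> S X)))
     (real (if outcome d n \<epsilon> S X < 4 then 20 + 3 * d else hash_time))"
    by (rule runs_final(2)[OF evaluator_run[where a = "outcome d n \<epsilon> S X"]])
      (use L nz assms outcome_le outcome_eq_1 in auto)
  then show "halts_within evaluator (load_point d x (final learner (input d n \<epsilon> S X))) T"
  proof (rule mono)
    \<comment> \<open>Acceptance with 4 happens only for \<open>\<epsilon> \<ge> 3 / 4\<close>, so
      the inner product of the evaluator is charged to \<open>time\<close> and the cell lookup to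
      \<open>hash_time\<close>.\<close>
    have "(if outcome d n \<epsilon> S X < 4 then 20 + 3 * d else hash_time) \<le>
        (if \<epsilon> < 3 / 4 then Suc (time d n (deg \<epsilon>)) else hash_time)"
      using outcome_less_4[OF nz] by (auto simp: time_def algebra_simps)
    then show "real (if outcome d n \<epsilon> S X < 4 then 20 + 3 * d else hash_time) \<le> T"
      using T by linarith
  qed
qed

section \<open>Sums of independent observations\<close>

lemma PiM_component_integral:
  fixes g :: "'a \<Rightarrow> real"
  assumes "prob_space M" "i \<in> I" "integrable M g"
  shows "integrable (PiM I (\<lambda>_. M)) (\<lambda>\<omega>. g (\<omega> i))" "(\<integral>\<omega>. g (\<omega> i) \<partial>PiM I (\<lambda>_. M)) = integral\<^sup>L M g"
proof -
  have c: "distr (PiM I (\<lambda>_. M)) M (\<lambda>\<omega>. \<omega> i) = M"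
    using assms by (intro distr_PiM_component)
  have m: "(\<lambda>\<omega>. \<omega> i) \<in> PiM I (\<lambda>_. M) \<rightarrow>\<^sub>M M"
    using assms(2) by measurable
  show "integrable (PiM I (\<lambda>_. M)) (\<lambda>\<omega>. g (\<omega> i))"
    by (rule integrable_distr[OF m]) (use assms(3) c in simp)
  have "integral\<^sup>L (distr (PiM I (\<lambda>_. M)) M (\<lambda>\<omega>. \<omega> i)) g = (\<integral>\<omega>. g (\<omega> i) \<partial>PiM I (\<lambda>_. M))"
    by (rule integral_distr[OF m]) (use assms(3) in auto)
  then show "(\<integral>\<omega>. g (\<omega> i) \<partial>PiM I (\<lambda>_. M)) = integral\<^sup>L M g"
    using c by simp
qed

text \<open>Cross terms factor over the product measure and vanish because the summands are centred.
  The functions may differ from index to index, as the weighted random signs of the cells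
  require.\<close>

lemma PiM_sum_square:
  fixes g :: "'i \<Rightarrow> 'a \<Rightarrow> real"
  assumes M: "prob_space M" and I: "finite I"
    and g: "\<And>i. i \<in> I \<Longrightarrow> g i \<in> borel_measurable M"
    and g2: "\<And>i. i \<in> I \<Longrightarrow> integrable M (\<lambda>x. (g i x)\<^sup>2)"
    and mean: "\<And>i. i \<in> I \<Longrightarrow> integral\<^sup>L M (g i) = 0"
  shows "integrable (PiM I (\<lambda>_. M)) (\<lambda>\<omega>. (\<Sum>i\<in>I. g i (\<omega> i))\<^sup>2)"
    and "(\<integral>\<omega>. (\<Sum>i\<in>I. g i (\<omega> i))\<^sup>2 \<partial>PiM I (\<lambda>_. M)) = (\<Sum>i\<in>I. \<integral>x. (g i x)\<^sup>2 \<partial>M)"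
proof -
  interpret prob_space M by (rule M)
  interpret P: product_sigma_finite "\<lambda>_::'i. M" by standard
  let ?P = "PiM I (\<lambda>_. M)"
  have g1: "i \<in> I \<Longrightarrow> integrable M (g i)" for i
    using square_integrable_imp_integrable[OF g g2] by blast
  have cross: "integrable ?P (\<lambda>\<omega>. g i (\<omega> i) * g j (\<omega> j)) \<and>
      (\<integral>\<omega>. g i (\<omega> i) * g j (\<omega> j) \<partial>?P) = (if i = j then \<integral>x. (g i x)\<^sup>2 \<partial>M else 0)"
    if ij: "i \<in> I" "j \<in> I" for i j
  proof (cases "i = j")
    case True
    then show ?thesis
      using PiM_component_integral[OF M ij(1) g2[OF ij(1)]] by (simp add: power2_eq_square)
  next
    case False
    \<comment> \<open>The factor 1 at all other coordinates turns the cross term into a product over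
      the whole of \<open>I\<close>, to which Fubini's theorem for finite products applies.\<close>
    define h where "h k = (if k = i then g i else if k = j then g j else (\<lambda>_. 1))" for k
    have h: "integrable M (h k)" if "k \<in> I" for k
      using g1 ij by (auto simp: h_def)
    have "(\<Prod>k\<in>I. h k (\<omega> k)) = g i (\<omega> i) * g j (\<omega> j)" for \<omega>
    proof -
      have "(\<Prod>k\<in>I. h k (\<omega> k)) = (\<Prod>k\<in>{i, j}. h k (\<omega> k))"
        using I ij by (intro prod.mono_neutral_right) (auto simp: h_def)
      also have "\<dots> = g i (\<omega> i) * g j (\<omega> j)"
        using False by (simp add: h_def)
      finally show ?thesis .
    qed
    moreover have "(\<Prod>k\<in>I. integral\<^sup>L M (h k)) = 0"
      using I ij mean[OF ij(1)] by (intro prod_zero) (auto simp: h_def)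
    ultimately show ?thesis
      using P.product_integrable_prod[where f = h, OF I h] P.product_integral_prod[where f = h, OF I h] False
      by simp
  qed
  have sq: "(\<lambda>\<omega>. (\<Sum>i\<in>I. g i (\<omega> i))\<^sup>2) = (\<lambda>\<omega>. \<Sum>i\<in>I. \<Sum>j\<in>I. g i (\<omega> i) * g j (\<omega> j))"
    by (simp add: power2_eq_square sum_product)
  show "integrable ?P (\<lambda>\<omega>. (\<Sum>i\<in>I. g i (\<omega> i))\<^sup>2)"
    unfolding sq using cross by (intro Bochner_Integration.integrable_sum) blast
  have "(\<integral>\<omega>. (\<Sum>i\<in>I. g i (\<omega> i))\<^sup>2 \<partial>?P) = (\<Sum>i\<in>I. \<Sum>j\<in>I. if i = j then \<integral>x. (g i x)\<^sup>2 \<partial>M else 0)"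
    unfolding sq using cross by (simp add: Bochner_Integration.integral_sum)
  also have "\<dots> = (\<Sum>i\<in>I. \<integral>x. (g i x)\<^sup>2 \<partial>M)"
    using I by simp
  finally show "(\<integral>\<omega>. (\<Sum>i\<in>I. g i (\<omega> i))\<^sup>2 \<partial>?P) = (\<Sum>i\<in>I. \<integral>x. (g i x)\<^sup>2 \<partial>M)" .
qed

text \<open>The variance is at most the raw second moment, which is the quantity that the
  applications can bound.\<close>

lemma PiM_deviation_square:
  fixes h :: "'a \<Rightarrow> real"
  assumes M: "prob_space M" and I: "finite I"
    and h: "h \<in> borel_measurable M" and h2: "integrable M (\<lambda>x. (h x)\<^sup>2)"
  shows "integrable (PiM I (\<lambda>_. M)) (\<lambda>\<omega>. ((\<Sum>i\<in>I. h (\<omega> i)) - card I * integral\<^sup>L M h)\<^sup>2)"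
    and "(\<integral>\<omega>. ((\<Sum>i\<in>I. h (\<omega> i)) - card I * integral\<^sup>L M h)\<^sup>2 \<partial>PiM I (\<lambda>_. M)) \<le> card I * (\<integral>x. (h x)\<^sup>2 \<partial>M)"
proof -
  interpret prob_space M by (rule M)
  define \<mu> where "\<mu> = integral\<^sup>L M h"
  have h1: "integrable M h"
    using square_integrable_imp_integrable[OF h h2] .
  have eq: "(\<Sum>i\<in>I. h (\<omega> i)) - card I * \<mu> = (\<Sum>i\<in>I. h (\<omega> i) - \<mu>)" for \<omega> :: "'b \<Rightarrow> 'a"
    by (simp add: sum_subtractf)
  have i2: "integrable M (\<lambda>x. (h x - \<mu>)\<^sup>2)"
    using h1 h2 by (simp add: power2_diff)
  have v: "(\<integral>x. (h x - \<mu>)\<^sup>2 \<partial>M) \<le> (\<integral>x. (h x)\<^sup>2 \<partial>M)"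
    using variance_eq[OF h1 h2] by (simp add: \<mu>_def)
  note S = PiM_sum_square[OF M I, of "\<lambda>_ x. h x - \<mu>"]
  show "integrable (PiM I (\<lambda>_. M)) (\<lambda>\<omega>. ((\<Sum>i\<in>I. h (\<omega> i)) - card I * integral\<^sup>L M h)\<^sup>2)"
    unfolding \<mu>_def[symmetric] eq by (rule S(1)) (use h h1 i2 in \<open>auto simp: \<mu>_def prob_space\<close>)
  have "(\<integral>\<omega>. (\<Sum>i\<in>I. h (\<omega> i) - \<mu>)\<^sup>2 \<partial>PiM I (\<lambda>_. M)) = card I * (\<integral>x. (h x - \<mu>)\<^sup>2 \<partial>M)"
    by (subst S(2)) (use h h1 i2 in \<open>auto simp: \<mu>_def prob_space\<close>)
  also have "\<dots> \<le> card I * (\<integral>x. (h x)\<^sup>2 \<partial>M)"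
    using v by (intro mult_left_mono) auto
  finally show "(\<integral>\<omega>. ((\<Sum>i\<in>I. h (\<omega> i)) - card I * integral\<^sup>L M h)\<^sup>2 \<partial>PiM I (\<lambda>_. M)) \<le> card I * (\<integral>x. (h x)\<^sup>2 \<partial>M)"
    unfolding \<mu>_def[symmetric] eq .
qed

lemma prob_gt_Markov:
  fixes u :: "'a \<Rightarrow> real"
  assumes M: "prob_space M" and u: "integrable M u" "\<And>x. x \<in> space M \<Longrightarrow> 0 \<le> u x" and c: "0 < c"
  shows "measure M {x \<in> space M. c < u x} \<le> (\<integral>x. u x \<partial>M) / c"
proof -
  interpret prob_space M by (rule M)
  have "measure M {x \<in> space M. c < u x} \<le> measure M {x \<in> space M. u x \<ge> c}"
    using u(1) by (intro finite_measure_mono) (auto intro!: borel_measurable_le)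
  also have "\<dots> \<le> (\<integral>x. u x \<partial>M) / c"
    by (rule integral_Markov_inequality_measure[OF u(1) sets.empty_sets _ c]) (auto intro: u(2))
  finally show ?thesis .
qed

lemma card_eq_sum_indicator:
  "finite I \<Longrightarrow> real (card {i \<in> I. \<omega> i \<in> A}) = (\<Sum>i\<in>I. indicator A (\<omega> i))"
  by (simp add: indicator_def if_distrib sum.If_cases Int_def)

lemma measurable_card_PiM:
  assumes "finite I" "A \<in> sets M"
  shows "(\<lambda>\<omega>. real (card {i \<in> I. \<omega> i \<in> A})) \<in> borel_measurable (PiM I (\<lambda>_. M))"
  unfolding card_eq_sum_indicator[OF assms(1)]
  by (intro borel_measurable_sum measurable_compose[OF measurable_component_singleton])
    (use assms in auto)

text \<open>Chebyshev's inequality at half the mean; the second moment of an indicator is its mass,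
  whence the rate 4 / (mass * sample size). It serves in contrapositive form: a hypothesis with
  error above \<open>\<epsilon>\<close> seldom shows at most half of that on a fresh sample.\<close>

lemma PiM_count_le:
  assumes M: "prob_space M" and I: "finite I" "I \<noteq> {}" and A: "A \<in> sets M"
    and \<epsilon>: "0 < \<epsilon>" "\<epsilon> < measure M A"
  shows "measure (PiM I (\<lambda>_. M)) {\<omega> \<in> space (PiM I (\<lambda>_. M)). 2 * real (card {i \<in> I. \<omega> i \<in> A}) \<le> \<epsilon> * card I}
    \<le> 4 / (\<epsilon> * card I)"
proof -
  interpret prob_space M by (rule M)
  interpret P: prob_space "PiM I (\<lambda>_. M)" by (intro prob_space_PiM M)
  let ?P = "PiM I (\<lambda>_. M)" and ?p = "measure M A"
  define n where "n = real (card I)"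
  have n: "0 < n" using I by (simp add: n_def card_gt_0_iff)
  have p: "0 < ?p" using \<epsilon> by simp
  let ?u = "\<lambda>\<omega>. ((\<Sum>i\<in>I. indicator A (\<omega> i)) - n * ?p)\<^sup>2"
  have mean: "integral\<^sup>L M (indicator A) = ?p"
    using A by simp
  have sq: "(\<lambda>x. (indicator A x :: real)\<^sup>2) = indicator A"
    by (auto simp: indicator_def)
  have ii: "integrable M (indicator A :: 'a \<Rightarrow> real)"
    using A by (simp add: integrable_indicator_iff emeasure_eq_measure)
  have int: "integrable ?P ?u" and le: "integral\<^sup>L ?P ?u \<le> n * ?p"
    using PiM_deviation_square[OF M I(1), of "indicator A"] A ii unfolding mean sq n_def by auto
  have "measure ?P {\<omega> \<in> space ?P. 2 * real (card {i \<in> I. \<omega> i \<in> A}) \<le> \<epsilon> * card I}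
      \<le> measure ?P {\<omega> \<in> space ?P. ?u \<omega> \<ge> (n * ?p / 2)\<^sup>2}"
  proof (rule P.finite_measure_mono)
    show "{\<omega> \<in> space ?P. ?u \<omega> \<ge> (n * ?p / 2)\<^sup>2} \<in> sets ?P"
      using int by (intro borel_measurable_le) auto
    show "{\<omega> \<in> space ?P. 2 * real (card {i \<in> I. \<omega> i \<in> A}) \<le> \<epsilon> * card I} \<subseteq> {\<omega> \<in> space ?P. ?u \<omega> \<ge> (n * ?p / 2)\<^sup>2}"
    proof safe
      fix \<omega> assume *: "2 * real (card {i \<in> I. \<omega> i \<in> A}) \<le> \<epsilon> * card I"
      have "\<epsilon> * n \<le> ?p * n" using \<epsilon> n by simp
      then have "n * ?p / 2 \<le> n * ?p - (\<Sum>i\<in>I. indicator A (\<omega> i))"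
        using * unfolding card_eq_sum_indicator[OF I(1)] n_def by (simp add: algebra_simps)
      then have "(n * ?p / 2)\<^sup>2 \<le> (n * ?p - (\<Sum>i\<in>I. indicator A (\<omega> i)))\<^sup>2"
        using n p by (intro power_mono) auto
      then show "?u \<omega> \<ge> (n * ?p / 2)\<^sup>2"
        by (simp add: power2_commute)
    qed
  qed
  also have "\<dots> \<le> integral\<^sup>L ?P ?u / (n * ?p / 2)\<^sup>2"
    using n p by (intro integral_Markov_inequality_measure[OF int sets.empty_sets]) auto
  also have "\<dots> \<le> n * ?p / (n * ?p / 2)\<^sup>2"
    using le by (intro divide_right_mono) auto
  also have "\<dots> = 4 / (?p * n)"
    using n p by (simp add: power2_eq_square field_simps)
  also have "\<dots> \<le> 4 / (\<epsilon> * n)"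
    using n p \<epsilon> by (intro divide_left_mono mult_right_mono) auto
  finally show ?thesis by (simp add: n_def)
qed

lemma PiM_count_gt:
  assumes M: "prob_space M" and I: "finite I" and A: "A \<in> sets M" and c: "0 < c"
  shows "measure (PiM I (\<lambda>_. M)) {\<omega> \<in> space (PiM I (\<lambda>_. M)). c < real (card {i \<in> I. \<omega> i \<in> A})}
    \<le> card I * measure M A / c"
proof -
  interpret prob_space M by (rule M)
  interpret P: prob_space "PiM I (\<lambda>_. M)" by (intro prob_space_PiM M)
  have ii: "integrable M (indicator A :: 'a \<Rightarrow> real)"
    using A by (simp add: integrable_indicator_iff emeasure_eq_measure)
  have int: "integrable (PiM I (\<lambda>_. M)) (\<lambda>\<omega>. real (card {i \<in> I. \<omega> i \<in> A}))"
    unfolding card_eq_sum_indicator[OF I]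
    by (intro Bochner_Integration.integrable_sum PiM_component_integral(1)[OF M _ ii])
  have "(\<integral>\<omega>. real (card {i \<in> I. \<omega> i \<in> A}) \<partial>PiM I (\<lambda>_. M)) = card I * measure M A"
    unfolding card_eq_sum_indicator[OF I]
    using PiM_component_integral(1)[OF M _ ii] A
    by (subst Bochner_Integration.integral_sum) (simp_all add: PiM_component_integral(2)[OF M _ ii])
  then show ?thesis
    using prob_gt_Markov[OF P.prob_space_axioms int _ c] by simp
qed

text \<open>Fubini over slices: it suffices that for each fixed first sample the bad second samples
  are rare. In this way a hypothesis trained on the first sample may be treated as fixed.\<close>

lemma pair_measure_le:
  assumes M: "prob_space M" and N: "prob_space N" and Q: "Q \<in> sets (M \<Otimes>\<^sub>M N)"
    and le: "\<And>x. x \<in> space M \<Longrightarrow> measure N (Pair x -` Q) \<le> a" and a: "0 \<le> a"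
  shows "measure (M \<Otimes>\<^sub>M N) Q \<le> a"
proof -
  interpret M: prob_space M by (rule M)
  interpret N: prob_space N by (rule N)
  interpret P: pair_prob_space M N ..
  have "emeasure (M \<Otimes>\<^sub>M N) Q = (\<integral>\<^sup>+ x. emeasure N (Pair x -` Q) \<partial>M)"
    by (rule N.emeasure_pair_measure_alt[OF Q])
  also have "\<dots> \<le> (\<integral>\<^sup>+ x. ennreal a \<partial>M)"
    using le by (intro nn_integral_mono) (simp add: N.emeasure_eq_measure ennreal_leI)
  also have "\<dots> = ennreal a"
    by (simp add: M.emeasure_space_1)
  finally show ?thesis
    using a by (simp add: P.emeasure_eq_measure)
qed

lemma measure_pair_fst:
  assumes M: "prob_space M" and N: "prob_space N" and A: "A \<in> sets M"
  shows "measure (M \<Otimes>\<^sub>M N) {\<omega> \<in> space (M \<Otimes>\<^sub>M N). fst \<omega> \<in> A} = measure M A"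
proof -
  interpret M: prob_space M by (rule M)
  interpret N: prob_space N by (rule N)
  have "{\<omega> \<in> space (M \<Otimes>\<^sub>M N). fst \<omega> \<in> A} = A \<times> space N"
    using sets.sets_into_space[OF A] by (auto simp: space_pair_measure)
  then show ?thesis
    using A by (simp add: measure_def N.emeasure_pair_measure_Times enn2real_mult N.emeasure_space_1)
qed

lemma measure_pair_snd:
  assumes M: "prob_space M" and N: "prob_space N" and A: "A \<in> sets N"
  shows "measure (M \<Otimes>\<^sub>M N) {\<omega> \<in> space (M \<Otimes>\<^sub>M N). snd \<omega> \<in> A} = measure N A"
proof -
  interpret M: prob_space M by (rule M)
  interpret N: prob_space N by (rule N)
  have "{\<omega> \<in> space (M \<Otimes>\<^sub>M N). snd \<omega> \<in> A} = space M \<times> A"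
    using sets.sets_into_space[OF A] by (auto simp: space_pair_measure)
  then show ?thesis
    using A by (simp add: measure_def N.emeasure_pair_measure_Times enn2real_mult M.emeasure_space_1)
qed

section \<open>Gaussian integrals\<close>

lemma DERIV_std_normal_density:
  "(std_normal_density has_real_derivative - x * std_normal_density x) (at x)"
  unfolding std_normal_density_def[abs_def]
  by (auto intro!: derivative_eq_intros simp: field_simps)

text \<open>\<open>F\<close> is the antiderivative of \<open>- g\<close> that vanishes at infinity,
  so the fundamental theorem leaves only its value at the lower end.\<close>

lemma std_normal_upper_tail_integral:
  fixes F g :: "real \<Rightarrow> real"
  assumes F: "\<And>x. (F has_real_derivative - g x) (at x)" and g: "\<And>x. isCont g x"
    and int: "integrable lborel g" and lim: "(F \<longlongrightarrow> 0) at_top"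
  shows "(\<integral>x. g x * indicator {u<..} x \<partial>lborel) = F u"
proof -
  have "(LBINT x=ereal u..\<infinity>. g x) = 0 - (- F u)"
  proof (rule interval_integral_FTC_integrable[where F = "\<lambda>x. - F x"])
    show "((\<lambda>x. - F x) has_vector_derivative g x) (at x)" for x
      using DERIV_minus[OF F, of x] by (simp add: has_real_derivative_iff_has_vector_derivative)
    show "set_integrable lborel (einterval (ereal u) \<infinity>) g"
      unfolding set_integrable_def using int by (intro integrable_mult_indicator) auto
    have "isCont F u"
      using F by (rule DERIV_isCont)
    then have "(F \<longlongrightarrow> F u) (at_right u)"
      by (simp add: isCont_def filterlim_at_split)
    from tendsto_minus[OF this] show "(((\<lambda>x. - F x) \<circ> real_of_ereal) \<longlongrightarrow> - F u) (at_right (ereal u))"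
      by (simp add: ereal_tendsto_simps1)
    show "(((\<lambda>x. - F x) \<circ> real_of_ereal) \<longlongrightarrow> 0) (at_left \<infinity>)"
      using tendsto_minus[OF lim] by (simp add: ereal_tendsto_simps1)
  qed (use g in auto)
  then show ?thesis
    by (simp add: interval_integral_to_infinity_eq set_lebesgue_integral_def mult.commute)
qed

lemma integrable_std_normal_hermite:
  "integrable lborel (\<lambda>x. std_normal_density x * x)"
  "integrable lborel (\<lambda>x. std_normal_density x * (x\<^sup>2 - 1))"
proof -
  show 1: "integrable lborel (\<lambda>x. std_normal_density x * x)"
    using integrable_std_normal_moment[of 1] by simp
  have "integrable lborel (\<lambda>x. std_normal_density x * x\<^sup>2 - std_normal_density x)"
    using integrable_std_normal_moment[of 2] by (intro Bochner_Integration.integrable_diff) auto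
  then show "integrable lborel (\<lambda>x. std_normal_density x * (x\<^sup>2 - 1))"
    by (simp add: algebra_simps)
qed

lemma integral_std_normal_hermite:
  "(\<integral>x. std_normal_density x * x \<partial>lborel) = 0"
  "(\<integral>x. std_normal_density x * (x\<^sup>2 - 1) \<partial>lborel) = 0"
proof -
  show "(\<integral>x. std_normal_density x * x \<partial>lborel) = 0"
    using integral_std_normal_moment_odd[of 0] by simp
  have "(\<integral>x. std_normal_density x * x\<^sup>2 - std_normal_density x \<partial>lborel) = 1 - 1"
    using integrable_std_normal_moment[of 2] integral_std_normal_moment_even[of 1]
    by (subst Bochner_Integration.integral_diff) auto
  then show "(\<integral>x. std_normal_density x * (x\<^sup>2 - 1) \<partial>lborel) = 0"
    by (simp add: algebra_simps)
qed

text \<open>With phi the standard normal density, x phi is minus the derivative of phi and (x^2 - 1)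
  phi is minus the derivative of x phi. The weights are the Hermite polynomials of degrees 1 and
  2.\<close>

lemma upper_tail_hermite:
  "(\<integral>x. std_normal_density x * x * indicator {u<..} x \<partial>lborel) = std_normal_density u"
  "(\<integral>x. std_normal_density x * (x\<^sup>2 - 1) * indicator {u<..} x \<partial>lborel) = u * std_normal_density u"
proof -
  note c = DERIV_isCont[OF DERIV_std_normal_density]
  have lim: "(std_normal_density \<longlongrightarrow> 0) at_top" "((\<lambda>x. x * std_normal_density x) \<longlongrightarrow> 0) at_top"
    unfolding std_normal_density_def[abs_def] by real_asymp+
  show "(\<integral>x. std_normal_density x * x * indicator {u<..} x \<partial>lborel) = std_normal_density u"
  proof (rule std_normal_upper_tail_integral[OF _ _ integrable_std_normal_hermite(1) lim(1)])
    show "(std_normal_density has_real_derivative - (std_normal_density x * x)) (at x)" for x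
      using DERIV_std_normal_density[of x] by (simp add: mult.commute)
  qed (intro continuous_intros c)
  show "(\<integral>x. std_normal_density x * (x\<^sup>2 - 1) * indicator {u<..} x \<partial>lborel) = u * std_normal_density u"
  proof (rule std_normal_upper_tail_integral[OF _ _ integrable_std_normal_hermite(2) lim(2)])
    show "((\<lambda>x. x * std_normal_density x) has_real_derivative - (std_normal_density x * (x\<^sup>2 - 1))) (at x)" for x
      using DERIV_mult[OF DERIV_ident DERIV_std_normal_density, of x] by (simp add: algebra_simps power2_eq_square)
  qed (intro continuous_intros c)
qed

text \<open>For negative \<open>a\<close> the half-line is the complement of an upper tail; as the
  full integral is zero, only the sign changes.\<close>

lemma std_normal_halfline_integral:
  fixes h :: "real \<Rightarrow> real"
  assumes int: "integrable lborel (\<lambda>x. std_normal_density x * h x)"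
    and zero: "(\<integral>x. std_normal_density x * h x \<partial>lborel) = 0"
    and tail: "\<And>u. (\<integral>x. std_normal_density x * h x * indicator {u<..} x \<partial>lborel) = H u"
    and a: "a \<noteq> 0"
  shows "(\<integral>x. std_normal_density x * (h x * (if s \<le> a * x then 1 else 0)) \<partial>lborel) = sgn a * H (s / a)"
proof (cases "0 < a")
  case True
  have "(\<integral>x. std_normal_density x * (h x * (if s \<le> a * x then 1 else 0)) \<partial>lborel) =
      (\<integral>x. std_normal_density x * h x * indicator {s / a<..} x \<partial>lborel)"
  proof (rule integral_cong_AE)
    \<comment> \<open>The closed and the open half-line differ in the single point
      \<open>s / a\<close>.\<close>
    show "AE x in lborel. std_normal_density x * (h x * (if s \<le> a * x then 1 else 0)) =
        std_normal_density x * h x * indicator {s / a<..} x"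
      using AE_lborel_singleton[of "s / a"] by eventually_elim (use True in \<open>auto simp: indicator_def field_simps\<close>)
    have "(\<lambda>x. (std_normal_density x * h x) * (if s \<le> a * x then 1 else 0)) \<in> borel_measurable lborel"
      using int by measurable
    then show "(\<lambda>x. std_normal_density x * (h x * (if s \<le> a * x then 1 else 0))) \<in> borel_measurable lborel"
      by (simp add: mult.assoc)
  qed (use int in measurable)
  then show ?thesis
    using True tail by simp
next
  case False
  then have "a < 0" using a by simp
  have "(\<integral>x. std_normal_density x * (h x * (if s \<le> a * x then 1 else 0)) \<partial>lborel) =
      (\<integral>x. std_normal_density x * h x - std_normal_density x * h x * indicator {s / a<..} x \<partial>lborel)"
    using \<open>a < 0\<close> by (intro Bochner_Integration.integral_cong refl) (auto simp: indicator_def field_simps)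
  also have "\<dots> = 0 - H (s / a)"
    using int by (subst Bochner_Integration.integral_diff)
      (auto simp: zero tail intro!: integrable_real_mult_indicator)
  finally show ?thesis
    using \<open>a < 0\<close> by simp
qed

lemma normal_density_scale: "a \<noteq> 0 \<Longrightarrow> std_normal_density (s / a) = \<bar>a\<bar> * normal_density 0 \<bar>a\<bar> s"
  by (simp add: normal_density_def real_sqrt_mult power_divide)

text \<open>The tail values are rewritten as centred normal densities of deviation
  \<open>\<bar>a\<bar>\<close> in the variable \<open>s\<close>, ready for convolution with the law
  of the other coordinates.\<close>

lemma halfline_hermite:
  "(\<integral>x. std_normal_density x * (x * (if s \<le> a * x then 1 else 0)) \<partial>lborel) = a * normal_density 0 \<bar>a\<bar> s"
  "a \<noteq> 0 \<Longrightarrow> (\<integral>x. std_normal_density x * ((x\<^sup>2 - 1) * (if s \<le> a * x then 1 else 0)) \<partial>lborel) = s * normal_density 0 \<bar>a\<bar> s"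
  "(\<integral>x. std_normal_density x * ((x\<^sup>2 - 1) * (if s \<le> 0 then 1 else 0)) \<partial>lborel) = 0"
proof -
  have "sgn a * std_normal_density (s / a) = a * normal_density 0 \<bar>a\<bar> s" if "a \<noteq> 0"
    using that by (simp add: normal_density_scale sgn_if)
  then show "(\<integral>x. std_normal_density x * (x * (if s \<le> a * x then 1 else 0)) \<partial>lborel) = a * normal_density 0 \<bar>a\<bar> s"
    using std_normal_halfline_integral[OF integrable_std_normal_hermite(1) integral_std_normal_hermite(1) upper_tail_hermite(1), of a s]
      integral_std_normal_hermite(1)
    by (cases "a = 0"; cases "s \<le> 0") auto
  show "(\<integral>x. std_normal_density x * ((x\<^sup>2 - 1) * (if s \<le> a * x then 1 else 0)) \<partial>lborel) = s * normal_density 0 \<bar>a\<bar> s" if "a \<noteq> 0"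
    using std_normal_halfline_integral[OF integrable_std_normal_hermite(2) integral_std_normal_hermite(2) upper_tail_hermite(2) that, of s]
      normal_density_scale[OF that, of s] that by (simp add: sgn_if split: if_splits)
  show "(\<integral>x. std_normal_density x * ((x\<^sup>2 - 1) * (if s \<le> 0 then 1 else 0)) \<partial>lborel) = 0"
    using integral_std_normal_hermite(2) by simp
qed

text \<open>Completing the square, or Bayes' rule: if r has deviation \<open>\<sigma>\<close> and an
  independent normal variable of deviation \<open>a\<close> is added, the sum is standard normal,
  and given the value \<open>\<tau>\<close> of the sum, r has mean
  \<open>\<sigma>\<^sup>2 * \<tau>\<close> and deviation \<open>a * \<sigma>\<close>.\<close>

lemma normal_density_convolution_eq:
  assumes "0 < a" "0 < \<sigma>" "a\<^sup>2 + \<sigma>\<^sup>2 = 1"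
  shows "normal_density 0 a (\<tau> - r) * normal_density 0 \<sigma> r = std_normal_density \<tau> * normal_density (\<sigma>\<^sup>2 * \<tau>) (a * \<sigma>) r"
proof -
  have "(\<tau> - r)\<^sup>2 / (2 * a\<^sup>2) + r\<^sup>2 / (2 * \<sigma>\<^sup>2) = \<tau>\<^sup>2 / 2 + (r - \<sigma>\<^sup>2 * \<tau>)\<^sup>2 / (2 * (a\<^sup>2 * \<sigma>\<^sup>2))"
  proof -
    have s: "\<sigma>\<^sup>2 = 1 - a\<^sup>2" using assms(3) by simp
    have "\<sigma>\<^sup>2 * (\<tau> - r)\<^sup>2 + a\<^sup>2 * r\<^sup>2 = a\<^sup>2 * \<sigma>\<^sup>2 * \<tau>\<^sup>2 + (r - \<sigma>\<^sup>2 * \<tau>)\<^sup>2"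
      unfolding s by (simp add: power2_eq_square algebra_simps)
    then show ?thesis
      using assms(1,2) by (simp add: field_simps)
  qed
  then have "exp (- ((\<tau> - r)\<^sup>2 / (2 * a\<^sup>2))) * exp (- (r\<^sup>2 / (2 * \<sigma>\<^sup>2))) =
      exp (- (\<tau>\<^sup>2 / 2)) * exp (- ((r - \<sigma>\<^sup>2 * \<tau>)\<^sup>2 / (2 * (a\<^sup>2 * \<sigma>\<^sup>2))))"
    by (simp flip: exp_add add: algebra_simps)
  then show ?thesis
    using assms(1,2) by (simp add: normal_density_def power_mult_distrib real_sqrt_mult field_simps)
qed

section \<open>The Gaussian product measure, its linear forms and its moments\<close>

abbreviation gaussian :: "nat set \<Rightarrow> (nat \<Rightarrow> real) measure" where
  "gaussian J \<equiv> PiM J (\<lambda>_. std_normal_distribution)"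

lemma prob_space_std_normal: "prob_space std_normal_distribution"
  by (rule prob_space_normal_density) simp

lemma prob_space_gaussian: "prob_space (gaussian J)"
  by (intro prob_space_PiM prob_space_std_normal)

lemma measurable_gaussian_component [measurable]: "i \<in> J \<Longrightarrow> (\<lambda>x. x i) \<in> borel_measurable (gaussian J)"
  using measurable_component_singleton[of i J "\<lambda>_. std_normal_distribution"]
  by (simp cong: measurable_cong_sets)

lemma distributed_gaussian_component:
  assumes "i \<in> J"
  shows "distributed (gaussian J) lborel (\<lambda>x. x i) std_normal_density"
proof -
  have "distr (gaussian J) lborel (\<lambda>x. x i) = distr (gaussian J) std_normal_distribution (\<lambda>x. x i)"
    by (rule distr_cong) auto
  also have "\<dots> = std_normal_distribution"
    by (rule distr_PiM_component[OF prob_space_std_normal assms])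
  finally show ?thesis
    using assms by (auto simp: distributed_def)
qed

lemma indep_vars_gaussian:
  assumes "J \<noteq> {}"
  shows "prob_space.indep_vars (gaussian J) (\<lambda>_. borel) (\<lambda>i x. x i) J"
proof -
  interpret prob_space "gaussian J" by (rule prob_space_gaussian)
  have s: "sets (gaussian J) = sets (PiM J (\<lambda>_. borel :: real measure))"
    by (intro sets_PiM_cong) auto
  have "distr (gaussian J) (PiM J (\<lambda>_. borel)) (\<lambda>x. \<lambda>i\<in>J. x i) = distr (gaussian J) (gaussian J) (\<lambda>x. x)"
    by (rule distr_cong) (use s in \<open>auto simp: space_PiM\<close>)
  also have "\<dots> = gaussian J"
    by (rule distr_id)
  also have "\<dots> = PiM J (\<lambda>i. distr (gaussian J) borel (\<lambda>x. x i))"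
  proof (rule PiM_cong)
    fix i assume i: "i \<in> J"
    have "distr (gaussian J) borel (\<lambda>x. x i) = distr (gaussian J) std_normal_distribution (\<lambda>x. x i)"
      by (rule distr_cong) auto
    also have "\<dots> = std_normal_distribution"
      by (rule distr_PiM_component[OF prob_space_std_normal i])
    finally show "std_normal_distribution = distr (gaussian J) borel (\<lambda>x. x i)" ..
  qed simp
  finally show ?thesis
    using assms by (subst indep_vars_iff_distr_eq_PiM') auto
qed

lemma distributed_gaussian_linear:
  assumes J: "finite J" and \<sigma>: "0 < \<sigma>" "(\<Sum>j\<in>J. (v j)\<^sup>2) = \<sigma>\<^sup>2"
  shows "distributed (gaussian J) lborel (\<lambda>x. \<Sum>j\<in>J. v j * x j) (normal_density 0 \<sigma>)"
proof -
  interpret prob_space "gaussian J" by (rule prob_space_gaussian)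
  \<comment> \<open>Vanishing coefficients are dropped because the sum rule for independent normal
    variables asks for positive deviations.\<close>
  define K where "K = {j \<in> J. v j \<noteq> 0}"
  have K: "finite K" "K \<subseteq> J" using J by (auto simp: K_def)
  have v2: "(\<Sum>j\<in>K. (v j)\<^sup>2) = \<sigma>\<^sup>2"
    unfolding \<sigma>(2)[symmetric] by (rule sum.mono_neutral_left) (use J in \<open>auto simp: K_def\<close>)
  then have ne: "K \<noteq> {}" using \<sigma>(1) by auto
  then have "J \<noteq> {}" using K by auto
  then have "indep_vars (\<lambda>_. borel) (\<lambda>j x. x j) K"
    by (rule indep_vars_subset[OF indep_vars_gaussian K(2)])
  then have ind: "indep_vars (\<lambda>_. borel) (\<lambda>j x. v j * x j) K"
    by (rule indep_vars_compose2) auto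
  have "distributed (gaussian J) lborel (\<lambda>x. \<Sum>j\<in>K. v j * x j) (normal_density (\<Sum>j\<in>K. 0) (sqrt (\<Sum>j\<in>K. \<bar>v j\<bar>\<^sup>2)))"
  proof (rule sum_indep_normal[OF K(1) ne ind])
    fix j assume j: "j \<in> K"
    then have "j \<in> J" using K by auto
    from normal_density_affine[OF distributed_gaussian_component[OF this], of "v j" 0]
    show "distributed (gaussian J) lborel (\<lambda>x. v j * x j) (normal_density 0 \<bar>v j\<bar>)"
      using j by (simp add: K_def)
  qed (auto simp: K_def)
  moreover have "(\<Sum>j\<in>K. v j * x j) = (\<Sum>j\<in>J. v j * x j)" for x
    by (rule sum.mono_neutral_left) (use J in \<open>auto simp: K_def\<close>)
  ultimately show ?thesis
    using v2 \<sigma>(1) by simp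
qed

text \<open>The left-hand side is the double factorial (2k-1)!!. The proof bounds already the larger
  quotient (2k)! / k!, a product of k factors of size at most 2k.\<close>

lemma std_normal_even_moment_le: "fact (2 * k) / (2 ^ k * fact k) \<le> (2 * real k) ^ k"
proof -
  have "fact (2 * k) div fact (2 * k - k) \<le> (2 * k) ^ k"
    by (rule fact_div_fact_le_pow) simp
  moreover have "(fact k :: nat) dvd fact (2 * k)"
    by (rule fact_dvd) simp
  ultimately have "fact (2 * k) \<le> (2 * k) ^ k * fact k"
    by (simp add: mult_2) (metis dvd_div_mult_self mult_le_mono1)
  then have "real (fact (2 * k)) \<le> real ((2 * k) ^ k * fact k)"
    by (simp only: of_nat_le_iff)
  then have "fact (2 * k) \<le> (2 * real k) ^ k * fact k"
    by simp
  also have "\<dots> \<le> (2 * real k) ^ k * (2 ^ k * fact k)"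
    by (intro mult_left_mono) auto
  finally show ?thesis
    by (simp add: divide_le_eq)
qed

lemma distributed_std_normal_moment:
  assumes "distributed M lborel Y std_normal_density"
  shows "integrable M (\<lambda>x. Y x ^ (2 * k))" "(\<integral>x. Y x ^ (2 * k) \<partial>M) \<le> (2 * real k) ^ k"
proof -
  show "integrable M (\<lambda>x. Y x ^ (2 * k))"
    using distributed_integrable[OF assms, of "\<lambda>x. x ^ (2 * k)"] integrable_std_normal_moment[of "2 * k"]
    by simp
  have "(\<integral>x. Y x ^ (2 * k) \<partial>M) = fact (2 * k) / (2 ^ k * fact k)"
    using distributed_integral[OF assms, of "\<lambda>x. x ^ (2 * k)"] integral_std_normal_moment_even[of k]
    by simp
  then show "(\<integral>x. Y x ^ (2 * k) \<partial>M) \<le> (2 * real k) ^ k"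
    using std_normal_even_moment_le by simp
qed

text \<open>Comparison with d times the largest entry. The loss is a power of d, which the sample
  size absorbs later.\<close>

lemma sum_power_le:
  fixes a :: "nat \<Rightarrow> real"
  assumes "0 < d" "\<And>l. 0 \<le> a l"
  shows "(\<Sum>l<d. a l) ^ m \<le> real d ^ m * (\<Sum>l<d. a l ^ m)"
proof -
  have "finite (a ` {..<d})" "a ` {..<d} \<noteq> {}" using assms(1) by auto
  then obtain k where k: "k < d" "\<And>l. l < d \<Longrightarrow> a l \<le> a k"
    using Max_in[of "a ` {..<d}"] Max_ge[of "a ` {..<d}"] by fastforce
  have "(\<Sum>l<d. a l) \<le> real d * a k"
    using sum_bounded_above[of "{..<d}" a "a k"] k by simp
  then have "(\<Sum>l<d. a l) ^ m \<le> (real d * a k) ^ m"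
    by (intro power_mono sum_nonneg assms)
  also have "\<dots> = real d ^ m * a k ^ m"
    by (rule power_mult_distrib)
  also have "a k ^ m \<le> (\<Sum>l<d. a l ^ m)"
    using k(1) assms(2) by (intro member_le_sum) auto
  finally show ?thesis by (simp add: mult_left_mono)
qed

lemma gaussian_norm_moment:
  assumes "0 < d"
  shows "integrable (gaussian {..<d}) (\<lambda>x. (\<Sum>l<d. (x l)\<^sup>2) ^ m)"
    "(\<integral>x. (\<Sum>l<d. (x l)\<^sup>2) ^ m \<partial>gaussian {..<d}) \<le> real d ^ (m + 1) * (2 * real m) ^ m"
proof -
  let ?G = "gaussian {..<d}"
  have mom: "integrable ?G (\<lambda>x. x l ^ (2 * m))" "(\<integral>x. x l ^ (2 * m) \<partial>?G) \<le> (2 * real m) ^ m" if "l < d" for l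
    using distributed_std_normal_moment[OF distributed_gaussian_component[of l "{..<d}"]] that by auto
  have le: "(\<Sum>l<d. (x l)\<^sup>2) ^ m \<le> real d ^ m * (\<Sum>l<d. x l ^ (2 * m))" for x :: "nat \<Rightarrow> real"
    using sum_power_le[OF assms, of "\<lambda>l. (x l)\<^sup>2" m] by (simp add: power_mult)
  have int: "integrable ?G (\<lambda>x. real d ^ m * (\<Sum>l<d. x l ^ (2 * m)))"
    using mom(1) by (intro integrable_mult_right Bochner_Integration.integrable_sum) auto
  show 1: "integrable ?G (\<lambda>x. (\<Sum>l<d. (x l)\<^sup>2) ^ m)"
  proof (rule Bochner_Integration.integrable_bound[OF int])
    show "(\<lambda>x. (\<Sum>l<d. (x l)\<^sup>2) ^ m) \<in> borel_measurable ?G"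
      by measurable
    show "AE x in ?G. norm ((\<Sum>l<d. (x l)\<^sup>2) ^ m) \<le> norm (real d ^ m * (\<Sum>l<d. x l ^ (2 * m)))"
    proof (rule AE_I2)
      fix x :: "nat \<Rightarrow> real"
      have "0 \<le> (\<Sum>l<d. (x l)\<^sup>2) ^ m" by (rule zero_le_power, rule sum_nonneg) simp
      then show "norm ((\<Sum>l<d. (x l)\<^sup>2) ^ m) \<le> norm (real d ^ m * (\<Sum>l<d. x l ^ (2 * m)))"
        using le[of x] by simp
    qed
  qed
  have "(\<integral>x. (\<Sum>l<d. (x l)\<^sup>2) ^ m \<partial>?G) \<le> (\<integral>x. real d ^ m * (\<Sum>l<d. x l ^ (2 * m)) \<partial>?G)"
    by (rule integral_mono[OF 1 int le])
  also have "\<dots> = real d ^ m * (\<Sum>l<d. \<integral>x. x l ^ (2 * m) \<partial>?G)"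
    using mom(1) by (simp add: Bochner_Integration.integral_sum)
  also have "\<dots> \<le> real d ^ m * (\<Sum>l<d. (2 * real m) ^ m)"
    using mom(2) by (intro mult_left_mono sum_mono) auto
  finally show "(\<integral>x. (\<Sum>l<d. (x l)\<^sup>2) ^ m \<partial>?G) \<le> real d ^ (m + 1) * (2 * real m) ^ m"
    by (simp add: mult_ac)
qed

lemma integral_std_normal:
  "g \<in> borel_measurable borel \<Longrightarrow> (\<integral>x. g x \<partial>std_normal_distribution) = (\<integral>x. std_normal_density x * g x \<partial>lborel)"
  for g :: "real \<Rightarrow> real"
  by (subst integral_real_density) auto

lemma integrable_std_normal:
  "g \<in> borel_measurable borel \<Longrightarrow> integrable std_normal_distribution g \<longleftrightarrow> integrable lborel (\<lambda>x. std_normal_density x * g x)"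
  for g :: "real \<Rightarrow> real"
  by (subst integrable_real_density) auto

lemma gaussian_component_integrable:
  assumes "i \<in> J" "h \<in> borel_measurable borel" "integrable lborel (\<lambda>x. std_normal_density x * h x)"
  shows "integrable (gaussian J) (\<lambda>x. h (x i) :: real)"
  using PiM_component_integral(1)[OF prob_space_std_normal assms(1), of h] assms integrable_std_normal by blast

lemma gaussian_component_integral:
  assumes "i \<in> J" "h \<in> borel_measurable borel" "integrable lborel (\<lambda>x. std_normal_density x * h x)"
  shows "(\<integral>x. h (x i) \<partial>gaussian J) = (\<integral>x. std_normal_density x * h x \<partial>lborel :: real)"
  using PiM_component_integral(2)[OF prob_space_std_normal assms(1), of h] integrable_std_normal[OF assms(2)]
    integral_std_normal[OF assms(2)] assms(3) by simp

text \<open>Coordinate \<open>l\<close> is integrated with the others frozen: the halfspace becomes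
  a half-line in y whose end is shifted by the rest of the linear form.\<close>

lemma gaussian_halfspace_Fubini:
  fixes h :: "real \<Rightarrow> real" and v :: "nat \<Rightarrow> real"
  assumes l: "l < d" and h [measurable]: "h \<in> borel_measurable borel"
    and int: "integrable lborel (\<lambda>x. std_normal_density x * h x)"
  shows "(\<integral>x. h (x l) * (if \<tau> \<le> (\<Sum>i<d. v i * x i) then 1 else 0) \<partial>gaussian {..<d}) =
    (\<integral>x. (\<integral>y. std_normal_density y * (h y * (if \<tau> - (\<Sum>i\<in>{..<d} - {l}. v i * x i) \<le> v l * y then 1 else 0)) \<partial>lborel)
      \<partial>gaussian ({..<d} - {l}))"
proof -
  let ?J = "{..<d} - {l}"
  let ?F = "\<lambda>x. h (x l) * (if \<tau> \<le> (\<Sum>i<d. v i * x i) then 1 else 0)"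
  interpret prob_space std_normal_distribution by (rule prob_space_std_normal)
  interpret product_sigma_finite "\<lambda>_::nat. std_normal_distribution" by standard
  have ins: "insert l ?J = {..<d}" using l by auto
  have [measurable]: "(\<lambda>x. h (x l)) \<in> borel_measurable (gaussian {..<d})"
    by (rule measurable_compose[OF measurable_gaussian_component h]) (use l in simp)
  have "integrable (gaussian {..<d}) ?F"
    by (rule Bochner_Integration.integrable_bound[OF gaussian_component_integrable[where i = l and J = "{..<d}", OF _ h int]])
      (use l in \<open>auto simp: abs_mult\<close>)
  then have "integral\<^sup>L (gaussian {..<d}) ?F = (\<integral>x. (\<integral>y. ?F (x(l := y)) \<partial>std_normal_distribution) \<partial>gaussian ?J)"
    using product_integral_insert[of ?J l ?F] ins by simp
  also have "\<dots> = (\<integral>x. (\<integral>y. h y * (if \<tau> - (\<Sum>i\<in>?J. v i * x i) \<le> v l * y then 1 else 0) \<partial>std_normal_distribution) \<partial>gaussian ?J)"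
  proof (intro Bochner_Integration.integral_cong refl)
    fix x :: "nat \<Rightarrow> real" and y
    have "(\<Sum>i<d. v i * (x(l := y)) i) = (\<Sum>i\<in>insert l ?J. v i * (x(l := y)) i)"
      by (simp only: ins)
    also have "\<dots> = v l * y + (\<Sum>i\<in>?J. v i * x i)"
      by (subst sum.insert) (auto intro!: sum.cong)
    finally show "?F (x(l := y)) = h y * (if \<tau> - (\<Sum>i\<in>?J. v i * x i) \<le> v l * y then 1 else 0)"
      by (auto simp: algebra_simps)
  qed
  also have "\<dots> = (\<integral>x. (\<integral>y. std_normal_density y * (h y * (if \<tau> - (\<Sum>i\<in>?J. v i * x i) \<le> v l * y then 1 else 0)) \<partial>lborel) \<partial>gaussian ?J)"
    by (intro Bochner_Integration.integral_cong refl integral_std_normal) measurable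
  finally show ?thesis .
qed

text \<open>No rotation of coordinates is performed: integrating out coordinate \<open>l\<close>
  leaves a function of the remaining linear form, which is normal with variance
  \<open>1 - (v l)\<^sup>2\<close>, and the convolution identity evaluates the rest.\<close>

lemma gaussian_halfspace_hermite:
  fixes v :: "nat \<Rightarrow> real"
  assumes l: "l < d" and v: "(\<Sum>i<d. (v i)\<^sup>2) = 1"
  shows "(\<integral>x. x l * (if \<tau> \<le> (\<Sum>i<d. v i * x i) then 1 else 0) \<partial>gaussian {..<d}) = v l * std_normal_density \<tau>"
    and "(\<integral>x. ((x l)\<^sup>2 - 1) * (if \<tau> \<le> (\<Sum>i<d. v i * x i) then 1 else 0) \<partial>gaussian {..<d}) = (v l)\<^sup>2 * (\<tau> * std_normal_density \<tau>)"
proof -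
  let ?J = "{..<d} - {l}" and ?a = "v l"
  let ?r = "\<lambda>x :: nat \<Rightarrow> real. \<Sum>i\<in>?J. v i * x i"
  interpret J: prob_space "gaussian ?J" by (rule prob_space_gaussian)
  define \<sigma> where "\<sigma> = sqrt (\<Sum>i\<in>?J. (v i)\<^sup>2)"
  have s0: "0 \<le> (\<Sum>i\<in>?J. (v i)\<^sup>2)" by (rule sum_nonneg) simp
  then have \<sigma>2: "(\<Sum>i\<in>?J. (v i)\<^sup>2) = \<sigma>\<^sup>2" by (simp add: \<sigma>_def)
  have a\<sigma>: "?a\<^sup>2 + \<sigma>\<^sup>2 = 1"
    using v sum.remove[of "{..<d}" l "\<lambda>i. (v i)\<^sup>2"] l \<sigma>2 by simp
  have 1: "(\<integral>x. x l * (if \<tau> \<le> (\<Sum>i<d. v i * x i) then 1 else 0) \<partial>gaussian {..<d}) =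
      (\<integral>x. ?a * normal_density 0 \<bar>?a\<bar> (\<tau> - ?r x) \<partial>gaussian ?J)"
    using gaussian_halfspace_Fubini[OF l _ integrable_std_normal_hermite(1), where v = v and \<tau> = \<tau>]
    by (simp add: halfline_hermite(1))
  have F2: "(\<integral>x. ((x l)\<^sup>2 - 1) * (if \<tau> \<le> (\<Sum>i<d. v i * x i) then 1 else 0) \<partial>gaussian {..<d}) =
      (\<integral>x. (\<integral>y. std_normal_density y * ((y\<^sup>2 - 1) * (if \<tau> - ?r x \<le> ?a * y then 1 else 0)) \<partial>lborel) \<partial>gaussian ?J)"
    by (rule gaussian_halfspace_Fubini[OF l _ integrable_std_normal_hermite(2)]) measurable
  have 2: "(\<integral>x. ((x l)\<^sup>2 - 1) * (if \<tau> \<le> (\<Sum>i<d. v i * x i) then 1 else 0) \<partial>gaussian {..<d}) =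
      (\<integral>x. (\<tau> - ?r x) * normal_density 0 \<bar>?a\<bar> (\<tau> - ?r x) \<partial>gaussian ?J)" if "?a \<noteq> 0"
    unfolding F2 by (simp add: halfline_hermite(2)[OF that])
  have z: "(\<integral>x. ((x l)\<^sup>2 - 1) * (if \<tau> \<le> (\<Sum>i<d. v i * x i) then 1 else 0) \<partial>gaussian {..<d}) = 0" if "?a = 0"
    unfolding F2 that mult_zero_left halfline_hermite(3) by simp
  show "(\<integral>x. x l * (if \<tau> \<le> (\<Sum>i<d. v i * x i) then 1 else 0) \<partial>gaussian {..<d}) = v l * std_normal_density \<tau>"
    and "(\<integral>x. ((x l)\<^sup>2 - 1) * (if \<tau> \<le> (\<Sum>i<d. v i * x i) then 1 else 0) \<partial>gaussian {..<d}) = (v l)\<^sup>2 * (\<tau> * std_normal_density \<tau>)"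
  proof -
    \<comment> \<open>The convolution identity needs two positive deviations. The degenerate cases
      are \<open>v\<close> orthogonal to the coordinate and \<open>v\<close> equal to plus or minus
      its unit vector.\<close>
    consider "?a = 0" | "?a \<noteq> 0" "\<sigma> = 0" | "?a \<noteq> 0" "0 < \<sigma>"
      using s0 by (fastforce simp: \<sigma>_def)
    then have "(\<integral>x. ?a * normal_density 0 \<bar>?a\<bar> (\<tau> - ?r x) \<partial>gaussian ?J) = ?a * std_normal_density \<tau> \<and>
      (?a \<noteq> 0 \<longrightarrow> (\<integral>x. (\<tau> - ?r x) * normal_density 0 \<bar>?a\<bar> (\<tau> - ?r x) \<partial>gaussian ?J) = ?a\<^sup>2 * (\<tau> * std_normal_density \<tau>))"
    proof cases
      case 2
      then have a2: "?a\<^sup>2 = 1" using a\<sigma> by simp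
      then have a1: "\<bar>?a\<bar> = 1" by (simp add: abs_square_eq_1)
      have "v i = 0" if "i \<in> ?J" for i
        using 2(2) \<sigma>2 that by (simp add: sum_nonneg_eq_0_iff)
      then have r: "?r x = 0" for x by simp
      show ?thesis
        unfolding r a1 a2 by (simp add: J.prob_space)
    next
      case 3
      have D: "distributed (gaussian ?J) lborel ?r (normal_density 0 \<sigma>)"
        by (rule distributed_gaussian_linear) (use 3 \<sigma>2 in auto)
      note c = normal_density_convolution_eq[of "\<bar>?a\<bar>" \<sigma> \<tau>]
      have c: "normal_density 0 \<bar>?a\<bar> (\<tau> - r) * normal_density 0 \<sigma> r = std_normal_density \<tau> * normal_density (\<sigma>\<^sup>2 * \<tau>) (\<bar>?a\<bar> * \<sigma>) r" for r
        by (rule c) (use 3 a\<sigma> in auto)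
      have p: "0 < \<bar>?a\<bar> * \<sigma>" using 3 by simp
      have "(\<integral>x. ?a * normal_density 0 \<bar>?a\<bar> (\<tau> - ?r x) \<partial>gaussian ?J) =
          (\<integral>r. normal_density 0 \<sigma> r * (?a * normal_density 0 \<bar>?a\<bar> (\<tau> - r)) \<partial>lborel)"
        by (rule distributed_integral[OF D, symmetric]) auto
      also have "\<dots> = (\<integral>r. (?a * std_normal_density \<tau>) * normal_density (\<sigma>\<^sup>2 * \<tau>) (\<bar>?a\<bar> * \<sigma>) r \<partial>lborel)"
        using c by (intro Bochner_Integration.integral_cong refl) (simp add: mult_ac)
      also have "\<dots> = ?a * std_normal_density \<tau>"
        using integral_normal_density[OF p] by simp
      finally have A: "(\<integral>x. ?a * normal_density 0 \<bar>?a\<bar> (\<tau> - ?r x) \<partial>gaussian ?J) = ?a * std_normal_density \<tau>" .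
      have "(\<integral>x. (\<tau> - ?r x) * normal_density 0 \<bar>?a\<bar> (\<tau> - ?r x) \<partial>gaussian ?J) =
          (\<integral>r. normal_density 0 \<sigma> r * ((\<tau> - r) * normal_density 0 \<bar>?a\<bar> (\<tau> - r)) \<partial>lborel)"
        by (rule distributed_integral[OF D, symmetric]) auto
      also have "\<dots> = (\<integral>r. std_normal_density \<tau> * (\<tau> * normal_density (\<sigma>\<^sup>2 * \<tau>) (\<bar>?a\<bar> * \<sigma>) r - normal_density (\<sigma>\<^sup>2 * \<tau>) (\<bar>?a\<bar> * \<sigma>) r * r) \<partial>lborel)"
      proof (intro Bochner_Integration.integral_cong refl)
        fix r
        have "normal_density 0 \<sigma> r * ((\<tau> - r) * normal_density 0 \<bar>?a\<bar> (\<tau> - r)) = (\<tau> - r) * (normal_density 0 \<bar>?a\<bar> (\<tau> - r) * normal_density 0 \<sigma> r)"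
          by (simp add: mult_ac)
        then show "normal_density 0 \<sigma> r * ((\<tau> - r) * normal_density 0 \<bar>?a\<bar> (\<tau> - r)) =
          std_normal_density \<tau> * (\<tau> * normal_density (\<sigma>\<^sup>2 * \<tau>) (\<bar>?a\<bar> * \<sigma>) r - normal_density (\<sigma>\<^sup>2 * \<tau>) (\<bar>?a\<bar> * \<sigma>) r * r)"
          unfolding c by (simp add: algebra_simps)
      qed
      \<comment> \<open>The shifted density has mean \<open>\<sigma>\<^sup>2 * \<tau>\<close>, so
        this is the mean of \<open>\<tau> - r\<close> under it.\<close>
      also have "\<dots> = std_normal_density \<tau> * (\<tau> - \<sigma>\<^sup>2 * \<tau>)"
        using integral_normal_moment_nz_1[OF p, of "\<sigma>\<^sup>2 * \<tau>"] integrable_normal_moment_nz_1[OF p, of "\<sigma>\<^sup>2 * \<tau>"]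
          integrable_normal_density[OF p, of "\<sigma>\<^sup>2 * \<tau>"] integral_normal_density[OF p, of "\<sigma>\<^sup>2 * \<tau>"] by simp
      also have "\<dots> = ?a\<^sup>2 * (\<tau> * std_normal_density \<tau>)"
      proof -
        have "\<tau> - \<sigma>\<^sup>2 * \<tau> = ?a\<^sup>2 * \<tau>"
          unfolding a\<sigma>[THEN eq_diff_eq[THEN iffD2]] by (simp add: algebra_simps)
        then show ?thesis by simp
      qed
      finally show ?thesis
        using A by blast
    qed simp
    then show "(\<integral>x. x l * (if \<tau> \<le> (\<Sum>i<d. v i * x i) then 1 else 0) \<partial>gaussian {..<d}) = v l * std_normal_density \<tau>"
      and "(\<integral>x. ((x l)\<^sup>2 - 1) * (if \<tau> \<le> (\<Sum>i<d. v i * x i) then 1 else 0) \<partial>gaussian {..<d}) = (v l)\<^sup>2 * (\<tau> * std_normal_density \<tau>)"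
      unfolding 1 using 2 z by (cases "?a = 0"; simp)+
  qed
qed

lemma distributed_std_normal_interval:
  assumes "prob_space M" "distributed M lborel Y std_normal_density" "a \<le> b"
  shows "(\<And>x. a \<le> x \<Longrightarrow> x \<le> b \<Longrightarrow> std_normal_density x \<le> c) \<Longrightarrow> measure M {x \<in> space M. a \<le> Y x \<and> Y x \<le> b} \<le> c * (b - a)"
    and "(\<And>x. a \<le> x \<Longrightarrow> x \<le> b \<Longrightarrow> c \<le> std_normal_density x) \<Longrightarrow> c * (b - a) \<le> measure M {x \<in> space M. a \<le> Y x \<and> Y x \<le> b}"
proof -
  interpret prob_space M by (rule assms)
  have Y: "Y \<in> borel_measurable M"
    using assms(2) by (simp add: distributed_def)
  have int: "integrable lborel (\<lambda>x. std_normal_density x * indicator {a..b} x)"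
    by (intro integrable_real_mult_indicator) auto
  have "{x \<in> space M. a \<le> Y x \<and> Y x \<le> b} = Y -` {a..b} \<inter> space M" by auto
  then have "emeasure M {x \<in> space M. a \<le> Y x \<and> Y x \<le> b} = (\<integral>\<^sup>+x. ennreal (std_normal_density x) * indicator {a..b} x \<partial>lborel)"
    using distributed_emeasure[OF assms(2), of "{a..b}"] by simp
  also have "\<dots> = (\<integral>\<^sup>+x. ennreal (std_normal_density x * indicator {a..b} x) \<partial>lborel)"
    by (intro nn_integral_cong) (simp add: indicator_def)
  also have "\<dots> = ennreal (\<integral>x. std_normal_density x * indicator {a..b} x \<partial>lborel)"
    by (rule nn_integral_eq_integral[OF int]) auto
  finally have eq: "measure M {x \<in> space M. a \<le> Y x \<and> Y x \<le> b} = (\<integral>x. std_normal_density x * indicator {a..b} x \<partial>lborel)"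
    by (simp add: measure_def integral_nonneg_AE)
  have c: "(\<integral>x. c * indicator {a..b} x \<partial>lborel) = c * (b - a)"
    using assms(3) by simp
  have ic: "integrable lborel (\<lambda>x. c * indicator {a..b} x :: real)"
    using assms(3) by (intro integrable_mult_right) (simp add: integrable_indicator_iff)
  show "measure M {x \<in> space M. a \<le> Y x \<and> Y x \<le> b} \<le> c * (b - a)" if "\<And>x. a \<le> x \<Longrightarrow> x \<le> b \<Longrightarrow> std_normal_density x \<le> c"
    unfolding eq c[symmetric] using that by (intro integral_mono int ic) (auto simp: indicator_def)
  show "c * (b - a) \<le> measure M {x \<in> space M. a \<le> Y x \<and> Y x \<le> b}" if "\<And>x. a \<le> x \<Longrightarrow> x \<le> b \<Longrightarrow> c \<le> std_normal_density x"
    unfolding eq c[symmetric] using that by (intro integral_mono int ic) (auto simp: indicator_def)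
qed

lemma std_normal_density_le_half: "std_normal_density x \<le> 1 / 2"
proof -
  have "exp (- x\<^sup>2 / 2) \<le> 1" by simp
  moreover have "2 \<le> sqrt (2 * pi)"
    by (rule real_le_rsqrt) (use pi_gt3 in simp)
  ultimately have "exp (- x\<^sup>2 / 2) / sqrt (2 * pi) \<le> 1 / 2"
    by (intro frac_le) auto
  then show ?thesis
    by (simp add: std_normal_density_def)
qed

lemma std_normal_density_ge: "exp (- x\<^sup>2 / 2) / 3 \<le> std_normal_density x"
proof -
  have "sqrt (2 * pi) \<le> sqrt (3\<^sup>2)"
    by (intro real_sqrt_le_mono) (use pi_less_4 in simp)
  then have "sqrt (2 * pi) \<le> 3"
    by simp
  then have "exp (- x\<^sup>2 / 2) / 3 \<le> exp (- x\<^sup>2 / 2) / sqrt (2 * pi)"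
    by (intro frac_le) auto
  then show ?thesis
    by (simp add: std_normal_density_def)
qed

section \<open>Chow parameters of a halfspace\<close>

locale halfspace =
  fixes d :: nat and v :: "nat \<Rightarrow> real" and \<tau> :: real
  assumes unit: "(\<Sum>i<d. (v i)\<^sup>2) = 1" and d2: "2 \<le> d"
begin

abbreviation G :: "(nat \<Rightarrow> real) measure" where
  "G \<equiv> std_gaussian d"

definition lin :: "(nat \<Rightarrow> real) \<Rightarrow> real" where
  "lin x = (\<Sum>i<d. v i * x i)"

definition f :: "(nat \<Rightarrow> real) \<Rightarrow> real" where
  "f x = sgn_pm (lin x - \<tau>)"

lemma G_eq: "G = gaussian {..<d}"
  by (simp add: std_gaussian_def)

sublocale G: prob_space G
  by (rule prob_space_std_gaussian)

lemma measurable_coordinate [measurable]: "i < d \<Longrightarrow> (\<lambda>x. x i) \<in> borel_measurable G"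
  by (simp add: G_eq measurable_gaussian_component)

lemma measurable_lin [measurable]: "lin \<in> borel_measurable G"
  unfolding lin_def[abs_def] by measurable

lemma measurable_f [measurable]: "f \<in> borel_measurable G"
  unfolding f_def[abs_def] sgn_pm_def by measurable

lemma f_eq: "f x = 2 * (if \<tau> \<le> lin x then 1 else 0) - 1"
  by (simp add: f_def sgn_pm_def)

lemma f_sq: "(f x)\<^sup>2 = 1"
  by (simp add: f_def sgn_pm_def)

lemma distributed_lin: "distributed G lborel lin std_normal_density"
  using distributed_gaussian_linear[of "{..<d}" 1 v] unit by (simp add: G_eq lin_def[abs_def])

text \<open>The strength of the signal in the Chow parameters; the factor 2 appears because
  \<open>f\<close> is twice an indicator minus 1.\<close>

definition amp :: real where
  "amp = 2 * std_normal_density \<tau>"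

lemma amp_pos: "0 < amp"
  by (simp add: amp_def normal_density_pos)

lemma coordinate_moments:
  assumes "l < d"
  shows "integrable G (\<lambda>x. x l)" "(\<integral>x. x l \<partial>G) = 0"
    "integrable G (\<lambda>x. (x l)\<^sup>2)" "(\<integral>x. (x l)\<^sup>2 \<partial>G) \<le> 2"
    "integrable G (\<lambda>x. (x l)\<^sup>2 - 1)" "(\<integral>x. (x l)\<^sup>2 - 1 \<partial>G) = 0"
    "integrable G (\<lambda>x. ((x l)\<^sup>2 - 1)\<^sup>2)" "(\<integral>x. ((x l)\<^sup>2 - 1)\<^sup>2 \<partial>G) \<le> 17"
proof -
  have l: "l \<in> {..<d}" using assms by simp
  show "integrable G (\<lambda>x. x l)" "(\<integral>x. x l \<partial>G) = 0"
    "integrable G (\<lambda>x. (x l)\<^sup>2 - 1)" "(\<integral>x. (x l)\<^sup>2 - 1 \<partial>G) = 0"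
    using gaussian_component_integrable[OF l _ integrable_std_normal_hermite(1)]
      gaussian_component_integral[OF l _ integrable_std_normal_hermite(1)]
      gaussian_component_integrable[OF l _ integrable_std_normal_hermite(2)]
      gaussian_component_integral[OF l _ integrable_std_normal_hermite(2)]
    by (simp_all add: G_eq integral_std_normal_hermite)
  note m = distributed_std_normal_moment[OF distributed_gaussian_component[OF l]]
  show 2: "integrable G (\<lambda>x. (x l)\<^sup>2)" "(\<integral>x. (x l)\<^sup>2 \<partial>G) \<le> 2"
    using m[of 1] by (simp_all add: G_eq)
  have 4: "integrable G (\<lambda>x. x l ^ 4)" "(\<integral>x. x l ^ 4 \<partial>G) \<le> 16"
    using m[of 2] by (simp_all add: G_eq)
  have eq: "((x l)\<^sup>2 - 1)\<^sup>2 = x l ^ 4 - 2 * (x l)\<^sup>2 + 1" for x :: "nat \<Rightarrow> real"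
    by (simp add: power2_eq_square power4_eq_xxxx algebra_simps)
  show i: "integrable G (\<lambda>x. ((x l)\<^sup>2 - 1)\<^sup>2)"
    unfolding eq using 2 4 by simp
  have "(\<integral>x. ((x l)\<^sup>2 - 1)\<^sup>2 \<partial>G) \<le> (\<integral>x. x l ^ 4 + 1 \<partial>G)"
    using i 4 by (intro integral_mono) (auto simp: eq)
  also have "\<dots> \<le> 17"
    using 4 by (simp add: G.prob_space)
  finally show "(\<integral>x. ((x l)\<^sup>2 - 1)\<^sup>2 \<partial>G) \<le> 17" .
qed

lemma integrable_f_mult: "integrable G h \<Longrightarrow> integrable G (\<lambda>x. f x * h x)"
  by (rule Bochner_Integration.integrable_bound[of G h])
    (auto simp: abs_mult f_eq)

lemma f_Hermite_1:
  assumes l: "l < d" shows "(\<integral>x. f x * x l \<partial>G) = amp * v l"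
proof -
  have i: "integrable G (\<lambda>x. x l * (if \<tau> \<le> lin x then 1 else 0))"
    by (rule Bochner_Integration.integrable_bound[OF coordinate_moments(1)[OF l]])
      (use l in auto)
  have "(\<integral>x. f x * x l \<partial>G) = (\<integral>x. 2 * (x l * (if \<tau> \<le> lin x then 1 else 0)) - x l \<partial>G)"
    by (intro Bochner_Integration.integral_cong) (auto simp: f_eq)
  also have "\<dots> = 2 * (\<integral>x. x l * (if \<tau> \<le> lin x then 1 else 0) \<partial>G)"
    using i coordinate_moments[OF l] by simp
  also have "\<dots> = amp * v l"
    using gaussian_halfspace_hermite(1)[OF l unit] by (simp add: amp_def G_eq lin_def)
  finally show ?thesis .
qed

lemma f_Hermite_2:
  assumes l: "l < d" shows "(\<integral>x. f x * ((x l)\<^sup>2 - 1) \<partial>G) = amp * \<tau> * (v l)\<^sup>2"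
proof -
  have i: "integrable G (\<lambda>x. ((x l)\<^sup>2 - 1) * (if \<tau> \<le> lin x then 1 else 0))"
    by (rule Bochner_Integration.integrable_bound[OF coordinate_moments(5)[OF l]])
      (use l in auto)
  have "(\<integral>x. f x * ((x l)\<^sup>2 - 1) \<partial>G) = (\<integral>x. 2 * (((x l)\<^sup>2 - 1) * (if \<tau> \<le> lin x then 1 else 0)) - ((x l)\<^sup>2 - 1) \<partial>G)"
    by (intro Bochner_Integration.integral_cong) (auto simp: f_eq)
  also have "\<dots> = 2 * (\<integral>x. ((x l)\<^sup>2 - 1) * (if \<tau> \<le> lin x then 1 else 0) \<partial>G)"
    using Bochner_Integration.integral_diff[OF integrable_mult_right[OF i, of 2] coordinate_moments(5)[OF l]]
      coordinate_moments(6)[OF l] by simp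
  also have "\<dots> = amp * \<tau> * (v l)\<^sup>2"
    using gaussian_halfspace_hermite(2)[OF l unit] by (simp add: amp_def G_eq lin_def)
  finally show ?thesis .
qed

text \<open>Sum of the degree-2 Hermite polynomials of the coordinates. Against \<open>f\<close>
  they contribute \<open>amp * \<tau> * (v l)\<^sup>2\<close> each, and since \<open>v\<close> is a
  unit vector the sum isolates \<open>amp * \<tau>\<close> without knowledge of
  \<open>v\<close>.\<close>

definition excess :: "(nat \<Rightarrow> real) \<Rightarrow> real" where
  "excess x = (\<Sum>l<d. (x l)\<^sup>2) - real d"

lemma excess_eq: "excess x = (\<Sum>l<d. (x l)\<^sup>2 - 1)"
  by (simp add: excess_def sum_subtractf)

lemma measurable_excess [measurable]: "excess \<in> borel_measurable G"
  unfolding excess_def[abs_def] by measurable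

text \<open>Independence of the coordinates keeps the second moment linear in d; 17 is the
  fourth-moment bound 16 plus 1.\<close>

lemma excess_sq: "integrable G (\<lambda>x. (excess x)\<^sup>2)" "(\<integral>x. (excess x)\<^sup>2 \<partial>G) \<le> 17 * real d"
proof -
  let ?h = "\<lambda>(i::nat) (x::real). x\<^sup>2 - 1"
  have i: "integrable std_normal_distribution (\<lambda>x. (x\<^sup>2 - 1)\<^sup>2)"
  proof -
    have eq: "std_normal_density x * ((x\<^sup>2 - 1)\<^sup>2) = std_normal_density x * x ^ 4 - 2 * (std_normal_density x * x\<^sup>2) + std_normal_density x" for x :: real
      by (simp add: power2_eq_square power4_eq_xxxx algebra_simps)
    show ?thesis
      by (subst integrable_std_normal) (auto simp: eq intro!: integrable_std_normal_moment
        Bochner_Integration.integrable_add Bochner_Integration.integrable_diff integrable_mult_right)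
  qed
  have z: "(\<integral>x. x\<^sup>2 - 1 \<partial>std_normal_distribution) = 0"
    by (subst integral_std_normal) (auto simp: integral_std_normal_hermite)
  note S = PiM_sum_square[OF prob_space_std_normal, of "{..<d}" ?h, OF _ _ i z]
  show "integrable G (\<lambda>x. (excess x)\<^sup>2)"
    using S(1) by (simp add: excess_eq G_eq)
  have "(\<integral>x. (x\<^sup>2 - 1)\<^sup>2 \<partial>std_normal_distribution) = (\<integral>x. ((x 0)\<^sup>2 - 1)\<^sup>2 \<partial>G)"
    unfolding G_eq by (rule PiM_component_integral(2)[OF prob_space_std_normal _ i, symmetric]) (use d2 in simp)
  also have "\<dots> \<le> 17"
    by (rule coordinate_moments(8)) (use d2 in simp)
  finally have "real d * (\<integral>x. (x\<^sup>2 - 1)\<^sup>2 \<partial>std_normal_distribution) \<le> real d * 17"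
    by (intro mult_left_mono) auto
  then show "(\<integral>x. (excess x)\<^sup>2 \<partial>G) \<le> 17 * real d"
    using S(2) by (simp add: excess_eq G_eq)
qed

lemma f_excess: "(\<integral>x. f x * excess x \<partial>G) = amp * \<tau>"
proof -
  have "(\<integral>x. f x * excess x \<partial>G) = (\<integral>x. (\<Sum>l<d. f x * ((x l)\<^sup>2 - 1)) \<partial>G)"
    by (simp add: excess_eq sum_distrib_left)
  also have "\<dots> = (\<Sum>l<d. \<integral>x. f x * ((x l)\<^sup>2 - 1) \<partial>G)"
    by (intro Bochner_Integration.integral_sum integrable_f_mult coordinate_moments(5)) auto
  also have "\<dots> = (\<Sum>l<d. amp * \<tau> * (v l)\<^sup>2)"
    by (intro sum.cong refl f_Hermite_2) auto
  also have "\<dots> = amp * \<tau>"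
    using unit by (simp flip: sum_distrib_left)
  finally show ?thesis .
qed

definition chow_error :: "nat \<Rightarrow> (nat \<Rightarrow> nat \<Rightarrow> real) \<Rightarrow> real" where
  "chow_error n x = (\<Sum>l<d. ((\<Sum>i<n. f (x i) * x i l) - real n * (amp * v l))\<^sup>2) +
    ((\<Sum>i<n. f (x i) * excess (x i)) - real n * (amp * \<tau>))\<^sup>2"

text \<open>Markov's inequality for the total squared error, to whose mean the d coordinates
  contribute at most \<open>2 * n\<close> each and the offset at most
  \<open>17 * n * d\<close>.\<close>

lemma chow_error_bound:
  assumes n: "0 < n"
  shows "chow_error n \<in> borel_measurable (PiM {..<n} (\<lambda>_. G))"
    and "measure (PiM {..<n} (\<lambda>_. G)) {x \<in> space (PiM {..<n} (\<lambda>_. G)). 18000 * real n * (real d)\<^sup>2 < chow_error n x} \<le> 1 / 1000"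
proof -
  let ?P = "PiM {..<n} (\<lambda>_. G)"
  interpret P: prob_space ?P by (intro prob_space_PiM G.prob_space_axioms)
  have sq: "(f x * y)\<^sup>2 = y\<^sup>2" for x y
    by (simp add: power_mult_distrib f_sq)
  have 1: "integrable ?P (\<lambda>x. ((\<Sum>i<n. f (x i) * x i l) - real n * (amp * v l))\<^sup>2)"
    "(\<integral>x. ((\<Sum>i<n. f (x i) * x i l) - real n * (amp * v l))\<^sup>2 \<partial>?P) \<le> real n * 2" if l: "l < d" for l
  proof -
    have [measurable]: "(\<lambda>x. f x * x l) \<in> borel_measurable G" using l by measurable
    note D = PiM_deviation_square[OF G.prob_space_axioms, of "{..<n}" "\<lambda>x. f x * x l", unfolded sq f_Hermite_1[OF l]]
    show "integrable ?P (\<lambda>x. ((\<Sum>i<n. f (x i) * x i l) - real n * (amp * v l))\<^sup>2)"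
      using D(1) coordinate_moments(3)[OF l] by simp
    have "(\<integral>x. ((\<Sum>i<n. f (x i) * x i l) - real n * (amp * v l))\<^sup>2 \<partial>?P) \<le> real n * (\<integral>x. (x l)\<^sup>2 \<partial>G)"
      using D(2) coordinate_moments(3)[OF l] by simp
    also have "\<dots> \<le> real n * 2"
      using coordinate_moments(4)[OF l] by (intro mult_left_mono) auto
    finally show "(\<integral>x. ((\<Sum>i<n. f (x i) * x i l) - real n * (amp * v l))\<^sup>2 \<partial>?P) \<le> real n * 2" .
  qed
  note D = PiM_deviation_square[OF G.prob_space_axioms, of "{..<n}" "\<lambda>x. f x * excess x", unfolded sq f_excess]
  have 2: "integrable ?P (\<lambda>x. ((\<Sum>i<n. f (x i) * excess (x i)) - real n * (amp * \<tau>))\<^sup>2)"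
    using D(1) excess_sq(1) by simp
  have "(\<integral>x. ((\<Sum>i<n. f (x i) * excess (x i)) - real n * (amp * \<tau>))\<^sup>2 \<partial>?P) \<le> real n * (\<integral>x. (excess x)\<^sup>2 \<partial>G)"
    using D(2) excess_sq(1) by simp
  also have "\<dots> \<le> real n * (17 * real d)"
    using excess_sq(2) by (intro mult_left_mono) auto
  finally have 3: "(\<integral>x. ((\<Sum>i<n. f (x i) * excess (x i)) - real n * (amp * \<tau>))\<^sup>2 \<partial>?P) \<le> real n * (17 * real d)" .
  have s: "integrable ?P (\<lambda>x. \<Sum>l<d. ((\<Sum>i<n. f (x i) * x i l) - real n * (amp * v l))\<^sup>2)"
    using 1(1) by (intro Bochner_Integration.integrable_sum) auto
  have i: "integrable ?P (chow_error n)"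
    unfolding chow_error_def[abs_def] using s 2 by (rule Bochner_Integration.integrable_add)
  then show "chow_error n \<in> borel_measurable ?P"
    by simp
  have "integral\<^sup>L ?P (chow_error n) = (\<Sum>l<d. (\<integral>x. ((\<Sum>i<n. f (x i) * x i l) - real n * (amp * v l))\<^sup>2 \<partial>?P)) +
      (\<integral>x. ((\<Sum>i<n. f (x i) * excess (x i)) - real n * (amp * \<tau>))\<^sup>2 \<partial>?P)"
    unfolding chow_error_def[abs_def] using s 2 1(1) by (simp add: Bochner_Integration.integral_sum)
  also have "\<dots> \<le> (\<Sum>l<d. real n * 2) + real n * (17 * real d)"
    using 1(2) 3 by (intro add_mono sum_mono) auto
  also have "\<dots> = real n * real d * 19"
    by (simp add: algebra_simps)
  \<comment> \<open>Since \<open>d \<ge> 2\<close>, the factor 19 is below 18 d; the constant 18000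
    is 18 times the inverse of the failure probability.\<close>
  also have "\<dots> \<le> real n * real d * (18 * real d)"
    using d2 by (intro mult_left_mono) auto
  finally have "integral\<^sup>L ?P (chow_error n) \<le> 18 * real n * (real d)\<^sup>2"
    by (simp add: power2_eq_square mult_ac)
  moreover have "measure ?P {x \<in> space ?P. 18000 * real n * (real d)\<^sup>2 < chow_error n x} \<le> integral\<^sup>L ?P (chow_error n) / (18000 * real n * (real d)\<^sup>2)"
    by (rule prob_gt_Markov[OF P.prob_space_axioms i]) (use n d2 in \<open>auto simp: chow_error_def intro!: add_nonneg_nonneg sum_nonneg\<close>)
  ultimately have "measure ?P {x \<in> space ?P. 18000 * real n * (real d)\<^sup>2 < chow_error n x} \<le> 18 * real n * (real d)\<^sup>2 / (18000 * real n * (real d)\<^sup>2)"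
    by (meson divide_right_mono order_trans mult_nonneg_nonneg of_nat_0_le_iff zero_le_numeral zero_le_power2)
  also have "\<dots> = 1 / 1000"
    using n d2 by (simp add: field_simps)
  finally show "measure ?P {x \<in> space ?P. 18000 * real n * (real d)\<^sup>2 < chow_error n x} \<le> 1 / 1000" .
qed

section \<open>Tails and anticoncentration of the projection \<open>lin\<close>\<close>

lemma lin_interval:
  "a \<le> b \<Longrightarrow> measure G {x \<in> space G. a \<le> lin x \<and> lin x \<le> b} \<le> (b - a) / 2"
  using distributed_std_normal_interval(1)[OF G.prob_space_axioms distributed_lin, of a b "1 / 2"]
    std_normal_density_le_half by simp

text \<open>Markov's inequality with the degree \<open>j\<close> left free: choosing it proportional
  to \<open>t\<close> makes the bound exponentially small.\<close>

lemma lin_moment_tail: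
  assumes "0 < t"
  shows "measure G {x \<in> space G. t \<le> (lin x)\<^sup>2} \<le> (2 * real j / t) ^ j"
proof -
  note m = distributed_std_normal_moment[OF distributed_lin, of j]
  have "measure G {x \<in> space G. t \<le> (lin x)\<^sup>2} \<le> measure G {x \<in> space G. t ^ j \<le> lin x ^ (2 * j)}"
    using assms by (intro G.finite_measure_mono) (auto simp: power_mult intro!: power_mono)
  also have "\<dots> \<le> (\<integral>x. lin x ^ (2 * j) \<partial>G) / t ^ j"
    by (rule integral_Markov_inequality_measure[OF m(1) sets.empty_sets]) (use assms in auto)
  also have "\<dots> \<le> (2 * real j) ^ j / t ^ j"
    using m(2) assms by (intro divide_right_mono) auto
  finally show ?thesis
    by (simp add: power_divide)
qed

text \<open>On these intervals the squared argument is at most 8k + 2, so the density is at least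
  exp(-4k - 1) / 3. As exp 4 \<le> 81 is far below 16384, the rate is exceeded already for k =
  1.\<close>

lemma balanced_prob_gt:
  assumes t: "0 \<le> t" "t\<^sup>2 \<le> 4 * real k" and k: "1 \<le> k"
  shows "2 * (1 / 16384) ^ k < measure G {x \<in> space G. t + 1 / 2 \<le> lin x \<and> lin x \<le> t + 1}"
    and "2 * (1 / 16384) ^ k < measure G {x \<in> space G. - (t + 1) \<le> lin x \<and> lin x \<le> - (t + 1 / 2)}"
proof -
  define c where "c = exp (- (4 * real k + 1)) / 3"
  have den: "c \<le> std_normal_density x" if "\<bar>x\<bar> \<le> t + 1" for x
  proof -
    have "x\<^sup>2 \<le> (t + 1)\<^sup>2"
      using that by (metis abs_ge_zero power2_abs power_mono)
    also have "\<dots> \<le> 2 * t\<^sup>2 + 2"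
      using sum_squares_bound[of t 1] by (simp add: power2_eq_square algebra_simps)
    finally have "x\<^sup>2 / 2 \<le> 4 * real k + 1"
      using t by simp
    then have "c \<le> exp (- x\<^sup>2 / 2) / 3"
      unfolding c_def by simp
    then show ?thesis
      using std_normal_density_ge[of x] by linarith
  qed
  have "exp 1 \<le> (3::real)" using exp_le by simp
  have "exp (4::real) = exp 1 ^ 4"
    by (simp flip: exp_of_nat_mult)
  also have "\<dots> \<le> 3 ^ 4"
    using \<open>exp 1 \<le> 3\<close> by (intro power_mono) auto
  finally have e4: "exp (4::real) \<le> 81" by simp
  \<comment> \<open>The 18 collects 1/3 for exp(-1), 1/3 from the density bound and 1/2 for the
    length of the interval.\<close>
  have "2 < (16384 / 81) / 18 * (1::real)" by simp
  also have "\<dots> \<le> (16384 / 81) ^ k / 18"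
  proof -
    have "(16384 / 81) ^ 1 \<le> (16384 / 81 :: real) ^ k"
      using k by (intro power_increasing) auto
    then show ?thesis by simp
  qed
  also have "\<dots> \<le> (16384 / exp 4) ^ k / 18"
    using e4 by (intro divide_right_mono power_mono divide_left_mono) auto
  also have "\<dots> = 16384 ^ k * exp (- (4 * real k)) * (1 / 3) / 3 * (1 / 2)"
    by (simp add: power_divide exp_minus exp_of_nat_mult field_simps flip: exp_of_nat_mult)
  also have "\<dots> \<le> 16384 ^ k * exp (- (4 * real k)) * exp (- 1) / 3 * (1 / 2)"
    using \<open>exp 1 \<le> 3\<close> by (intro mult_right_mono divide_right_mono mult_left_mono) (auto simp: exp_minus field_simps)
  also have "\<dots> = 16384 ^ k * (c * (1 / 2))"
    by (simp add: c_def flip: exp_add)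
  finally have "2 * (1 / 16384) ^ k < c * (1 / 2)"
    by (simp add: power_divide field_simps)
  moreover have "c * (1 / 2) \<le> measure G {x \<in> space G. t + 1 / 2 \<le> lin x \<and> lin x \<le> t + 1}"
    using distributed_std_normal_interval(2)[OF G.prob_space_axioms distributed_lin, of "t + 1 / 2" "t + 1" c] den t
    by auto
  moreover have "c * (1 / 2) \<le> measure G {x \<in> space G. - (t + 1) \<le> lin x \<and> lin x \<le> - (t + 1 / 2)}"
    using distributed_std_normal_interval(2)[OF G.prob_space_axioms distributed_lin, of "- (t + 1)" "- (t + 1 / 2)" c] den t
    by auto
  ultimately show "2 * (1 / 16384) ^ k < measure G {x \<in> space G. t + 1 / 2 \<le> lin x \<and> lin x \<le> t + 1}"
    and "2 * (1 / 16384) ^ k < measure G {x \<in> space G. - (t + 1) \<le> lin x \<and> lin x \<le> - (t + 1 / 2)}"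
    by linarith+
qed

lemma sets_f [measurable]: "{x \<in> space G. f x = b} \<in> sets G" "{x \<in> space G. f x \<noteq> b} \<in> sets G"
  by measurable

text \<open>A point with the rare label and a small projection would force a whole interval of
  \<open>balanced_prob_gt\<close> into the region of that label, namely the interval beyond
  \<open>\<bar>lin x\<bar>\<close> on the side away from the threshold; the region would then be too
  heavy.\<close>

lemma rare_label_threshold:
  assumes k: "1 \<le> k" and rare: "measure G {x \<in> space G. f x \<noteq> b} \<le> 2 * (1 / 16384) ^ k" and b: "b \<in> {-1, 1}"
    and fx: "f x \<noteq> b"
  shows "4 * real k \<le> (lin x)\<^sup>2"
proof (rule ccontr)
  assume "\<not> 4 * real k \<le> (lin x)\<^sup>2"
  then have t: "0 \<le> \<bar>lin x\<bar>" "\<bar>lin x\<bar>\<^sup>2 \<le> 4 * real k" by auto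
  show False
  proof (cases "b = 1")
    case True
    then have "lin x < \<tau>" using fx by (auto simp: f_eq split: if_splits)
    then have "measure G {y \<in> space G. - (\<bar>lin x\<bar> + 1) \<le> lin y \<and> lin y \<le> - (\<bar>lin x\<bar> + 1 / 2)} \<le> measure G {y \<in> space G. f y \<noteq> b}"
      using True by (intro G.finite_measure_mono) (auto simp: f_eq)
    then show False using balanced_prob_gt(2)[OF t k] rare by linarith
  next
    case False
    then have "\<tau> \<le> lin x" "b = -1" using fx b by (auto simp: f_eq split: if_splits)
    then have "measure G {y \<in> space G. \<bar>lin x\<bar> + 1 / 2 \<le> lin y \<and> lin y \<le> \<bar>lin x\<bar> + 1} \<le> measure G {y \<in> space G. f y \<noteq> b}"
      by (intro G.finite_measure_mono) (auto simp: f_eq)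
    then show False using balanced_prob_gt(1)[OF t k] rare by linarith
  qed
qed

lemma large_threshold_rare_label:
  assumes k: "20 \<le> k" and \<tau>: "64 * real k < \<tau>\<^sup>2"
  shows "measure G {x \<in> space G. f x \<noteq> (if 0 < \<tau> then -1 else 1)} \<le> (1 / 16384) ^ k / 1000"
proof -
  have "measure G {x \<in> space G. f x \<noteq> (if 0 < \<tau> then -1 else 1)} \<le> measure G {x \<in> space G. 64 * real k \<le> (lin x)\<^sup>2}"
  proof (rule G.finite_measure_mono)
    show "{x \<in> space G. f x \<noteq> (if 0 < \<tau> then -1 else 1)} \<subseteq> {x \<in> space G. 64 * real k \<le> (lin x)\<^sup>2}"
    proof safe
      fix x assume "f x \<noteq> (if 0 < \<tau> then -1 else 1)"
      then have "\<bar>\<tau>\<bar> \<le> \<bar>lin x\<bar>"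
        by (auto simp: f_eq split: if_splits)
      then have "\<tau>\<^sup>2 \<le> (lin x)\<^sup>2"
        by (simp add: abs_le_square_iff)
      then show "64 * real k \<le> (lin x)\<^sup>2"
        using \<tau> by simp
    qed
  qed measurable
  \<comment> \<open>With \<open>j = 16 * k\<close> the base is 32k / 64k = 1/2, so the bound is
    2^(-16k).\<close>
  also have "\<dots> \<le> (2 * real (16 * k) / (64 * real k)) ^ (16 * k)"
    by (rule lin_moment_tail) (use k in simp)
  also have "\<dots> = (1 / 65536) ^ k"
    using k by (simp add: power_mult power_divide)
  \<comment> \<open>65536 is 4 times 16384: the spare power of 1/4 is below 1/1000 because
    \<open>20 \<le> k\<close>, and later pays for the failure probability.\<close>
  also have "\<dots> = (1 / 16384) ^ k * (1 / 4) ^ k"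
    by (simp flip: power_mult_distrib)
  also have "\<dots> \<le> (1 / 16384) ^ k * (1 / 1000)"
  proof (intro mult_left_mono)
    have "(1 / 4) ^ k \<le> (1 / 4 :: real) ^ 20"
      using k by (intro power_decreasing) auto
    also have "\<dots> \<le> 1 / 1000" by (simp add: power_divide)
    finally show "(1 / 4) ^ k \<le> (1 / 1000 :: real)" .
  qed simp
  finally show ?thesis by simp
qed

lemma amp_ge:
  assumes "\<tau>\<^sup>2 \<le> 64 * real k" shows "2 * (exp (- 32 * real k) / 3) \<le> amp"
proof -
  have "exp (- 32 * real k) / 3 \<le> exp (- \<tau>\<^sup>2 / 2) / 3"
    using assms by simp
  also have "\<dots> \<le> std_normal_density \<tau>" by (rule std_normal_density_ge)
  finally show ?thesis by (simp add: amp_def)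
qed

end

section \<open>The moment discrepancy as a squared tensor distance\<close>

text \<open>Entry \<open>g\<close> of the m-fold tensor power of \<open>x\<close>. Indexing by all
  tuples rather than by monomials makes the inner product of two tensor powers exactly the power of
  the inner product, without multinomial coefficients.\<close>

definition tensor :: "nat \<Rightarrow> (nat \<Rightarrow> real) \<Rightarrow> (nat \<Rightarrow> nat) \<Rightarrow> real" where
  "tensor m x g = (\<Prod>t<m. x (g t))"

abbreviation multi :: "nat \<Rightarrow> nat \<Rightarrow> (nat \<Rightarrow> nat) set" where
  "multi d m \<equiv> PiE {..<m} (\<lambda>_. {..<d})"

lemma finite_multi: "finite (multi d m)"
  by (intro finite_PiE) auto

lemma tensor_inner: "(\<Sum>l<d. x l * y l) ^ m = (\<Sum>g\<in>multi d m. tensor m x g * tensor m y g)"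
proof -
  have "(\<Sum>l<d. x l * y l) ^ m = (\<Prod>t<m. \<Sum>l<d. x l * y l)"
    by simp
  also have "\<dots> = (\<Sum>g\<in>multi d m. \<Prod>t<m. x (g t) * y (g t))"
    by (rule prod_sum_PiE) auto
  finally show ?thesis
    by (simp add: tensor_def prod.distrib)
qed

lemma tensor_norm: "(\<Sum>g\<in>multi d m. (tensor m x g)\<^sup>2) = (\<Sum>l<d. (x l)\<^sup>2) ^ m"
  using tensor_inner[of x x d m] by (simp add: power2_eq_square)

definition mmd_tensor :: "nat \<Rightarrow> nat \<Rightarrow> nat \<Rightarrow> (nat \<Rightarrow> nat \<Rightarrow> real) \<Rightarrow> (nat \<Rightarrow> nat \<Rightarrow> real) \<Rightarrow> real" where
  "mmd_tensor d m n x z = (\<Sum>g\<in>multi d m. ((\<Sum>j<n. tensor m (z j) g) - (\<Sum>j<n. tensor m (x j) g))\<^sup>2)"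

text \<open>The kernel trick: \<open>tensor\<close> is the feature map of the polynomial kernel, so
  the double sum expands a squared distance in dimension d^(2k) between vectors that the learner
  never forms.\<close>

lemma mmd_eq:
  assumes "0 < k"
  shows "mmd d k n x z * (2 * real k) ^ (2 * k) = mmd_tensor d (2 * k) n x z"
proof -
  let ?m = "2 * k" and ?T = "tensor (2 * k)"
  define Z where "Z g = (\<Sum>j<n. ?T (z j) g)" for g
  define X where "X g = (\<Sum>j<n. ?T (x j) g)" for g
  have K: "kernel d k u w * (2 * real k) ^ ?m = (\<Sum>g\<in>multi d ?m. ?T u g * ?T w g)" for u w
    using assms by (simp add: kernel_def power_divide flip: tensor_inner)
  have swap: "(\<Sum>i<n. \<Sum>j<n. \<Sum>g\<in>multi d ?m. ?T (a i) g * ?T (b j) g) =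
      (\<Sum>g\<in>multi d ?m. (\<Sum>i<n. ?T (a i) g) * (\<Sum>j<n. ?T (b j) g))" for a b
  proof -
    have "(\<Sum>i<n. \<Sum>j<n. \<Sum>g\<in>multi d ?m. ?T (a i) g * ?T (b j) g) =
       (\<Sum>i<n. \<Sum>g\<in>multi d ?m. \<Sum>j<n. ?T (a i) g * ?T (b j) g)"
      by (intro sum.cong refl sum.swap)
    also have "\<dots> = (\<Sum>g\<in>multi d ?m. \<Sum>i<n. \<Sum>j<n. ?T (a i) g * ?T (b j) g)"
      by (rule sum.swap)
    finally show ?thesis by (simp add: sum_product)
  qed
  have "mmd d k n x z * (2 * real k) ^ ?m = (\<Sum>i<n. \<Sum>j<n.
      kernel d k (z i) (z j) * (2 * real k) ^ ?m - 2 * (kernel d k (z i) (x j) * (2 * real k) ^ ?m) + kernel d k (x i) (x j) * (2 * real k) ^ ?m)"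
    unfolding mmd_def sum_distrib_right by (intro sum.cong refl) (simp only: left_diff_distrib distrib_right mult.assoc)
  also have "\<dots> = (\<Sum>g\<in>multi d ?m. Z g * Z g) - 2 * (\<Sum>g\<in>multi d ?m. Z g * X g) + (\<Sum>g\<in>multi d ?m. X g * X g)"
    unfolding K by (simp only: sum.distrib sum_subtractf sum_distrib_left[symmetric] swap Z_def X_def)
  also have "\<dots> = (\<Sum>g\<in>multi d ?m. Z g * Z g - 2 * (Z g * X g) + X g * X g)"
    by (simp add: sum.distrib sum_subtractf sum_distrib_left)
  also have "\<dots> = (\<Sum>g\<in>multi d ?m. (Z g - X g)\<^sup>2)"
    by (intro sum.cong refl) (simp add: power2_eq_square algebra_simps)
  finally show ?thesis
    by (simp add: mmd_tensor_def Z_def X_def)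
qed

text \<open>A directional moment is the inner product of the moment tensor with the tensor power of
  \<open>v\<close>, which has norm 1. By Cauchy-Schwarz the discrepancy controls all directions at
  once, hence also the unknown normal vector.\<close>

lemma moment_transfer:
  assumes unit: "(\<Sum>i<d. (v i)\<^sup>2) = 1" and k: "0 < k" and mmd: "mmd d k n x z \<le> (real n)\<^sup>2"
  shows "(\<Sum>j<n. (\<Sum>i<d. v i * z j i) ^ (2 * k)) \<le> (\<Sum>j<n. (\<Sum>i<d. v i * x j i) ^ (2 * k)) + real n * (2 * real k) ^ k"
proof -
  let ?m = "2 * k" and ?T = "tensor (2 * k)"
  define D where "D g = (\<Sum>j<n. ?T (z j) g) - (\<Sum>j<n. ?T (x j) g)" for g
  have swap: "(\<Sum>j<n. (\<Sum>i<d. v i * y j i) ^ ?m) = (\<Sum>g\<in>multi d ?m. ?T v g * (\<Sum>j<n. ?T (y j) g))" for y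
    unfolding tensor_inner sum_distrib_left by (rule sum.swap)
  have "(\<Sum>j<n. (\<Sum>i<d. v i * z j i) ^ ?m) - (\<Sum>j<n. (\<Sum>i<d. v i * x j i) ^ ?m) = (\<Sum>g\<in>multi d ?m. ?T v g * D g)"
    unfolding swap D_def by (simp add: sum_subtractf right_diff_distrib)
  moreover have "(\<Sum>g\<in>multi d ?m. ?T v g * D g)\<^sup>2 \<le> (real n * (2 * real k) ^ k)\<^sup>2"
  proof -
    have "(\<Sum>g\<in>multi d ?m. ?T v g * D g)\<^sup>2 \<le> (\<Sum>g\<in>multi d ?m. (?T v g)\<^sup>2) * (\<Sum>g\<in>multi d ?m. (D g)\<^sup>2)"
      by (rule Cauchy_Schwarz_ineq_sum)
    also have "\<dots> = mmd d k n x z * (2 * real k) ^ ?m"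
      unfolding mmd_eq[OF k] by (simp add: mmd_tensor_def D_def tensor_norm unit)
    also have "\<dots> \<le> (real n)\<^sup>2 * (2 * real k) ^ ?m"
      using mmd by (intro mult_right_mono) auto
    also have "\<dots> = (real n * (2 * real k) ^ k)\<^sup>2"
      by (simp add: power_mult_distrib mult.commute flip: power_mult)
    finally show ?thesis .
  qed
  ultimately have "((\<Sum>j<n. (\<Sum>i<d. v i * z j i) ^ ?m) - (\<Sum>j<n. (\<Sum>i<d. v i * x j i) ^ ?m))\<^sup>2 \<le> (real n * (2 * real k) ^ k)\<^sup>2"
    by simp
  then have "(\<Sum>j<n. (\<Sum>i<d. v i * z j i) ^ ?m) - (\<Sum>j<n. (\<Sum>i<d. v i * x j i) ^ ?m) \<le> real n * (2 * real k) ^ k"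
    by (rule power2_le_imp_le) simp
  then show ?thesis by simp
qed

section \<open>Training and test events for small accuracy parameters\<close>

lemma deg_ge_20:
  assumes "0 < \<epsilon>" "\<epsilon> < 1" shows "20 \<le> deg \<epsilon>"
proof (rule ccontr)
  assume "\<not> 20 \<le> deg \<epsilon>"
  then have "(2::real) ^ deg \<epsilon> \<le> 2 ^ 19"
    by (intro power_increasing) auto
  then have "\<epsilon> * 2 ^ deg \<epsilon> \<le> 1 * 2 ^ 19"
    using assms by (intro mult_mono) auto
  then show False using deg_ge[OF assms(1)] by simp
qed

text \<open>The most expensive demand on the exponent is 131k + 3, in \<open>flagged_near\<close>;
  150 covers it since k is at least 20.\<close>

locale halfspace_learning = halfspace +
  fixes \<epsilon> :: real and n :: nat
  assumes \<epsilon>: "0 < \<epsilon>" "\<epsilon> < 3 / 4" and n_ge: "d ^ (150 * deg \<epsilon>) \<le> n"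
begin

abbreviation k :: nat where "k \<equiv> deg \<epsilon>"

abbreviation P :: "(nat \<Rightarrow> nat \<Rightarrow> real) measure" where
  "P \<equiv> PiM {..<n} (\<lambda>_. G)"

sublocale P: prob_space P
  by (intro prob_space_PiM G.prob_space_axioms)

lemma k_ge: "20 \<le> k"
  by (rule deg_ge_20) (use \<epsilon> in auto)

text \<open>All powers of 2 and of d that the analysis spends are paid from this one bound, powers
  of 2 being at most powers of d.\<close>

lemma two_pow_le_n:
  assumes "a + b \<le> 150 * k" shows "2 ^ a * real d ^ b \<le> real n"
proof -
  have "2 ^ a * real d ^ b \<le> real d ^ a * real d ^ b"
    using d2 by (intro mult_right_mono power_mono) auto
  also have "\<dots> = real d ^ (a + b)"
    by (simp add: power_add)
  also have "\<dots> \<le> real d ^ (150 * k)"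
    using assms d2 by (intro power_increasing) auto
  also have "\<dots> = real (d ^ (150 * k))" by simp
  also have "\<dots> \<le> real n"
    using n_ge by (simp only: of_nat_le_iff)
  finally show ?thesis .
qed

lemma n_pos: "0 < n"
  using two_pow_le_n[of 0 0] by simp

lemma \<epsilon>_scale: "1000000 \<le> \<epsilon> * 2 ^ k"
  by (rule deg_ge) (rule \<epsilon>)

lemma eps_n: "4 / (\<epsilon> * real n) \<le> 1 / 1000"
proof -
  have "4000 * 1 \<le> \<epsilon> * 2 ^ k * 1"
    using \<epsilon>_scale by simp
  also have "\<dots> \<le> \<epsilon> * real n"
    using two_pow_le_n[of k 0] \<epsilon> by simp
  finally show ?thesis
    using \<epsilon> n_pos by (simp add: field_simps)
qed

text \<open>Since 16384 is 2^14, the rate consumes 14k of the exponent.\<close>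

lemma rate_n: "4 / (2 * (1 / 16384) ^ k * real n) \<le> 1 / 1000"
proof -
  have "2 ^ (14 * k) = (16384 :: real) ^ k"
    by (simp add: power_mult)
  moreover have "2 ^ (14 * k + 11) \<le> real n"
    using two_pow_le_n[of "14 * k + 11" 0] k_ge by simp
  ultimately have "2048 * 16384 ^ k \<le> real n"
    by (simp add: power_add)
  moreover have "2000 * (16384 :: real) ^ k \<le> 2048 * 16384 ^ k"
    by simp
  ultimately have "2000 * 16384 ^ k \<le> real n"
    by linarith
  then show ?thesis
    using n_pos by (simp add: power_divide field_simps)
qed

lemma train_moment_bound:
  "(\<lambda>x. \<Sum>i<n. lin (x i) ^ (2 * k)) \<in> borel_measurable P"
  "measure P {x \<in> space P. 1000 * real n * (2 * real k) ^ k < (\<Sum>i<n. lin (x i) ^ (2 * k))} \<le> 1 / 1000"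
proof -
  note m = distributed_std_normal_moment[OF distributed_lin, of k]
  note c = PiM_component_integral[where I = "{..<n}", OF G.prob_space_axioms _ m(1)]
  have i: "integrable P (\<lambda>x. \<Sum>i<n. lin (x i) ^ (2 * k))"
    using c(1) by (intro Bochner_Integration.integrable_sum) auto
  then show "(\<lambda>x. \<Sum>i<n. lin (x i) ^ (2 * k)) \<in> borel_measurable P"
    by simp
  have "(\<integral>x. (\<Sum>i<n. lin (x i) ^ (2 * k)) \<partial>P) = (\<Sum>i<n. \<integral>x. lin (x i) ^ (2 * k) \<partial>P)"
    using c(1) by (intro Bochner_Integration.integral_sum) auto
  also have "\<dots> = (\<Sum>i<n. \<integral>x. lin x ^ (2 * k) \<partial>G)"
    by (intro sum.cong refl c(2)) auto
  also have "\<dots> \<le> real n * (2 * real k) ^ k"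
    using m(2) by (simp add: mult_left_mono)
  finally have "(\<integral>x. (\<Sum>i<n. lin (x i) ^ (2 * k)) \<partial>P) \<le> real n * (2 * real k) ^ k" .
  moreover have pos: "0 < real n * (2 * real k) ^ k"
    using n_pos k_ge by simp
  moreover have "measure P {x \<in> space P. 1000 * real n * (2 * real k) ^ k < (\<Sum>i<n. lin (x i) ^ (2 * k))} \<le>
      (\<integral>x. (\<Sum>i<n. lin (x i) ^ (2 * k)) \<partial>P) / (1000 * real n * (2 * real k) ^ k)"
  proof (rule prob_gt_Markov[OF P.prob_space_axioms i])
    show "0 \<le> (\<Sum>i<n. lin (x i) ^ (2 * k))" for x
      by (rule sum_nonneg) simp
    show "0 < 1000 * real n * (2 * real k) ^ k"
      using n_pos k_ge by simp
  qed
  ultimately have "measure P {x \<in> space P. 1000 * real n * (2 * real k) ^ k < (\<Sum>i<n. lin (x i) ^ (2 * k))} \<le>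
      real n * (2 * real k) ^ k / (1000 * real n * (2 * real k) ^ k)"
    using pos by (meson divide_right_mono less_imp_le mult_nonneg_nonneg of_nat_0_le_iff order_trans zero_le_numeral zero_le_power)
  also have "\<dots> = 1 / 1000"
    using n_pos k_ge by simp
  finally show "measure P {x \<in> space P. 1000 * real n * (2 * real k) ^ k < (\<Sum>i<n. lin (x i) ^ (2 * k))} \<le> 1 / 1000" .
qed

definition tensor_error :: "(nat \<Rightarrow> nat \<Rightarrow> real) \<Rightarrow> real" where
  "tensor_error x = (\<Sum>g\<in>multi d (2 * k). ((\<Sum>i<n. tensor (2 * k) (x i) g) - real n * (\<integral>y. tensor (2 * k) y g \<partial>G))\<^sup>2)"

lemma measurable_tensor: "g \<in> multi d m \<Longrightarrow> (\<lambda>x. tensor m x g) \<in> borel_measurable G"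
  unfolding tensor_def by (intro borel_measurable_prod measurable_coordinate) auto

lemma integrable_tensor_sq:
  assumes g: "g \<in> multi d m"
  shows "integrable G (\<lambda>x. (tensor m x g)\<^sup>2)"
proof (rule Bochner_Integration.integrable_bound)
  show "integrable G (\<lambda>x. (\<Sum>l<d. (x l)\<^sup>2) ^ m)"
    using gaussian_norm_moment(1)[of d m] d2 by (simp add: G_eq)
  show "(\<lambda>x. (tensor m x g)\<^sup>2) \<in> borel_measurable G"
    using measurable_tensor[OF g] by measurable
  have "(tensor m x g)\<^sup>2 \<le> (\<Sum>l<d. (x l)\<^sup>2) ^ m" for x
    unfolding tensor_norm[symmetric] by (rule member_le_sum[OF g]) (auto simp: finite_multi)
  then show "AE x in G. norm ((tensor m x g)\<^sup>2) \<le> norm ((\<Sum>l<d. (x l)\<^sup>2) ^ m)"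
    by (intro AE_I2) (metis abs_ge_self abs_power2 order_trans real_norm_def)
qed

text \<open>Summed over all entries, the second moments form a moment of the Gaussian norm, so the
  mean error is at most n d^(2k+1) (4k)^(2k). Relative to the threshold this is 4 * 4^k d^(2k+1) /
  n, which the sample size makes small.\<close>

lemma tensor_error_bound:
  "tensor_error \<in> borel_measurable P"
  "measure P {x \<in> space P. (real n)\<^sup>2 * (2 * real k) ^ (2 * k) / 4 < tensor_error x} \<le> 1 / 1000"
proof -
  let ?m = "2 * k"
  note D = PiM_deviation_square[OF G.prob_space_axioms _ measurable_tensor integrable_tensor_sq, of "{..<n}"]
  have i: "integrable P tensor_error"
    unfolding tensor_error_def[abs_def] using D(1) by (intro Bochner_Integration.integrable_sum) simp
  then show "tensor_error \<in> borel_measurable P" by simp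
  have "integral\<^sup>L P tensor_error = (\<Sum>g\<in>multi d ?m. \<integral>x. ((\<Sum>i<n. tensor ?m (x i) g) - real n * (\<integral>y. tensor ?m y g \<partial>G))\<^sup>2 \<partial>P)"
    unfolding tensor_error_def[abs_def] using D(1) by (intro Bochner_Integration.integral_sum) simp
  also have "\<dots> \<le> (\<Sum>g\<in>multi d ?m. real n * (\<integral>x. (tensor ?m x g)\<^sup>2 \<partial>G))"
    using D(2) by (intro sum_mono) simp
  also have "\<dots> = real n * (\<integral>x. (\<Sum>g\<in>multi d ?m. (tensor ?m x g)\<^sup>2) \<partial>G)"
    by (simp add: sum_distrib_left[symmetric] Bochner_Integration.integral_sum integrable_tensor_sq)
  also have "\<dots> \<le> real n * (real d ^ (?m + 1) * (2 * real ?m) ^ ?m)"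
    unfolding tensor_norm using gaussian_norm_moment(2)[of d ?m] d2 by (intro mult_left_mono) (auto simp: G_eq)
  finally have le: "integral\<^sup>L P tensor_error \<le> real n * (real d ^ (?m + 1) * (2 * real ?m) ^ ?m)" .
  define B where "B = (2 * real k) ^ ?m"
  have B: "0 < B" using k_ge by (simp add: B_def)
  have "(2 * real ?m) ^ ?m = (2 * (2 * real k)) ^ ?m" by simp
  also have "\<dots> = 2 ^ ?m * B" by (simp only: power_mult_distrib B_def)
  also have "2 ^ ?m = (4::real) ^ k" by (simp add: power_mult)
  finally have eq: "(2 * real ?m) ^ ?m = 4 ^ k * B" .
  have "measure P {x \<in> space P. (real n)\<^sup>2 * B / 4 < tensor_error x} \<le> integral\<^sup>L P tensor_error / ((real n)\<^sup>2 * B / 4)"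
  proof (rule prob_gt_Markov[OF P.prob_space_axioms i])
    show "0 \<le> tensor_error x" for x
      unfolding tensor_error_def by (rule sum_nonneg) simp
    show "0 < (real n)\<^sup>2 * B / 4"
      using B n_pos by simp
  qed
  also have "\<dots> \<le> real n * (real d ^ (?m + 1) * (4 ^ k * B)) / ((real n)\<^sup>2 * B / 4)"
    using le B unfolding eq by (intro divide_right_mono) auto
  also have "\<dots> = 4 * 4 ^ k * real d ^ (?m + 1) / real n"
  proof -
    have frac: "a * (D * (c * b)) / (a\<^sup>2 * b / 4) = 4 * c * D / a" if "0 < a" "0 < b" for a b c D :: real
      using that by (simp add: power2_eq_square divide_simps)
    show ?thesis
      by (rule frac) (use B n_pos in auto)
  qed
  also have "\<dots> \<le> 1 / 1000"
  proof -
    have e: "(2::real) ^ (12 + 2 * k) = 4096 * 4 ^ k"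
      by (simp add: power_add power_mult)
    have "12 + 2 * k + (?m + 1) \<le> 150 * k" using k_ge by simp
    from two_pow_le_n[OF this] have "4096 * 4 ^ k * real d ^ (?m + 1) \<le> real n"
      unfolding e .
    moreover have "4000 * (4 ^ k * real d ^ (?m + 1)) \<le> 4096 * (4 ^ k * real d ^ (?m + 1))"
      by (intro mult_right_mono) auto
    ultimately have "4000 * (4 ^ k * real d ^ (?m + 1)) \<le> real n"
      by (simp add: mult.assoc)
    then show ?thesis
      using n_pos by (simp add: field_simps)
  qed
  finally show "measure P {x \<in> space P. (real n)\<^sup>2 * (2 * real k) ^ (2 * k) / 4 < tensor_error x} \<le> 1 / 1000"
    by (simp add: B_def)
qed

text \<open>Both samples are compared with the population tensor: the inequality (a - b)^2 \<le> 2
  (a - c)^2 + 2 (b - c)^2 doubles the two quarters, and the halves add up to the threshold.\<close>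

lemma mmd_le_of_tensor_error:
  assumes x: "tensor_error x \<le> (real n)\<^sup>2 * (2 * real k) ^ (2 * k) / 4"
    and z: "tensor_error z \<le> (real n)\<^sup>2 * (2 * real k) ^ (2 * k) / 4"
  shows "mmd d k n x z \<le> (real n)\<^sup>2"
proof -
  let ?m = "2 * k"
  define \<mu> where "\<mu> g = real n * (\<integral>y. tensor ?m y g \<partial>G)" for g
  have "(a - b)\<^sup>2 \<le> 2 * (a - c)\<^sup>2 + 2 * (b - c)\<^sup>2" for a b c :: real
  proof -
    have "2 * (a - c)\<^sup>2 + 2 * (b - c)\<^sup>2 - (a - b)\<^sup>2 = (a + b - 2 * c)\<^sup>2"
      by (simp add: power2_eq_square algebra_simps)
    then show ?thesis using zero_le_power2[of "a + b - 2 * c"] by linarith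
  qed
  then have "mmd_tensor d ?m n x z \<le> (\<Sum>g\<in>multi d ?m. 2 * ((\<Sum>j<n. tensor ?m (z j) g) - \<mu> g)\<^sup>2 + 2 * ((\<Sum>j<n. tensor ?m (x j) g) - \<mu> g)\<^sup>2)"
    unfolding mmd_tensor_def by (intro sum_mono)
  also have "\<dots> = 2 * tensor_error z + 2 * tensor_error x"
    unfolding tensor_error_def \<mu>_def sum.distrib sum_distrib_left ..
  also have "\<dots> \<le> (real n)\<^sup>2 * (2 * real k) ^ ?m"
    using x z by simp
  finally have "mmd d k n x z * (2 * real k) ^ ?m \<le> (real n)\<^sup>2 * (2 * real k) ^ ?m"
    using mmd_eq[of k d n x z] k_ge by simp
  then show ?thesis
    using k_ge by simp
qed

text \<open>Markov's inequality on the test sample, whose moment is inherited from the training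
  sample: a point of \<open>A\<close> contributes at least (4k)^k = 2^k (2k)^k, while the total is
  at most 1001 n (2k)^k, and 2^k is at least 10^6 / epsilon.\<close>

lemma moment_count:
  assumes mmd: "mmd d k n x z \<le> (real n)\<^sup>2"
    and train: "(\<Sum>i<n. lin (x i) ^ (2 * k)) \<le> 1000 * real n * (2 * real k) ^ k"
    and A: "\<And>j. j \<in> A \<Longrightarrow> 4 * real k \<le> (lin (z j))\<^sup>2" "A \<subseteq> {..<n}"
  shows "2 * real (card A) \<le> \<epsilon> * real n"
proof -
  define B where "B = (2 * real k) ^ k"
  have B: "0 < B" using k_ge by (simp add: B_def)
  have "real (card A) * (4 * real k) ^ k = (\<Sum>j\<in>A. (4 * real k) ^ k)"
    by simp
  also have "\<dots> \<le> (\<Sum>j\<in>A. lin (z j) ^ (2 * k))"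
    unfolding power_mult using A(1) by (intro sum_mono power_mono) auto
  also have "\<dots> \<le> (\<Sum>j<n. lin (z j) ^ (2 * k))"
    using A(2) by (intro sum_mono2) auto
  also have "\<dots> \<le> (\<Sum>i<n. lin (x i) ^ (2 * k)) + real n * B"
    using moment_transfer[OF unit _ mmd] k_ge by (simp add: lin_def B_def)
  also have "\<dots> \<le> 1001 * real n * B"
    using train unfolding B_def[symmetric] mult.assoc by linarith
  also have "(4 * real k) ^ k = 2 ^ k * B"
    using power_mult_distrib[of 2 "2 * real k" k] by (simp add: B_def)
  finally have "(real (card A) * 2 ^ k) * B \<le> (1001 * real n) * B"
    by (simp add: mult_ac)
  then have le: "real (card A) * 2 ^ k \<le> 1001 * real n"
    using B by simp
  have "real (card A) * 1000000 \<le> real (card A) * (\<epsilon> * 2 ^ k)"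
    using \<epsilon>_scale by (intro mult_left_mono) auto
  also have "\<dots> = \<epsilon> * (real (card A) * 2 ^ k)" by simp
  also have "\<dots> \<le> \<epsilon> * (1001 * real n)"
    using le \<epsilon> by (intro mult_left_mono) auto
  finally have "1000000 * real (card A) \<le> 1001 * (\<epsilon> * real n)"
    by simp
  moreover have "0 \<le> \<epsilon> * real n" using \<epsilon> by simp
  ultimately show ?thesis by linarith
qed

section \<open>The estimated halfspace and the region that it flags\<close>

definition sample_chow :: "(nat \<Rightarrow> nat \<Rightarrow> real) \<Rightarrow> nat \<Rightarrow> real" where
  "sample_chow x l = (\<Sum>i<n. f (x i) * x i l)"

definition sample_offset :: "(nat \<Rightarrow> nat \<Rightarrow> real) \<Rightarrow> real" where
  "sample_offset x = (\<Sum>i<n. f (x i) * excess (x i))"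

lemma chow_decomposition:
  assumes good: "chow_error n x \<le> 18000 * real n * (real d)\<^sup>2"
  defines "A \<equiv> \<lambda>z. (\<Sum>l<d. sample_chow x l * z l) - sample_offset x"
  shows "(A z - real n * amp * (lin z - \<tau>))\<^sup>2 \<le> 18000 * real n * (real d)\<^sup>2 * ((\<Sum>l<d. (z l)\<^sup>2) + 1)"
proof -
  \<comment> \<open>The offset is treated as an extra coordinate with index \<open>d\<close>, paired
    with the entry -1, so that one application of Cauchy-Schwarz covers both errors.\<close>
  define a where "a l = (if l < d then sample_chow x l - real n * (amp * v l) else sample_offset x - real n * (amp * \<tau>))" for l
  define b where "b l = (if l < d then z l else -1)" for l
  have "A z - real n * amp * (lin z - \<tau>) = (\<Sum>l<Suc d. a l * b l)"
    by (simp add: A_def a_def b_def lin_def sum_subtractf sum_distrib_left algebra_simps)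
  then have "(A z - real n * amp * (lin z - \<tau>))\<^sup>2 \<le> (\<Sum>l<Suc d. (a l)\<^sup>2) * (\<Sum>l<Suc d. (b l)\<^sup>2)"
    using Cauchy_Schwarz_ineq_sum[of a b "{..<Suc d}"] by simp
  also have "(\<Sum>l<Suc d. (a l)\<^sup>2) = chow_error n x"
    by (simp add: a_def chow_error_def sample_chow_def sample_offset_def)
  also have "(\<Sum>l<Suc d. (b l)\<^sup>2) = (\<Sum>l<d. (z l)\<^sup>2) + 1"
    by (simp add: b_def)
  also have "chow_error n x * ((\<Sum>l<d. (z l)\<^sup>2) + 1) \<le> 18000 * real n * (real d)\<^sup>2 * ((\<Sum>l<d. (z l)\<^sup>2) + 1)"
    using good by (intro mult_right_mono add_nonneg_nonneg sum_nonneg) auto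
  finally show ?thesis .
qed

text \<open>If the estimated value A and its target t have different signs, then A is no larger in
  absolute value than A - t, which the sampling error bounds. The argument is uniform in
  \<open>\<tau>\<close>, as soundness requires.\<close>

lemma disagreement_flagged:
  assumes good: "chow_error n x \<le> 18000 * real n * (real d)\<^sup>2"
    and ne: "sgn_pm ((\<Sum>l<d. sample_chow x l * z l) - sample_offset x) \<noteq> f z"
  shows "flagged d n (sample_chow x) (sample_offset x) z"
proof -
  define A where "A = (\<Sum>l<d. sample_chow x l * z l) - sample_offset x"
  define t where "t = real n * amp * (lin z - \<tau>)"
  define c where "c = real n * amp"
  have "0 < c"
    using n_pos amp_pos by (simp add: c_def)
  then have "0 \<le> t \<longleftrightarrow> \<tau> \<le> lin z"
    unfolding t_def c_def[symmetric] by (simp add: zero_le_mult_iff)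
  then have "(0 \<le> A) \<noteq> (0 \<le> t)"
    using ne unfolding A_def[symmetric] by (auto simp: f_def sgn_pm_def split: if_splits)
  then have "\<bar>A\<bar> \<le> \<bar>A - t\<bar>" by linarith
  then have "A\<^sup>2 \<le> (A - t)\<^sup>2" by (simp add: abs_le_square_iff)
  also have "\<dots> \<le> 18000 * real n * (real d)\<^sup>2 * ((\<Sum>l<d. (z l)\<^sup>2) + 1)"
    unfolding A_def t_def by (rule chow_decomposition[OF good])
  finally show ?thesis by (simp add: flagged_def A_def)
qed

text \<open>Outside this set the margin exceeds \<open>\<epsilon> / 4000\<close> and the norm is
  moderate, so the signal can dominate the right-hand side of \<open>flagged\<close>. Each of the
  two parts has Gaussian mass at most \<open>\<epsilon> / 4000\<close>.\<close>

definition near :: "(nat \<Rightarrow> real) set" where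
  "near = {z \<in> space G. (\<tau> - \<epsilon> / 4000 \<le> lin z \<and> lin z \<le> \<tau> + \<epsilon> / 4000) \<or> 8000 * (real d + 1) / \<epsilon> \<le> (\<Sum>l<d. (z l)\<^sup>2) + 1}"

lemma sets_near: "near \<in> sets G"
  unfolding near_def by measurable

lemma near_prob: "measure G near \<le> \<epsilon> / 2000"
proof -
  let ?A = "{z \<in> space G. \<tau> - \<epsilon> / 4000 \<le> lin z \<and> lin z \<le> \<tau> + \<epsilon> / 4000}"
  let ?B = "{z \<in> space G. 8000 * (real d + 1) / \<epsilon> \<le> (\<Sum>l<d. (z l)\<^sup>2) + 1}"
  have i: "integrable G (\<lambda>z. (\<Sum>l<d. (z l)\<^sup>2) + 1)"
    using coordinate_moments(3) by (intro Bochner_Integration.integrable_add Bochner_Integration.integrable_sum) auto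
  have "(\<integral>z. (\<Sum>l<d. (z l)\<^sup>2) + 1 \<partial>G) = (\<Sum>l<d. \<integral>z. (z l)\<^sup>2 \<partial>G) + 1"
    using coordinate_moments(3)
    by (subst Bochner_Integration.integral_add)
      (auto simp: Bochner_Integration.integral_sum G.prob_space intro!: Bochner_Integration.integrable_sum)
  also have "\<dots> \<le> (\<Sum>l<d. 2) + 1"
    using coordinate_moments(4) by (intro add_mono sum_mono) auto
  also have "\<dots> \<le> 2 * (real d + 1)" by simp
  finally have m: "(\<integral>z. (\<Sum>l<d. (z l)\<^sup>2) + 1 \<partial>G) \<le> 2 * (real d + 1)" .
  have pos: "0 < 8000 * (real d + 1) / \<epsilon>" using \<epsilon> by simp
  have "measure G ?B \<le> (\<integral>z. (\<Sum>l<d. (z l)\<^sup>2) + 1 \<partial>G) / (8000 * (real d + 1) / \<epsilon>)"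
    by (rule integral_Markov_inequality_measure[OF i sets.empty_sets _ pos]) (auto intro!: AE_I2 add_nonneg_nonneg sum_nonneg)
  also have "\<dots> \<le> 2 * (real d + 1) / (8000 * (real d + 1) / \<epsilon>)"
    using m pos by (intro divide_right_mono) auto
  also have "\<dots> = \<epsilon> / 4000"
    using \<epsilon> by (simp add: field_simps)
  finally have B: "measure G ?B \<le> \<epsilon> / 4000" .
  have A: "measure G ?A \<le> \<epsilon> / 4000"
    using lin_interval[of "\<tau> - \<epsilon> / 4000" "\<tau> + \<epsilon> / 4000"] \<epsilon> by simp
  have "near = ?A \<union> ?B" by (auto simp: near_def)
  moreover have "measure G (?A \<union> ?B) \<le> measure G ?A + measure G ?B"
    by (rule measure_Un_le) measurable
  ultimately show ?thesis using A B by simp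
qed

text \<open>The signal \<open>n * amp * (lin z - \<tau>)\<close> grows like n, the sampling error
  only like its square root; a flagged point outside \<open>near\<close> would therefore bound n
  from above, contrary to \<open>n_ge\<close>.\<close>

lemma flagged_near:
  assumes good: "chow_error n x \<le> 18000 * real n * (real d)\<^sup>2"
    and \<tau>: "\<tau>\<^sup>2 \<le> 64 * real k" and z: "z \<in> space G"
    and flag: "flagged d n (sample_chow x) (sample_offset x) z"
  shows "z \<in> near"
proof (rule ccontr)
  assume "z \<notin> near"
  then have far: "\<epsilon> / 4000 < \<bar>lin z - \<tau>\<bar>" and small: "(\<Sum>l<d. (z l)\<^sup>2) + 1 < 8000 * (real d + 1) / \<epsilon>"
    using z by (auto simp: near_def not_le abs_if)
  define A where "A = (\<Sum>l<d. sample_chow x l * z l) - sample_offset x"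
  define t where "t = real n * amp * (lin z - \<tau>)"
  define R where "R = (\<Sum>l<d. (z l)\<^sup>2) + 1"
  define D where "D = real d"
  have D: "2 \<le> D" using d2 by (simp add: D_def)
  have n: "0 < real n" using n_pos by simp
  have "t\<^sup>2 \<le> 2 * A\<^sup>2 + 2 * (A - t)\<^sup>2"
  proof -
    have "2 * A\<^sup>2 + 2 * (A - t)\<^sup>2 - t\<^sup>2 = (2 * A - t)\<^sup>2"
      by (simp add: power2_eq_square algebra_simps)
    then show ?thesis using zero_le_power2[of "2 * A - t"] by linarith
  qed
  also have "\<dots> \<le> 2 * (18000 * real n * D\<^sup>2 * R) + 2 * (18000 * real n * D\<^sup>2 * R)"
    using flag chow_decomposition[OF good, of z] unfolding flagged_def A_def t_def R_def D_def
    by (intro add_mono mult_left_mono) auto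
  also have "\<dots> = (72000 * real n * D\<^sup>2) * R" by simp
  also have "\<dots> \<le> (72000 * real n * D\<^sup>2) * (8000 * (D + 1) / \<epsilon>)"
    using small by (intro mult_left_mono) (auto simp: R_def D_def)
  finally have "(real n)\<^sup>2 * (amp\<^sup>2 * (lin z - \<tau>)\<^sup>2) \<le> (72000 * real n * D\<^sup>2) * (8000 * (D + 1) / \<epsilon>)"
    by (simp add: t_def power_mult_distrib mult_ac)
  then have "real n * (real n * (amp\<^sup>2 * (lin z - \<tau>)\<^sup>2)) \<le> real n * ((72000 * D\<^sup>2) * (8000 * (D + 1) / \<epsilon>))"
    by (simp only: power2_eq_square mult_ac)
  then have "real n * (amp\<^sup>2 * (lin z - \<tau>)\<^sup>2) \<le> (72000 * D\<^sup>2) * (8000 * (D + 1) / \<epsilon>)"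
    using n by (rule mult_left_le_imp_le)
  moreover have "real n * (amp\<^sup>2 * (lin z - \<tau>)\<^sup>2) > real n * (amp\<^sup>2 * (\<epsilon> / 4000)\<^sup>2)"
  proof -
    have "(\<epsilon> / 4000)\<^sup>2 < \<bar>lin z - \<tau>\<bar>\<^sup>2"
      using far \<epsilon> by (intro power_strict_mono) auto
    then show ?thesis using n amp_pos by simp
  qed
  ultimately have lt: "real n * (amp\<^sup>2 * (\<epsilon> / 4000)\<^sup>2) < (72000 * D\<^sup>2) * (8000 * (D + 1) / \<epsilon>)"
    by linarith
  \<comment> \<open>\<open>amp\<close> is at least 2 exp(-32k) / 3; in its square, e is replaced by
    4.\<close>
  have "4 / 9 * (1 / 2 ^ (128 * k)) \<le> amp\<^sup>2"
  proof -
    have e4: "exp 1 \<le> (4::real)" using exp_le by simp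
    have "exp (64 * real k) = exp 1 ^ (64 * k)"
      by (simp flip: exp_of_nat_mult)
    also have "\<dots> \<le> 4 ^ (64 * k)" using e4 by (intro power_mono) auto
    also have "\<dots> = 2 ^ (128 * k)"
      by (simp add: power_mult)
    finally have "1 / 2 ^ (128 * k) \<le> 1 / exp (64 * real k)"
      by (intro divide_left_mono) auto
    also have "\<dots> = (exp (- 32 * real k))\<^sup>2"
      by (simp add: exp_minus field_simps flip: exp_add exp_double)
    finally have "4 / 9 * (1 / 2 ^ (128 * k)) \<le> (2 * (exp (- 32 * real k) / 3))\<^sup>2"
      by (simp add: power_mult_distrib power_divide)
    also have "\<dots> \<le> amp\<^sup>2"
      using amp_ge[OF \<tau>] by (intro power_mono) auto
    finally show ?thesis .
  qed
  then have "real n * (4 / 9 * (1 / 2 ^ (128 * k)) * (\<epsilon> / 4000)\<^sup>2) \<le> real n * (amp\<^sup>2 * (\<epsilon> / 4000)\<^sup>2)"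
    by (intro mult_left_mono mult_right_mono) auto
  with lt have "real n * (4 / 9 * (1 / 2 ^ (128 * k)) * (\<epsilon> / 4000)\<^sup>2) < (72000 * D\<^sup>2) * (8000 * (D + 1) / \<epsilon>)"
    by linarith
  \<comment> \<open>36000000 is 9/4 times 4000 squared; the cube of \<open>\<epsilon>\<close>
    combines the squared margin with the bound on the norm.\<close>
  then have "real n * \<epsilon> ^ 3 < 2 ^ (128 * k) * (72000 * D\<^sup>2 * (8000 * (D + 1)) * 36000000)"
    using \<epsilon> by (simp add: field_simps power2_eq_square power3_eq_cube)
  also have "\<dots> \<le> 2 ^ (128 * k) * (72000 * D\<^sup>2 * (8000 * (2 * D)) * 36000000)"
    using D by (intro mult_left_mono mult_right_mono) auto
  \<comment> \<open>The numerical constant is below 10^18, and each of the three factors 10^6 is at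
    most \<open>\<epsilon> * 2 ^ k\<close>; this turns 128k into 131k.\<close>
  also have "\<dots> \<le> 2 ^ (128 * k) * (1000000 ^ 3 * D ^ 3)"
    using D by (intro mult_left_mono) (auto simp: power2_eq_square power3_eq_cube)
  also have "\<dots> \<le> 2 ^ (128 * k) * ((\<epsilon> * 2 ^ k) ^ 3 * D ^ 3)"
    using D \<epsilon>_scale by (intro mult_left_mono mult_right_mono power_mono) auto
  also have "\<dots> = (2 ^ (131 * k) * D ^ 3) * \<epsilon> ^ 3"
    by (simp add: power_mult_distrib flip: power_mult power_add)
  also have "\<dots> \<le> real n * \<epsilon> ^ 3"
    using two_pow_le_n[of "131 * k" 3] k_ge \<epsilon> by (intro mult_right_mono) (auto simp: D_def)
  finally show False by simp
qed

end

section \<open>From samples to products\<close>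

lemma pred_le_borel:
  fixes f g :: "'a \<Rightarrow> real"
  shows "f \<in> borel_measurable M \<Longrightarrow> g \<in> borel_measurable M \<Longrightarrow> Measurable.pred M (\<lambda>w. f w \<le> g w)"
  unfolding Measurable.pred_def by (rule borel_measurable_le)

lemma measurable_cell: "cell \<in> borel \<rightarrow>\<^sub>M count_space UNIV"
  unfolding cell_def[abs_def] by (rule measurable_card) (simp add: borel_measurable_less)

context halfspace
begin

text \<open>The restriction to \<open>{..<n}\<close> keeps the labelled sample extensional, as
  elements of the product space are.\<close>

definition lab :: "nat \<Rightarrow> (nat \<Rightarrow> nat \<Rightarrow> real) \<Rightarrow> nat \<Rightarrow> (nat \<Rightarrow> real) \<times> real" where
  "lab n x = (\<lambda>i\<in>{..<n}. (x i, f (x i)))"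

lemma f_halfspace: "f \<in> halfspaces d"
  unfolding halfspaces_def f_def[abs_def] lin_def using unit by blast

lemma prob_space_labelled: "prob_space (labelled G f)"
  unfolding labelled_def by (rule G.prob_space_distr[OF measurable_label[OF f_halfspace]])

lemma sets_labelled: "sets (labelled G f) = sets (G \<Otimes>\<^sub>M count_space {-1, 1})"
  by (simp add: labelled_def)

lemma PiM_labelled:
  "PiM {..<n} (\<lambda>_. labelled G f) = distr (PiM {..<n} (\<lambda>_. G)) (PiM {..<n} (\<lambda>_. labelled G f)) (lab n)"
proof -
  have m: "(\<lambda>x. (x, f x)) \<in> G \<rightarrow>\<^sub>M labelled G f"
    using measurable_label[OF f_halfspace] sets_labelled by (simp cong: measurable_cong_sets)
  have "distr (PiM {..<n} (\<lambda>_. G)) (PiM {..<n} (\<lambda>_. labelled G f)) (compose {..<n} (\<lambda>x. (x, f x))) =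
      PiM {..<n} (\<lambda>_. distr G (labelled G f) (\<lambda>x. (x, f x)))"
    by (rule distr_PiM_finite_prob_space') (auto intro: G.prob_space_axioms prob_space_labelled m)
  moreover have "distr G (labelled G f) (\<lambda>x. (x, f x)) = labelled G f"
    unfolding labelled_def by (rule distr_cong) auto
  moreover have "compose {..<n} (\<lambda>x. (x, f x)) = lab n"
    by (auto simp: compose_def lab_def fun_eq_iff)
  ultimately show ?thesis by simp
qed

context
  fixes D' :: "(nat \<Rightarrow> real) measure" and n :: nat
  assumes D': "prob_space D'" "sets D' = sets G"
begin

abbreviation TrainM :: "(nat \<Rightarrow> nat \<Rightarrow> real) measure" where "TrainM \<equiv> PiM {..<n} (\<lambda>_. G)"
abbreviation TestM :: "(nat \<Rightarrow> nat \<Rightarrow> real) measure" where "TestM \<equiv> PiM {..<n} (\<lambda>_. D')"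
abbreviation \<Omega> where "\<Omega> \<equiv> samples n G D' f"

lemma prob_space_TestM: "prob_space TestM"
  by (intro prob_space_PiM D')

lemma prob_space_TrainM: "prob_space TrainM"
  by (intro prob_space_PiM G.prob_space_axioms)

lemma space_D': "space D' = space G"
  using D'(2) by (rule sets_eq_imp_space_eq)

lemma measurable_lab: "lab n \<in> TrainM \<rightarrow>\<^sub>M PiM {..<n} (\<lambda>_. labelled G f)"
proof -
  have m: "(\<lambda>x. (x, f x)) \<in> G \<rightarrow>\<^sub>M labelled G f"
    using measurable_label[OF f_halfspace] sets_labelled by (simp cong: measurable_cong_sets)
  show ?thesis
    unfolding lab_def
  proof (rule measurable_restrict)
    fix i assume "i \<in> {..<n}"
    then have "(\<lambda>x. x i) \<in> TrainM \<rightarrow>\<^sub>M G" by measurable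
    from measurable_compose[OF this m] show "(\<lambda>x. (x i, f (x i))) \<in> TrainM \<rightarrow>\<^sub>M labelled G f" .
  qed
qed

lemma samples_distr: "\<Omega> = distr (TrainM \<Otimes>\<^sub>M TestM) (PiM {..<n} (\<lambda>_. labelled G f) \<Otimes>\<^sub>M TestM) (\<lambda>(x, z). (lab n x, z))"
proof -
  interpret TestM: prob_space TestM by (rule prob_space_TestM)
  have id: "distr TestM TestM (\<lambda>z. z) = TestM" by (rule distr_id)
  have "\<Omega> = distr TrainM (PiM {..<n} (\<lambda>_. labelled G f)) (lab n) \<Otimes>\<^sub>M distr TestM TestM (\<lambda>z. z)"
    unfolding samples_def id PiM_labelled[symmetric] ..
  also have "\<dots> = distr (TrainM \<Otimes>\<^sub>M TestM) (PiM {..<n} (\<lambda>_. labelled G f) \<Otimes>\<^sub>M TestM) (\<lambda>(x, z). (lab n x, z))"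
    by (rule pair_measure_distr[OF measurable_lab]) (simp_all add: id TestM.sigma_finite_measure_axioms)
  finally show ?thesis .
qed

text \<open>Bad events are described on unlabelled samples, where plain product measures are
  available, and transported along \<open>lab\<close>. The good event has to be measurable itself,
  because a nonmeasurable set has measure 0.\<close>

lemma samples_prob_ge:
  assumes E: "{\<omega> \<in> space \<Omega>. \<Phi> \<omega>} \<in> sets \<Omega>"
    and B: "B \<in> sets (TrainM \<Otimes>\<^sub>M TestM)" "measure (TrainM \<Otimes>\<^sub>M TestM) B \<le> \<delta>"
    and good: "\<And>x z. x \<in> space TrainM \<Longrightarrow> z \<in> space TestM \<Longrightarrow> (x, z) \<notin> B \<Longrightarrow> \<Phi> (lab n x, z)"
  shows "1 - \<delta> \<le> measure \<Omega> {\<omega> \<in> space \<Omega>. \<Phi> \<omega>}"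
proof -
  interpret TestM: prob_space TestM by (rule prob_space_TestM)
  interpret TrainM: prob_space TrainM by (rule prob_space_TrainM)
  interpret PQ: pair_prob_space TrainM TestM ..
  let ?g = "\<lambda>(x, z). (lab n x, z)"
  let ?N = "PiM {..<n} (\<lambda>_. labelled G f) \<Otimes>\<^sub>M TestM"
  have [measurable]: "lab n \<in> TrainM \<rightarrow>\<^sub>M PiM {..<n} (\<lambda>_. labelled G f)" by (rule measurable_lab)
  have g: "?g \<in> TrainM \<Otimes>\<^sub>M TestM \<rightarrow>\<^sub>M ?N" by measurable
  have sN: "sets \<Omega> = sets ?N" by (subst samples_distr) simp
  then have spN: "space \<Omega> = space ?N" by (rule sets_eq_imp_space_eq)
  have "1 - \<delta> \<le> 1 - measure (TrainM \<Otimes>\<^sub>M TestM) B" using B(2) by simp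
  also have "\<dots> = measure (TrainM \<Otimes>\<^sub>M TestM) (space (TrainM \<Otimes>\<^sub>M TestM) - B)"
    using B(1) by (simp add: PQ.prob_compl)
  also have "\<dots> \<le> measure (TrainM \<Otimes>\<^sub>M TestM) (?g -` {\<omega> \<in> space \<Omega>. \<Phi> \<omega>} \<inter> space (TrainM \<Otimes>\<^sub>M TestM))"
  proof (rule PQ.finite_measure_mono)
    show "?g -` {\<omega> \<in> space \<Omega>. \<Phi> \<omega>} \<inter> space (TrainM \<Otimes>\<^sub>M TestM) \<in> sets (TrainM \<Otimes>\<^sub>M TestM)"
      by (rule measurable_sets[OF g]) (use E sN in simp)
    show "space (TrainM \<Otimes>\<^sub>M TestM) - B \<subseteq> ?g -` {\<omega> \<in> space \<Omega>. \<Phi> \<omega>} \<inter> space (TrainM \<Otimes>\<^sub>M TestM)"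
      using good measurable_space[OF g] spN by (auto simp: space_pair_measure)
  qed
  also have "\<dots> = measure (distr (TrainM \<Otimes>\<^sub>M TestM) ?N ?g) {\<omega> \<in> space \<Omega>. \<Phi> \<omega>}"
    by (rule measure_distr[OF g, symmetric]) (use E sN in simp)
  also have "\<dots> = measure \<Omega> {\<omega> \<in> space \<Omega>. \<Phi> \<omega>}"
    by (simp flip: samples_distr)
  finally show ?thesis .
qed

lemma measurable_train: "i < n \<Longrightarrow> l < d \<Longrightarrow> (\<lambda>\<omega>. fst (fst \<omega> i) l) \<in> borel_measurable \<Omega>"
  and measurable_label_coord: "i < n \<Longrightarrow> (\<lambda>\<omega>. snd (fst \<omega> i)) \<in> borel_measurable \<Omega>"
  and measurable_test: "i < n \<Longrightarrow> l < d \<Longrightarrow> (\<lambda>\<omega>. snd \<omega> i l) \<in> borel_measurable \<Omega>"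
proof -
  assume i: "i < n"
  have c: "(\<lambda>\<omega>. fst \<omega> i) \<in> \<Omega> \<rightarrow>\<^sub>M labelled G f"
    unfolding samples_def
    by (rule measurable_compose[OF measurable_fst measurable_component_singleton]) (use i in simp)
  have fst: "fst \<in> labelled G f \<rightarrow>\<^sub>M G"
    using measurable_fst[of G "count_space {-1, 1 :: real}"] sets_labelled by (simp cong: measurable_cong_sets)
  have "snd \<in> labelled G f \<rightarrow>\<^sub>M count_space {-1, 1}"
    using measurable_snd[of G "count_space {-1, 1 :: real}"] sets_labelled by (simp cong: measurable_cong_sets)
  then have snd: "snd \<in> borel_measurable (labelled G f)"
    by (rule measurable_compose) simp
  show "(\<lambda>\<omega>. snd (fst \<omega> i)) \<in> borel_measurable \<Omega>"
    by (rule measurable_compose[OF c snd])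
  have t: "(\<lambda>\<omega>. snd \<omega> i) \<in> \<Omega> \<rightarrow>\<^sub>M D'"
    unfolding samples_def
    by (rule measurable_compose[OF measurable_snd measurable_component_singleton]) (use i in simp)
  assume l: "l < d"
  show "(\<lambda>\<omega>. fst (fst \<omega> i) l) \<in> borel_measurable \<Omega>"
    by (rule measurable_compose[OF measurable_compose[OF c fst] measurable_coordinate[OF l]])
  have "(\<lambda>x. x l) \<in> borel_measurable D'"
    using measurable_coordinate[OF l] D'(2) by (simp cong: measurable_cong_sets)
  then show "(\<lambda>\<omega>. snd \<omega> i l) \<in> borel_measurable \<Omega>"
    by (rule measurable_compose[OF t])
qed

lemma measurable_card_Collect:
  assumes "\<And>j. j < n \<Longrightarrow> Measurable.pred \<Omega> (R j)"
  shows "(\<lambda>\<omega>. real (card {j. j < n \<and> R j \<omega>})) \<in> borel_measurable \<Omega>"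
proof -
  have "(\<lambda>\<omega>. real (card {j. j < n \<and> R j \<omega>})) = (\<lambda>\<omega>. \<Sum>j<n. if R j \<omega> then 1 else 0)"
    by (auto simp: sum.If_cases Int_def)
  then show ?thesis
    using assms by simp
qed

lemma measurable_chow: "l < d \<Longrightarrow> (\<lambda>\<omega>. chow n (fst \<omega>) l) \<in> borel_measurable \<Omega>"
  unfolding chow_def
  by (intro borel_measurable_sum borel_measurable_times measurable_train measurable_label_coord) auto

lemma measurable_offset: "(\<lambda>\<omega>. offset d n (fst \<omega>)) \<in> borel_measurable \<Omega>"
  unfolding offset_def
  by (intro borel_measurable_sum borel_measurable_times borel_measurable_diff borel_measurable_power
      borel_measurable_const measurable_train measurable_label_coord) auto

lemma measurable_outcome:
  assumes n: "hash_tests \<le> n"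
  shows "(\<lambda>\<omega>. outcome d n \<epsilon> (fst \<omega>) (snd \<omega>)) \<in> \<Omega> \<rightarrow>\<^sub>M count_space UNIV"
proof -
  have "Measurable.pred \<Omega> (\<lambda>\<omega>. flagged d n (chow n (fst \<omega>)) (offset d n (fst \<omega>)) (snd \<omega> j))" if "j < n" for j
    unfolding flagged_def using that
    by (intro pred_le_borel borel_measurable_power borel_measurable_diff borel_measurable_sum
        borel_measurable_times borel_measurable_add borel_measurable_const measurable_chow measurable_offset measurable_test) auto
  note f1 = measurable_card_Collect[OF this]
  have fl: "{\<omega> \<in> space \<Omega>. 2 * real (card {j. j < n \<and> flagged d n (chow n (fst \<omega>)) (offset d n (fst \<omega>)) (snd \<omega> j)}) \<le> \<epsilon> * real n} \<in> sets \<Omega>"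
    by (intro borel_measurable_le borel_measurable_times borel_measurable_const f1)
  have "Measurable.pred \<Omega> (\<lambda>\<omega>. snd (fst \<omega> i) < 0)" if "i < n" for i
    using that by (intro borel_measurable_pred_less measurable_label_coord borel_measurable_const) auto
  note n1 = measurable_card_Collect[OF this]
  have ng: "{\<omega> \<in> space \<Omega>. real (card {i. i < n \<and> snd (fst \<omega> i) < 0}) \<le> c} \<in> sets \<Omega>" for c
    by (intro borel_measurable_le borel_measurable_const n1)
  have "Measurable.pred \<Omega> (\<lambda>\<omega>. \<not> snd (fst \<omega> i) < 0)" if "i < n" for i
    unfolding not_less using that by (intro pred_le_borel measurable_label_coord borel_measurable_const) auto
  note p1 = measurable_card_Collect[OF this]
  have ps: "{\<omega> \<in> space \<Omega>. real (card {i. i < n \<and> \<not> snd (fst \<omega> i) < 0}) \<le> c} \<in> sets \<Omega>" for c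
    by (intro borel_measurable_le borel_measurable_const p1)
  have mm: "{\<omega> \<in> space \<Omega>. mmd d k n (\<lambda>i. fst (fst \<omega> i)) (snd \<omega>) \<le> c} \<in> sets \<Omega>" for k c
    unfolding mmd_def kernel_def
    by (intro borel_measurable_le borel_measurable_sum borel_measurable_add borel_measurable_diff borel_measurable_times borel_measurable_const
        borel_measurable_power borel_measurable_divide measurable_test measurable_train) auto
  have cl: "{\<omega> \<in> space \<Omega>. inj_on (\<lambda>i. cell (snd \<omega> i 0)) {..<hash_tests}} \<in> sets \<Omega>"
  proof -
    have c: "(\<lambda>\<omega>. cell (snd \<omega> i 0)) \<in> \<Omega> \<rightarrow>\<^sub>M count_space UNIV" if i: "i < hash_tests" for i
      using i n d2 by (intro measurable_compose[OF measurable_test measurable_cell]) auto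
    have "Measurable.pred \<Omega> (\<lambda>\<omega>. cell (snd \<omega> i 0) \<noteq> cell (snd \<omega> j 0))" if "i < hash_tests" "j < hash_tests" for i j
    proof -
      have r: "(\<lambda>\<omega>. real (cell (snd \<omega> i 0))) \<in> borel_measurable \<Omega>" if "i < hash_tests" for i
        by (rule measurable_compose[OF c[OF that]]) simp
      from borel_measurable_neq[OF r[OF that(1)] r[OF that(2)]] show ?thesis
        unfolding Measurable.pred_def by simp
    qed
    then have "Measurable.pred \<Omega> (\<lambda>\<omega>. i = j \<or> cell (snd \<omega> i 0) \<noteq> cell (snd \<omega> j 0))"
      if "i \<in> {..<hash_tests}" "j \<in> {..<hash_tests}" for i j
      using that by (cases "i = j") auto
    then have "Measurable.pred \<Omega> (\<lambda>\<omega>. \<forall>i\<in>{..<hash_tests}. \<forall>j\<in>{..<hash_tests}. i = j \<or> cell (snd \<omega> i 0) \<noteq> cell (snd \<omega> j 0))"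
      by (intro pred_intros_finite finite_lessThan)
    moreover have "inj_on (\<lambda>i. cell (z i 0)) {..<hash_tests} \<longleftrightarrow>
        (\<forall>i\<in>{..<hash_tests}. \<forall>j\<in>{..<hash_tests}. i = j \<or> cell (z i 0) \<noteq> cell (z j 0))" for z :: "nat \<Rightarrow> nat \<Rightarrow> real"
      by (auto simp: inj_on_def)
    ultimately show ?thesis
      unfolding Measurable.pred_def by (simp only:)
  qed
  show ?thesis
    unfolding outcome_def
    by (cases "\<epsilon> < 3 / 4") (simp_all only: if_True if_False, (intro measurable_If measurable_const fl ng ps mm cl; simp)+)
qed

lemma space_TestM: "z \<in> space TestM \<Longrightarrow> i < n \<Longrightarrow> z i \<in> space G"
  by (auto simp: space_PiM space_D' PiE_iff)

text \<open>Joint measurability in sample and point is what makes the error of an answer a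
  measurable function of the sample.\<close>

lemma measurable_answer:
  assumes "hash_cells < n"
  shows "(\<lambda>(\<omega>, x). answer d n (fst \<omega>) m x) \<in> borel_measurable (\<Omega> \<Otimes>\<^sub>M D')"
proof -
  have coord: "(\<lambda>p. snd p l) \<in> borel_measurable (\<Omega> \<Otimes>\<^sub>M D')" if "l < d" for l
  proof -
    have "(\<lambda>x. x l) \<in> borel_measurable D'"
      using measurable_coordinate[OF that] D'(2) by (simp cong: measurable_cong_sets)
    then show ?thesis by (rule measurable_compose[OF measurable_snd])
  qed
  have S: "(\<lambda>p. g (fst p)) \<in> borel_measurable (\<Omega> \<Otimes>\<^sub>M D')" if "g \<in> borel_measurable \<Omega>" for g :: "_ \<Rightarrow> real"
    using that by (rule measurable_compose[OF measurable_fst])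
  have sgn: "sgn_pm \<in> borel_measurable borel"
    unfolding sgn_pm_def[abs_def] by measurable
  have lin: "(\<lambda>p. (\<Sum>l<d. chow n (fst (fst p)) l * snd p l) - offset d n (fst (fst p))) \<in> borel_measurable (\<Omega> \<Otimes>\<^sub>M D')"
    by (intro borel_measurable_diff borel_measurable_sum borel_measurable_times coord S[OF measurable_chow] S[OF measurable_offset]) auto
  \<comment> \<open>Indices from n on get the value 0, so that every \<open>F j\<close> is
    measurable and composition with the countably valued cell number applies.\<close>
  define F where "F j \<omega> = (if j < n then sgn_pm (fst (fst \<omega> j) 0) else 0)" for j and \<omega> :: "(nat \<Rightarrow> (nat \<Rightarrow> real) \<times> real) \<times> (nat \<Rightarrow> nat \<Rightarrow> real)"
  have F: "(\<lambda>p. F j (fst p)) \<in> borel_measurable (\<Omega> \<Otimes>\<^sub>M D')" for j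
    unfolding F_def using d2
    by (cases "j < n") (auto intro!: S measurable_compose[OF _ sgn] measurable_train)
  have "(\<lambda>p. cell (snd p 0)) \<in> \<Omega> \<Otimes>\<^sub>M D' \<rightarrow>\<^sub>M count_space UNIV"
    using d2 by (intro measurable_compose[OF coord measurable_cell]) auto
  from measurable_compose_countable[OF F this]
  have "(\<lambda>p. F (cell (snd p 0)) (fst p)) \<in> borel_measurable (\<Omega> \<Otimes>\<^sub>M D')" .
  moreover have "cell t < n" for t
    using cell_le[of t] assms by simp
  ultimately have hash: "(\<lambda>p. sgn_pm (fst (fst (fst p) (cell (snd p 0))) 0)) \<in> borel_measurable (\<Omega> \<Otimes>\<^sub>M D')"
    by (simp add: F_def)
  show ?thesis
    unfolding answer_def split_beta
    using measurable_compose[OF lin sgn] hash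
    by (cases "m = 1"; cases "m = 2"; cases "m = 3") simp_all
qed

section \<open>The error of an answer, and reduction of the two guarantees to small bad sets\<close>

definition err :: "((nat \<Rightarrow> real) \<Rightarrow> real) \<Rightarrow> real" where
  "err h = measure D' {x \<in> space D'. h x \<noteq> f x}"

lemma f_D': "f \<in> borel_measurable D'"
  using measurable_f D'(2) by (simp cong: measurable_cong_sets)

lemma measurable_err:
  assumes "hash_cells < n"
  shows "(\<lambda>\<omega>. err (answer d n (fst \<omega>) m)) \<in> borel_measurable \<Omega>"
    and "\<omega> \<in> space \<Omega> \<Longrightarrow> {x \<in> space D'. answer d n (fst \<omega>) m x \<noteq> f x} \<in> sets D'"
proof -
  interpret D': prob_space D' by (rule D')
  note A = measurable_answer[OF assms, of m]
  note [measurable] = A f_D'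
  have "Measurable.pred (\<Omega> \<Otimes>\<^sub>M D') (\<lambda>p. (case p of (\<omega>, x) \<Rightarrow> answer d n (fst \<omega>) m x) \<noteq> f (snd p))"
    by measurable
  then have "{p \<in> space (\<Omega> \<Otimes>\<^sub>M D'). snd p \<in> {x \<in> space D'. answer d n (fst (fst p)) m x \<noteq> f x}} \<in> sets (\<Omega> \<Otimes>\<^sub>M D')"
    unfolding Measurable.pred_def
    by (rule back_subst[where P = "\<lambda>A. A \<in> sets (\<Omega> \<Otimes>\<^sub>M D')"]) (auto simp: space_pair_measure)
  then show "(\<lambda>\<omega>. err (answer d n (fst \<omega>) m)) \<in> borel_measurable \<Omega>"
    unfolding err_def by (intro D'.measurable_measure) auto
  assume \<omega>: "\<omega> \<in> space \<Omega>"
  have "(\<lambda>x. answer d n (fst \<omega>) m x) \<in> borel_measurable D'"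
    using measurable_compose[OF measurable_Pair1'[OF \<omega>] A] by simp
  then show "{x \<in> space D'. answer d n (fst \<omega>) m x \<noteq> f x} \<in> sets D'"
    using f_D' by (rule borel_measurable_neq)
qed

lemma lab_samples_space: "x \<in> space TrainM \<Longrightarrow> z \<in> space TestM \<Longrightarrow> (lab n x, z) \<in> space \<Omega>"
  using measurable_space[OF measurable_lab] by (simp add: samples_def space_pair_measure)

text \<open>Soundness is reduced to a small measurable set outside which the chosen answer is
  accurate; measurability of the error region, demanded by \<open>tds_learner\<close>, is discharged
  here once and for all.\<close>

lemma soundness:
  assumes n: "hash_tests \<le> n" "hash_cells < n" and \<epsilon>: "0 < \<epsilon>"
    and B: "B \<in> sets (TrainM \<Otimes>\<^sub>M TestM)" "measure (TrainM \<Otimes>\<^sub>M TestM) B \<le> \<delta>"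
    and good: "\<And>x z. x \<in> space TrainM \<Longrightarrow> z \<in> space TestM \<Longrightarrow> (x, z) \<notin> B \<Longrightarrow> outcome d n \<epsilon> (lab n x) z \<noteq> 0 \<Longrightarrow>
      err (answer d n (lab n x) (outcome d n \<epsilon> (lab n x) z)) \<le> \<epsilon>"
  shows "\<P>((S, X) in \<Omega>. \<forall>h. learn learner evaluator d n \<epsilon> S X = Some h \<longrightarrow>
            {x \<in> space D'. h x \<noteq> f x} \<in> sets D' \<and> \<P>(x in D'. h x \<noteq> f x) \<le> \<epsilon>) \<ge> 1 - \<delta>"
proof -
  let ?o = "\<lambda>\<omega>. outcome d n \<epsilon> (fst \<omega>) (snd \<omega>)"
  \<comment> \<open>The chosen answer varies with the sample. Ranging over the four fixed answers
    turns the event into a finite combination of measurable ones.\<close>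
  let ?\<Phi> = "\<lambda>\<omega>. \<forall>m\<in>{1..4}. ?o \<omega> = m \<longrightarrow> err (answer d n (fst \<omega>) m) \<le> \<epsilon>"
  have d: "0 < d" using d2 by simp
  have "Measurable.pred \<Omega> (\<lambda>\<omega>. ?o \<omega> = m \<longrightarrow> err (answer d n (fst \<omega>) m) \<le> \<epsilon>)" for m
  proof -
    have 1: "Measurable.pred \<Omega> (\<lambda>\<omega>. ?o \<omega> = m)"
      using measurable_outcome[OF n(1)] by (rule measurable_compose) simp
    have 2: "Measurable.pred \<Omega> (\<lambda>\<omega>. err (answer d n (fst \<omega>) m) \<le> \<epsilon>)"
      by (intro pred_le_borel measurable_err(1) n borel_measurable_const)
    show ?thesis using 1 2 by measurable
  qed
  then have "Measurable.pred \<Omega> ?\<Phi>"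
    by (intro pred_intros_finite finite_atLeastAtMost)
  then have E: "{\<omega> \<in> space \<Omega>. ?\<Phi> \<omega>} \<in> sets \<Omega>"
    unfolding Measurable.pred_def .
  have "1 - \<delta> \<le> measure \<Omega> {\<omega> \<in> space \<Omega>. ?\<Phi> \<omega>}"
    by (rule samples_prob_ge[OF E B]) (use good in auto)
  moreover have eqv: "(\<forall>m\<in>{1..4}. outcome d n \<epsilon> S X = m \<longrightarrow> err (answer d n S m) \<le> \<epsilon>) \<longleftrightarrow> (\<forall>h. learn learner evaluator d n \<epsilon> S X = Some h \<longrightarrow>
            {x \<in> space D'. h x \<noteq> f x} \<in> sets D' \<and> \<P>(x in D'. h x \<noteq> f x) \<le> \<epsilon>)" if \<omega>: "(S, X) \<in> space \<Omega>" for S X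
  proof -
    have o: "outcome d n \<epsilon> S X \<noteq> 0 \<longleftrightarrow> outcome d n \<epsilon> S X \<in> {1..4}"
      using outcome_le[of d n \<epsilon> S X] by auto
    show ?thesis
      unfolding learn_eq[OF \<epsilon> n d] using measurable_err(2)[OF n(2) \<omega>] o
      by (auto simp: err_def)
  qed
  then have "{\<omega> \<in> space \<Omega>. ?\<Phi> \<omega>} = {(S, X) \<in> space \<Omega>. \<forall>h. learn learner evaluator d n \<epsilon> S X = Some h \<longrightarrow>
            {x \<in> space D'. h x \<noteq> f x} \<in> sets D' \<and> \<P>(x in D'. h x \<noteq> f x) \<le> \<epsilon>}"
  proof (intro Collect_cong, goal_cases)
    case (1 \<omega>)
    show ?case
      by (cases \<omega>) (simp only: fst_conv snd_conv prod.case eqv cong: conj_cong)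
  qed
  ultimately show ?thesis by (simp only:)
qed

lemma completeness:
  assumes n: "hash_tests \<le> n" "hash_cells < n" and \<epsilon>: "0 < \<epsilon>"
    and B: "B \<in> sets (TrainM \<Otimes>\<^sub>M TestM)" "measure (TrainM \<Otimes>\<^sub>M TestM) B \<le> \<delta>"
    and good: "\<And>x z. x \<in> space TrainM \<Longrightarrow> z \<in> space TestM \<Longrightarrow> (x, z) \<notin> B \<Longrightarrow> outcome d n \<epsilon> (lab n x) z \<noteq> 0"
  shows "\<P>((S, X) in \<Omega>. learn learner evaluator d n \<epsilon> S X \<noteq> None) \<ge> 1 - \<delta>"
proof -
  let ?\<Phi> = "\<lambda>\<omega>. outcome d n \<epsilon> (fst \<omega>) (snd \<omega>) \<noteq> 0"
  have d: "0 < d" using d2 by simp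
  have "Measurable.pred \<Omega> ?\<Phi>"
    using measurable_outcome[OF n(1)] by (rule measurable_compose) simp
  then have E: "{\<omega> \<in> space \<Omega>. ?\<Phi> \<omega>} \<in> sets \<Omega>"
    unfolding Measurable.pred_def .
  have "1 - \<delta> \<le> measure \<Omega> {\<omega> \<in> space \<Omega>. ?\<Phi> \<omega>}"
    by (rule samples_prob_ge[OF E B]) (use good in auto)
  moreover have "{\<omega> \<in> space \<Omega>. ?\<Phi> \<omega>} = {(S, X) \<in> space \<Omega>. learn learner evaluator d n \<epsilon> S X \<noteq> None}"
    by (auto simp: learn_eq[OF \<epsilon> n d])
  ultimately show ?thesis by (simp only:)
qed

lemma fst_event:
  assumes "A \<in> sets TrainM"
  shows "{\<omega> \<in> space (TrainM \<Otimes>\<^sub>M TestM). fst \<omega> \<in> A} \<in> sets (TrainM \<Otimes>\<^sub>M TestM)"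
    and "measure (TrainM \<Otimes>\<^sub>M TestM) {\<omega> \<in> space (TrainM \<Otimes>\<^sub>M TestM). fst \<omega> \<in> A} = measure TrainM A"
  using assms measure_pair_fst[OF prob_space_TrainM prob_space_TestM assms] by measurable

lemma snd_event:
  assumes "A \<in> sets TestM"
  shows "{\<omega> \<in> space (TrainM \<Otimes>\<^sub>M TestM). snd \<omega> \<in> A} \<in> sets (TrainM \<Otimes>\<^sub>M TestM)"
    and "measure (TrainM \<Otimes>\<^sub>M TestM) {\<omega> \<in> space (TrainM \<Otimes>\<^sub>M TestM). snd \<omega> \<in> A} = measure TestM A"
  using assms measure_pair_snd[OF prob_space_TrainM prob_space_TestM assms] by measurable

text \<open>The hypothesis depends on the training sample only, so for each fixed training sample the
  test sample is a fresh sample for it.\<close>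

lemma generalisation:
  assumes n: "hash_cells < n" and \<epsilon>: "0 < \<epsilon>"
  obtains B where "B \<in> sets (TrainM \<Otimes>\<^sub>M TestM)" "measure (TrainM \<Otimes>\<^sub>M TestM) B \<le> 4 / (\<epsilon> * real n)"
    "\<And>x z. x \<in> space TrainM \<Longrightarrow> z \<in> space TestM \<Longrightarrow> (x, z) \<notin> B \<Longrightarrow>
      2 * real (card {j. j < n \<and> answer d n (lab n x) m (z j) \<noteq> f (z j)}) \<le> \<epsilon> * real n \<Longrightarrow>
      err (answer d n (lab n x) m) \<le> \<epsilon>"
proof -
  let ?bad = "\<lambda>\<omega>. \<epsilon> < err (answer d n (fst \<omega>) m) \<and> 2 * real (card {j. j < n \<and> answer d n (fst \<omega>) m (snd \<omega> j) \<noteq> f (snd \<omega> j)}) \<le> \<epsilon> * real n"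
  let ?g = "\<lambda>(x, z). (lab n x, z)"
  have n0: "0 < n" using n by simp
  have 1: "Measurable.pred \<Omega> (\<lambda>\<omega>. \<epsilon> < err (answer d n (fst \<omega>) m))"
    by (intro borel_measurable_pred_less measurable_err(1) n borel_measurable_const)
  have "Measurable.pred \<Omega> (\<lambda>\<omega>. answer d n (fst \<omega>) m (snd \<omega> j) \<noteq> f (snd \<omega> j))" if j: "j < n" for j
  proof -
    have t: "(\<lambda>\<omega>. snd \<omega> j) \<in> \<Omega> \<rightarrow>\<^sub>M D'"
      unfolding samples_def
      by (rule measurable_compose[OF measurable_snd measurable_component_singleton]) (use j in simp)
    have "(\<lambda>\<omega>. (\<omega>, snd \<omega> j)) \<in> \<Omega> \<rightarrow>\<^sub>M \<Omega> \<Otimes>\<^sub>M D'"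
      using t by measurable
    from measurable_compose[OF this measurable_answer[OF n, of m]]
    have "(\<lambda>\<omega>. answer d n (fst \<omega>) m (snd \<omega> j)) \<in> borel_measurable \<Omega>"
      by simp
    from borel_measurable_neq[OF this measurable_compose[OF t f_D']] show ?thesis
      unfolding Measurable.pred_def .
  qed
  then have 2: "Measurable.pred \<Omega> (\<lambda>\<omega>. 2 * real (card {j. j < n \<and> answer d n (fst \<omega>) m (snd \<omega> j) \<noteq> f (snd \<omega> j)}) \<le> \<epsilon> * real n)"
    by (intro pred_le_borel borel_measurable_times borel_measurable_const measurable_card_Collect)
  have bad: "{\<omega> \<in> space \<Omega>. ?bad \<omega>} \<in> sets \<Omega>"
    using pred_intros_logic(3)[OF 1 2] unfolding Measurable.pred_def .
  have [measurable]: "lab n \<in> TrainM \<rightarrow>\<^sub>M PiM {..<n} (\<lambda>_. labelled G f)" by (rule measurable_lab)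
  have g: "?g \<in> TrainM \<Otimes>\<^sub>M TestM \<rightarrow>\<^sub>M \<Omega>"
    unfolding samples_def by measurable
  define B where "B = ?g -` {\<omega> \<in> space \<Omega>. ?bad \<omega>} \<inter> space (TrainM \<Otimes>\<^sub>M TestM)"
  have B: "B \<in> sets (TrainM \<Otimes>\<^sub>M TestM)"
    unfolding B_def by (rule measurable_sets[OF g bad])
  show thesis
  proof
    show "B \<in> sets (TrainM \<Otimes>\<^sub>M TestM)" by (rule B)
    show "measure (TrainM \<Otimes>\<^sub>M TestM) B \<le> 4 / (\<epsilon> * real n)"
    \<comment> \<open>For a fixed training sample the hypothesis is fixed: its slice of
      \<open>B\<close> is empty unless the error exceeds \<open>\<epsilon>\<close>, and in that case
      \<open>PiM_count_le\<close> applies.\<close>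
    proof (rule pair_measure_le[OF prob_space_TrainM prob_space_TestM B])
      fix x assume x: "x \<in> space TrainM"
      let ?h = "answer d n (lab n x) m"
      let ?A = "{y \<in> space D'. ?h y \<noteq> f y}"
      interpret TestM: prob_space TestM by (rule prob_space_TestM)
      have "TestM.prob {} = 0" by simp
      show "measure TestM (Pair x -` B) \<le> 4 / (\<epsilon> * real n)"
      proof (cases "\<epsilon> < err ?h")
        case False
        then have "Pair x -` B = {}" by (auto simp: B_def)
        then show ?thesis using \<epsilon> by simp
      next
        case True
        obtain z0 where "z0 \<in> space TestM" using TestM.not_empty by blast
        from measurable_err(2)[OF n lab_samples_space[OF x this], of m] have A: "?A \<in> sets D'" by simp
        have "measure TestM (Pair x -` B) \<le> measure TestM {z \<in> space TestM. 2 * real (card {j \<in> {..<n}. z j \<in> ?A}) \<le> \<epsilon> * card {..<n}}"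
        proof (rule TestM.finite_measure_mono)
          show "{z \<in> space TestM. 2 * real (card {j \<in> {..<n}. z j \<in> ?A}) \<le> \<epsilon> * card {..<n}} \<in> sets TestM"
            by (intro borel_measurable_le borel_measurable_times borel_measurable_const measurable_card_PiM A) simp
          show "Pair x -` B \<subseteq> {z \<in> space TestM. 2 * real (card {j \<in> {..<n}. z j \<in> ?A}) \<le> \<epsilon> * card {..<n}}"
          proof
            fix z assume z: "z \<in> Pair x -` B"
            then have zQ: "z \<in> space TestM" using x by (simp add: B_def space_pair_measure)
            have "{j \<in> {..<n}. z j \<in> ?A} = {j. j < n \<and> ?h (z j) \<noteq> f (z j)}"
              using space_TestM[OF zQ] by (auto simp: space_D')
            then show "z \<in> {z \<in> space TestM. 2 * real (card {j \<in> {..<n}. z j \<in> ?A}) \<le> \<epsilon> * card {..<n}}"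
              using z zQ by (simp add: B_def)
          qed
        qed
        also have "\<dots> \<le> 4 / (\<epsilon> * card {..<n})"
          using True n0 by (intro PiM_count_le D' A \<epsilon>) (auto simp: err_def)
        finally show ?thesis by simp
      qed
    qed (use \<epsilon> in simp)
    fix x z assume xz: "x \<in> space TrainM" "z \<in> space TestM" "(x, z) \<notin> B"
      "2 * real (card {j. j < n \<and> answer d n (lab n x) m (z j) \<noteq> f (z j)}) \<le> \<epsilon> * real n"
    show "err (answer d n (lab n x) m) \<le> \<epsilon>"
    proof (rule ccontr)
      assume "\<not> err (answer d n (lab n x) m) \<le> \<epsilon>"
      then have "(x, z) \<in> B"
        using xz lab_samples_space[OF xz(1,2)] by (simp add: B_def space_pair_measure)
      then show False using xz(3) by simp
    qed
  qed
qed

end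

end

section \<open>Correctness for small accuracy parameters\<close>

lemma measure_Un_bound:
  assumes "prob_space M" "A \<in> sets M" "B \<in> sets M" "measure M A \<le> a" "measure M B \<le> b"
  shows "A \<union> B \<in> sets M" "measure M (A \<union> B) \<le> a + b"
  using assms measure_Un_le[of A M B] by auto

context halfspace_learning
begin

lemma chow_lab: "chow n (lab n x) = sample_chow x"
  by (auto simp: chow_def sample_chow_def lab_def fun_eq_iff intro!: sum.cong)

lemma offset_lab: "offset d n (lab n x) = sample_offset x"
  by (auto simp: offset_def sample_offset_def lab_def excess_def intro!: sum.cong)

lemma mmd_lab: "mmd d k n (\<lambda>i. fst (lab n x i)) z = mmd d k n x z"
  by (auto simp: mmd_def lab_def intro!: sum.cong)

lemma space_train: "x \<in> space P \<Longrightarrow> i < n \<Longrightarrow> x i \<in> space G"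
  by (auto simp: space_PiM PiE_iff)

lemma negative_lab:
  assumes "x \<in> space P"
  shows "{i. i < n \<and> snd (lab n x i) < 0} = {i \<in> {..<n}. x i \<in> {y \<in> space G. f y \<noteq> 1}}"
    and "{i. i < n \<and> \<not> snd (lab n x i) < 0} = {i \<in> {..<n}. x i \<in> {y \<in> space G. f y \<noteq> -1}}"
  using space_train[OF assms] by (auto simp: lab_def f_eq split: if_splits)

definition rate :: real where "rate = (1 / 16384) ^ k"

lemma rate_pos: "0 < rate" by (simp add: rate_def)

lemma outcome_lab:
  assumes "x \<in> space P"
  shows "outcome d n \<epsilon> (lab n x) z =
    (if 2 * real (card {j. j < n \<and> flagged d n (sample_chow x) (sample_offset x) (z j)}) \<le> \<epsilon> * real n then 1
     else if mmd d k n x z \<le> (real n)\<^sup>2 then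
       if real (card {i \<in> {..<n}. x i \<in> {y \<in> space G. f y \<noteq> 1}}) \<le> rate * real n then 2
       else if real (card {i \<in> {..<n}. x i \<in> {y \<in> space G. f y \<noteq> -1}}) \<le> rate * real n then 3
       else 0
     else 0)"
  unfolding outcome_def chow_lab offset_lab mmd_lab negative_lab[OF assms] rate_def using \<epsilon> by simp

text \<open>The training sample shows few labels other than \<open>b\<close> although these have
  mass above \<open>2 * rate\<close>. The case distinction is on the distribution and not on the
  sample, so a single Chebyshev bound covers the event.\<close>

definition misleading :: "real \<Rightarrow> (nat \<Rightarrow> nat \<Rightarrow> real) set" where
  "misleading b = (if 2 * rate < measure G {y \<in> space G. f y \<noteq> b}
    then {x \<in> space P. 2 * real (card {i \<in> {..<n}. x i \<in> {y \<in> space G. f y \<noteq> b}}) \<le> 2 * rate * card {..<n}} else {})"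

lemma misleading: "misleading b \<in> sets P" "measure P (misleading b) \<le> 1 / 1000"
proof -
  show "misleading b \<in> sets P"
    unfolding misleading_def
    by (auto intro!: borel_measurable_le borel_measurable_times measurable_card_PiM[unfolded Collect_conj_eq] simp del: card_lessThan)
  have "measure P {x \<in> space P. 2 * real (card {i \<in> {..<n}. x i \<in> {y \<in> space G. f y \<noteq> b}}) \<le> 2 * rate * card {..<n}} \<le> 4 / (2 * rate * card {..<n})"
    if "2 * rate < measure G {y \<in> space G. f y \<noteq> b}"
    using that n_pos rate_pos by (intro PiM_count_le G.prob_space_axioms sets_f) auto
  then show "measure P (misleading b) \<le> 1 / 1000"
    using rate_n by (auto simp: misleading_def rate_def)
qed

lemma not_misleading:
  assumes "x \<in> space P" "x \<notin> misleading b"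
    "real (card {i \<in> {..<n}. x i \<in> {y \<in> space G. f y \<noteq> b}}) \<le> rate * real n"
  shows "measure G {y \<in> space G. f y \<noteq> b} \<le> 2 * (1 / 16384) ^ k"
  using assms by (auto simp: misleading_def rate_def split: if_splits)

definition atypical :: "(nat \<Rightarrow> nat \<Rightarrow> real) set" where
  "atypical = {x \<in> space P. 18000 * real n * (real d)\<^sup>2 < chow_error n x} \<union>
    ({x \<in> space P. 1000 * real n * (2 * real k) ^ k < (\<Sum>i<n. lin (x i) ^ (2 * k))} \<union>
     (misleading 1 \<union> misleading (-1)))"

lemma atypical: "atypical \<in> sets P" "measure P atypical \<le> 4 / 1000"
proof -
  note m = measure_Un_bound[OF P.prob_space_axioms misleading(1)[of 1] misleading(1)[of "-1"] misleading(2) misleading(2)]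
  have t: "{x \<in> space P. 1000 * real n * (2 * real k) ^ k < (\<Sum>i<n. lin (x i) ^ (2 * k))} \<in> sets P"
    by (intro borel_measurable_less borel_measurable_const train_moment_bound(1))
  note m2 = measure_Un_bound[OF P.prob_space_axioms t m(1) train_moment_bound(2) m(2)]
  have c: "{x \<in> space P. 18000 * real n * (real d)\<^sup>2 < chow_error n x} \<in> sets P"
    by (intro borel_measurable_less borel_measurable_const chow_error_bound(1) n_pos)
  note m3 = measure_Un_bound[OF P.prob_space_axioms c m2(1) chow_error_bound(2)[OF n_pos] m2(2)]
  show "atypical \<in> sets P" unfolding atypical_def by (rule m3(1))
  show "measure P atypical \<le> 4 / 1000"
    unfolding atypical_def by (rule order_trans[OF m3(2)]) simp
qed

text \<open>The failure budget is 4/1000 for an atypical training sample and 1/1000 for each of the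
  three possible answers. All three events are excluded because the answer is selected after seeing
  the test sample.\<close>

lemma sound_small:
  assumes D': "prob_space D'" "sets D' = sets G" and n: "hash_tests \<le> n" "hash_cells < n"
  shows "\<P>((S, X) in samples n G D' f. \<forall>h. learn learner evaluator d n \<epsilon> S X = Some h \<longrightarrow>
            {x \<in> space D'. h x \<noteq> f x} \<in> sets D' \<and> \<P>(x in D'. h x \<noteq> f x) \<le> \<epsilon>) \<ge> 1 - 1 / 100"
proof -
  let ?Q = "PiM {..<n} (\<lambda>_. D')"
  let ?err = "halfspace.err d v \<tau> D'"
  interpret Q: prob_space ?Q by (intro prob_space_PiM D')
  interpret PQ: pair_prob_space P ?Q ..
  define Good where "Good m B \<longleftrightarrow> B \<in> sets (P \<Otimes>\<^sub>M ?Q) \<and> measure (P \<Otimes>\<^sub>M ?Q) B \<le> 1 / 1000 \<and>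
    (\<forall>x z. x \<in> space P \<longrightarrow> z \<in> space ?Q \<longrightarrow> (x, z) \<notin> B \<longrightarrow>
      2 * real (card {j. j < n \<and> answer d n (lab n x) m (z j) \<noteq> f (z j)}) \<le> \<epsilon> * real n \<longrightarrow>
      ?err (answer d n (lab n x) m) \<le> \<epsilon>)" for m B
  have "\<exists>B. Good m B" for m
  proof -
    obtain B where "B \<in> sets (P \<Otimes>\<^sub>M ?Q)" and le: "measure (P \<Otimes>\<^sub>M ?Q) B \<le> 4 / (\<epsilon> * real n)"
      and "\<And>x z. x \<in> space P \<Longrightarrow> z \<in> space ?Q \<Longrightarrow> (x, z) \<notin> B \<Longrightarrow>
        2 * real (card {j. j < n \<and> answer d n (lab n x) m (z j) \<noteq> f (z j)}) \<le> \<epsilon> * real n \<Longrightarrow>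
        ?err (answer d n (lab n x) m) \<le> \<epsilon>"
      by (rule generalisation[OF D' n(2) \<epsilon>(1), of m]) blast
    then have "Good m B"
      unfolding Good_def using order_trans[OF le eps_n] by simp
    then show ?thesis ..
  qed
  then obtain B where B: "\<And>m. Good m (B m)" by metis
  let ?A = "{\<omega> \<in> space (P \<Otimes>\<^sub>M ?Q). fst \<omega> \<in> atypical}"
  have A: "?A \<in> sets (P \<Otimes>\<^sub>M ?Q)" "measure (P \<Otimes>\<^sub>M ?Q) ?A \<le> 4 / 1000"
    using fst_event[OF D', of atypical n] atypical by auto
  have Bm: "B m \<in> sets (P \<Otimes>\<^sub>M ?Q)" "measure (P \<Otimes>\<^sub>M ?Q) (B m) \<le> 1 / 1000" for m
    using B[of m] by (auto simp: Good_def)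
  note u1 = measure_Un_bound[OF PQ.prob_space_axioms Bm(1)[of 1] Bm(1)[of 2] Bm(2) Bm(2)]
  note u2 = measure_Un_bound[OF PQ.prob_space_axioms Bm(1)[of 3] u1(1) Bm(2) u1(2)]
  note u3 = measure_Un_bound[OF PQ.prob_space_axioms A(1) u2(1) A(2) u2(2)]
  show ?thesis
  proof (rule soundness[OF D' n \<epsilon>(1)])
    show "?A \<union> (B 3 \<union> (B 1 \<union> B 2)) \<in> sets (P \<Otimes>\<^sub>M ?Q)"
      "measure (P \<Otimes>\<^sub>M ?Q) (?A \<union> (B 3 \<union> (B 1 \<union> B 2))) \<le> 1 / 100"
      by (rule u3(1), rule order_trans[OF u3(2)]) simp
    fix x z assume x: "x \<in> space P" and z: "z \<in> space ?Q" and nB: "(x, z) \<notin> ?A \<union> (B 3 \<union> (B 1 \<union> B 2))"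
      and nz: "outcome d n \<epsilon> (lab n x) z \<noteq> 0"
    let ?m = "outcome d n \<epsilon> (lab n x) z"
    have typical: "x \<notin> atypical" using nB x z by (auto simp: space_pair_measure)
    have chow: "chow_error n x \<le> 18000 * real n * (real d)\<^sup>2"
      and train: "(\<Sum>i<n. lin (x i) ^ (2 * k)) \<le> 1000 * real n * (2 * real k) ^ k"
      and mis: "x \<notin> misleading 1" "x \<notin> misleading (-1)"
      using typical x by (auto simp: atypical_def)
    have m: "?m = 1 \<or> ?m = 2 \<or> ?m = 3"
      using nz unfolding outcome_lab[OF x] by (simp split: if_splits)
    have "2 * real (card {j. j < n \<and> answer d n (lab n x) ?m (z j) \<noteq> f (z j)}) \<le> \<epsilon> * real n"
    proof -
      \<comment> \<open>The two constant answers are treated together; \<open>b\<close> is the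
        constant, and the learner's conditions supply the small discrepancy and the scarcity of the
        other label.\<close>
      consider "?m = 1" | b where "b \<in> {-1, 1}" "?m \<noteq> 1" "\<And>y. answer d n (lab n x) ?m y = b"
          "mmd d k n x z \<le> (real n)\<^sup>2" "real (card {i \<in> {..<n}. x i \<in> {y \<in> space G. f y \<noteq> b}}) \<le> rate * real n"
      proof (cases "?m = 1")
        case False
        then consider "?m = 2" | "?m = 3" using m by blast
        then show ?thesis
        proof cases
          case 1
          show ?thesis
            by (rule that(2)[of 1]) (use 1 in \<open>simp_all add: answer_def outcome_lab[OF x] split: if_splits\<close>)
        next
          case 2
          show ?thesis
            by (rule that(2)[of "-1"]) (use 2 in \<open>simp_all add: answer_def outcome_lab[OF x] split: if_splits\<close>)
        qed
      qed
      then show ?thesis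
      proof cases
        case 1
        \<comment> \<open>Disagreements on the test sample are invisible, but they lie among the
          flagged points, which the learner has counted.\<close>
        have "{j. j < n \<and> answer d n (lab n x) 1 (z j) \<noteq> f (z j)} \<subseteq> {j. j < n \<and> flagged d n (sample_chow x) (sample_offset x) (z j)}"
          using disagreement_flagged[OF chow] by (auto simp: answer_def chow_lab offset_lab)
        then have "card {j. j < n \<and> answer d n (lab n x) 1 (z j) \<noteq> f (z j)} \<le> card {j. j < n \<and> flagged d n (sample_chow x) (sample_offset x) (z j)}"
          by (intro card_mono) auto
        moreover have "2 * real (card {j. j < n \<and> flagged d n (sample_chow x) (sample_offset x) (z j)}) \<le> \<epsilon> * real n"
          using 1 unfolding outcome_lab[OF x] by (simp split: if_splits)
        ultimately show ?thesis
          unfolding 1 by linarith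
      next
        case (2 b)
        have "x \<notin> misleading b" using mis 2(1) by auto
        from not_misleading[OF x this 2(5)]
        have rare: "measure G {y \<in> space G. f y \<noteq> b} \<le> 2 * (1 / 16384) ^ k" .
        show ?thesis
        proof (rule moment_count[OF 2(4) train])
          fix j assume "j \<in> {j. j < n \<and> answer d n (lab n x) ?m (z j) \<noteq> f (z j)}"
          then have "f (z j) \<noteq> b" using 2(3) by auto
          then show "4 * real k \<le> (lin (z j))\<^sup>2"
            using rare_label_threshold[OF _ rare 2(1)] k_ge by simp
        qed auto
      qed
    qed
    moreover have "(x, z) \<notin> B ?m" using m nB by auto
    ultimately show "?err (answer d n (lab n x) ?m) \<le> \<epsilon>"
      using B[of ?m] x z unfolding Good_def by blast
  qed
qed

text \<open>The value 64k splits the analysis, not the algorithm. Below it the flag count passes;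
  above it, should the flag count fail, the discrepancy and one of the label counts pass.\<close>

lemma complete_small:
  assumes n: "hash_tests \<le> n" "hash_cells < n"
  shows "\<P>((S, X) in samples n G G f. learn learner evaluator d n \<epsilon> S X \<noteq> None) \<ge> 1 - 1 / 100"
proof -
  interpret PP: pair_prob_space P P ..
  note D' = G.prob_space_axioms refl[of "sets G"]
  show ?thesis
  proof (cases "\<tau>\<^sup>2 \<le> 64 * real k")
    case True
    let ?A = "{x \<in> space P. 18000 * real n * (real d)\<^sup>2 < chow_error n x}"
    let ?N = "{z \<in> space P. \<epsilon> * real n / 2 < real (card {j \<in> {..<n}. z j \<in> near})}"
    have A: "?A \<in> sets P"
      by (intro borel_measurable_less borel_measurable_const chow_error_bound(1) n_pos)
    have N: "?N \<in> sets P"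
      by (intro borel_measurable_less borel_measurable_const measurable_card_PiM sets_near) simp
    have "measure P ?N \<le> card {..<n} * measure G near / (\<epsilon> * real n / 2)"
      using \<epsilon> n_pos by (intro PiM_count_gt G.prob_space_axioms sets_near) auto
    also have "\<dots> \<le> real n * (\<epsilon> / 2000) / (\<epsilon> * real n / 2)"
      using near_prob \<epsilon> by (intro divide_right_mono mult_mono) auto
    also have "\<dots> = 1 / 1000"
      using \<epsilon> n_pos by (simp add: field_simps)
    finally have Nle: "measure P ?N \<le> 1 / 1000" .
    note a = fst_event[OF D' A] and b = snd_event[OF D' N]
    note u = measure_Un_bound[OF PP.prob_space_axioms a(1) b(1), unfolded a(2) b(2), OF chow_error_bound(2)[OF n_pos] Nle]
    show ?thesis
    proof (rule completeness[OF D' n \<epsilon>(1)])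
      show "{\<omega> \<in> space (P \<Otimes>\<^sub>M P). fst \<omega> \<in> ?A} \<union> {\<omega> \<in> space (P \<Otimes>\<^sub>M P). snd \<omega> \<in> ?N} \<in> sets (P \<Otimes>\<^sub>M P)"
        "measure (P \<Otimes>\<^sub>M P) ({\<omega> \<in> space (P \<Otimes>\<^sub>M P). fst \<omega> \<in> ?A} \<union> {\<omega> \<in> space (P \<Otimes>\<^sub>M P). snd \<omega> \<in> ?N}) \<le> 1 / 100"
        by (rule u(1), rule order_trans[OF u(2)]) simp
      fix x z assume x: "x \<in> space P" and z: "z \<in> space P"
        and nB: "(x, z) \<notin> {\<omega> \<in> space (P \<Otimes>\<^sub>M P). fst \<omega> \<in> ?A} \<union> {\<omega> \<in> space (P \<Otimes>\<^sub>M P). snd \<omega> \<in> ?N}"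
      have chow: "chow_error n x \<le> 18000 * real n * (real d)\<^sup>2"
        and few: "2 * real (card {j \<in> {..<n}. z j \<in> near}) \<le> \<epsilon> * real n"
        using nB x z by (auto simp: space_pair_measure)
      have "{j. j < n \<and> flagged d n (sample_chow x) (sample_offset x) (z j)} \<subseteq> {j \<in> {..<n}. z j \<in> near}"
        using flagged_near[OF chow True space_train[OF z]] by auto
      then have "card {j. j < n \<and> flagged d n (sample_chow x) (sample_offset x) (z j)} \<le> card {j \<in> {..<n}. z j \<in> near}"
        by (intro card_mono) auto
      then have "2 * real (card {j. j < n \<and> flagged d n (sample_chow x) (sample_offset x) (z j)}) \<le> \<epsilon> * real n"
        using few by linarith
      then show "outcome d n \<epsilon> (lab n x) z \<noteq> 0"
        unfolding outcome_lab[OF x] by simp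
    qed
  next
    case False
    define b :: real where "b = (if 0 < \<tau> then -1 else 1)"
    let ?L = "{x \<in> space P. rate * real n < real (card {i \<in> {..<n}. x i \<in> {y \<in> space G. f y \<noteq> b}})}"
    let ?T = "{x \<in> space P. (real n)\<^sup>2 * (2 * real k) ^ (2 * k) / 4 < tensor_error x}"
    have L: "?L \<in> sets P"
      by (intro borel_measurable_less borel_measurable_const measurable_card_PiM sets_f) simp
    have T: "?T \<in> sets P"
      by (intro borel_measurable_less borel_measurable_const tensor_error_bound(1))
    have "measure P ?L \<le> card {..<n} * measure G {y \<in> space G. f y \<noteq> b} / (rate * real n)"
      using rate_pos n_pos by (intro PiM_count_gt G.prob_space_axioms sets_f) auto
    also have "\<dots> \<le> real n * (rate / 1000) / (rate * real n)"
      using large_threshold_rare_label[OF k_ge] False rate_pos unfolding rate_def[symmetric]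
      by (intro divide_right_mono mult_mono) (auto simp: b_def)
    also have "\<dots> = 1 / 1000"
      using rate_pos n_pos by (simp add: field_simps)
    finally have Lle: "measure P ?L \<le> 1 / 1000" .
    note l = fst_event[OF D' L] and t1 = fst_event[OF D' T] and t2 = snd_event[OF D' T]
    note u1 = measure_Un_bound[OF PP.prob_space_axioms t1(1) t2(1), unfolded t1(2) t2(2), OF tensor_error_bound(2) tensor_error_bound(2)]
    note u2 = measure_Un_bound[OF PP.prob_space_axioms l(1) u1(1), unfolded l(2), OF Lle u1(2)]
    let ?B = "{\<omega> \<in> space (P \<Otimes>\<^sub>M P). fst \<omega> \<in> ?L} \<union> ({\<omega> \<in> space (P \<Otimes>\<^sub>M P). fst \<omega> \<in> ?T} \<union> {\<omega> \<in> space (P \<Otimes>\<^sub>M P). snd \<omega> \<in> ?T})"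
    show ?thesis
    proof (rule completeness[OF D' n \<epsilon>(1)])
      show "?B \<in> sets (P \<Otimes>\<^sub>M P)" "measure (P \<Otimes>\<^sub>M P) ?B \<le> 1 / 100"
        by (rule u2(1), rule order_trans[OF u2(2)]) simp
      fix x z assume x: "x \<in> space P" and z: "z \<in> space P" and nB: "(x, z) \<notin> ?B"
      have few: "real (card {i \<in> {..<n}. x i \<in> {y \<in> space G. f y \<noteq> b}}) \<le> rate * real n"
        and "tensor_error x \<le> (real n)\<^sup>2 * (2 * real k) ^ (2 * k) / 4"
        and "tensor_error z \<le> (real n)\<^sup>2 * (2 * real k) ^ (2 * k) / 4"
        using nB x z by (auto simp: space_pair_measure not_less)
      then have "mmd d k n x z \<le> (real n)\<^sup>2"
        by (intro mmd_le_of_tensor_error)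
      then show "outcome d n \<epsilon> (lab n x) z \<noteq> 0"
        using few unfolding outcome_lab[OF x] by (cases "0 < \<tau>") (simp_all add: b_def)
    qed
  qed
qed

end

section \<open>Random cells for large accuracy parameters\<close>

text \<open>Only a fixed number of the test points is inspected; the marginal on these coordinates
  is again a product measure.\<close>

lemma PiM_count_le_subset:
  assumes M: "prob_space M" and I: "finite I" "J \<subseteq> I" "J \<noteq> {}" and A: "A \<in> sets M"
    and \<epsilon>: "0 < \<epsilon>" "\<epsilon> < measure M A"
  shows "measure (PiM I (\<lambda>_. M)) {\<omega> \<in> space (PiM I (\<lambda>_. M)). 2 * real (card {i \<in> J. \<omega> i \<in> A}) \<le> \<epsilon> * card J}
    \<le> 4 / (\<epsilon> * card J)"
    and "{\<omega> \<in> space (PiM I (\<lambda>_. M)). 2 * real (card {i \<in> J. \<omega> i \<in> A}) \<le> \<epsilon> * card J} \<in> sets (PiM I (\<lambda>_. M))"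
proof -
  let ?r = "\<lambda>\<omega>. \<lambda>i\<in>J. \<omega> i"
  let ?E = "{\<omega> \<in> space (PiM J (\<lambda>_. M)). 2 * real (card {i \<in> J. \<omega> i \<in> A}) \<le> \<epsilon> * card J}"
  have fJ: "finite J" using I finite_subset by blast
  have r: "?r \<in> PiM I (\<lambda>_. M) \<rightarrow>\<^sub>M PiM J (\<lambda>_. M)"
    by (rule measurable_restrict) (use I in auto)
  have d: "distr (PiM I (\<lambda>_. M)) (PiM J (\<lambda>_. M)) ?r = PiM J (\<lambda>_. M)"
    using distr_PiM_reindex[of I "\<lambda>_. M" "\<lambda>i. i" J] M I by auto
  have E: "?E \<in> sets (PiM J (\<lambda>_. M))"
    by (intro borel_measurable_le borel_measurable_times borel_measurable_const measurable_card_PiM fJ A)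
  have eq: "{\<omega> \<in> space (PiM I (\<lambda>_. M)). 2 * real (card {i \<in> J. \<omega> i \<in> A}) \<le> \<epsilon> * card J} = ?r -` ?E \<inter> space (PiM I (\<lambda>_. M))"
    using measurable_space[OF r] by (auto cong: conj_cong)
  show "{\<omega> \<in> space (PiM I (\<lambda>_. M)). 2 * real (card {i \<in> J. \<omega> i \<in> A}) \<le> \<epsilon> * card J} \<in> sets (PiM I (\<lambda>_. M))"
    unfolding eq by (rule measurable_sets[OF r E])
  have "measure (PiM I (\<lambda>_. M)) (?r -` ?E \<inter> space (PiM I (\<lambda>_. M))) = measure (PiM J (\<lambda>_. M)) ?E"
    using measure_distr[OF r, of ?E] E d by simp
  then show "measure (PiM I (\<lambda>_. M)) {\<omega> \<in> space (PiM I (\<lambda>_. M)). 2 * real (card {i \<in> J. \<omega> i \<in> A}) \<le> \<epsilon> * card J}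
    \<le> 4 / (\<epsilon> * card J)"
    unfolding eq using PiM_count_le[OF M fJ I(3) A \<epsilon>] by simp
qed

lemma PiM_pair_prob:
  assumes M: "prob_space M" and ij: "i \<in> I" "j \<in> I" "i \<noteq> j" and A: "A \<in> sets M"
  shows "{\<omega> \<in> space (PiM I (\<lambda>_. M)). \<omega> i \<in> A \<and> \<omega> j \<in> A} \<in> sets (PiM I (\<lambda>_. M))"
    and "measure (PiM I (\<lambda>_. M)) {\<omega> \<in> space (PiM I (\<lambda>_. M)). \<omega> i \<in> A \<and> \<omega> j \<in> A} = (measure M A)\<^sup>2"
proof -
  interpret prob_space M by (rule M)
  have eq: "{\<omega> \<in> space (PiM I (\<lambda>_. M)). \<omega> i \<in> A \<and> \<omega> j \<in> A} = prod_emb I (\<lambda>_. M) {i, j} (PiE {i, j} (\<lambda>_. A))"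
    by (auto simp: prod_emb_def space_PiM PiE_iff extensional_def)
  show "{\<omega> \<in> space (PiM I (\<lambda>_. M)). \<omega> i \<in> A \<and> \<omega> j \<in> A} \<in> sets (PiM I (\<lambda>_. M))"
    unfolding eq by (rule sets_PiM_I) (use ij A in auto)
  have "emeasure (PiM I (\<lambda>_. M)) (prod_emb I (\<lambda>_. M) {i, j} (PiE {i, j} (\<lambda>_. A))) = (\<Prod>k\<in>{i, j}. emeasure M A)"
    by (rule emeasure_PiM_emb) (use ij A M in auto)
  then show "measure (PiM I (\<lambda>_. M)) {\<omega> \<in> space (PiM I (\<lambda>_. M)). \<omega> i \<in> A \<and> \<omega> j \<in> A} = (measure M A)\<^sup>2"
    unfolding eq using ij(3) by (simp add: measure_def enn2real_mult power2_eq_square)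
qed

lemma down_closed_eq_lessThan:
  fixes S :: "nat set"
  assumes fin: "finite S" and down: "\<And>i j. i \<in> S \<Longrightarrow> j \<le> i \<Longrightarrow> j \<in> S"
  shows "S = {..<card S}"
proof (cases "S = {}")
  case False
  have "S = {..Max S}"
  proof (intro set_eqI iffI)
    fix j assume "j \<in> {..Max S}"
    then show "j \<in> S" using down[OF Max_in[OF fin False]] by simp
  qed (use Max_ge[OF fin] in simp)
  then show ?thesis
    by (metis card_atMost lessThan_Suc_atMost)
qed simp

text \<open>Thresholds increase with their index, so those below t form an initial segment;
  comparing t with a threshold becomes comparing the index with \<open>cell t\<close>.\<close>

lemma cell_set: "{k. k < hash_cells \<and> real k / real hash_width - real hash_width < t} = {..<cell t}"
  unfolding cell_def
proof (rule down_closed_eq_lessThan)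
  fix i j assume i: "i \<in> {k. k < hash_cells \<and> real k / real hash_width - real hash_width < t}" and "j \<le> i"
  then have "real j / real hash_width \<le> real i / real hash_width"
    by (intro divide_right_mono) auto
  then show "j \<in> {k. k < hash_cells \<and> real k / real hash_width - real hash_width < t}"
    using i \<open>j \<le> i\<close> by simp
qed simp

context halfspace
begin

lemma coordinate_distributed: "distributed G lborel (\<lambda>x. x 0) std_normal_density"
  unfolding G_eq by (rule distributed_gaussian_component) (use d2 in simp)

text \<open>A bounded cell lies in an interval of length \<open>1 / hash_width\<close> on which the
  density is at most 1/2; for the two unbounded cells a second-moment bound of
  \<open>2 / hash_width\<^sup>2\<close> suffices.\<close>

lemma cell_prob: "measure G {x \<in> space G. cell (x 0) = j} \<le> 1 / real hash_width"
proof -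
  have W: "2 \<le> real hash_width" by (simp add: hash_width_def)
  have d0: "0 < d" using d2 by simp
  note [measurable] = measurable_coordinate[OF d0]
  have tail: "measure G {x \<in> space G. cell (x 0) = j} \<le> 1 / real hash_width"
    if "\<And>t. cell t = j \<Longrightarrow> (real hash_width)\<^sup>2 \<le> t\<^sup>2"
  proof -
    note m = distributed_std_normal_moment[OF coordinate_distributed, of 1]
    have W2: "0 < (real hash_width)\<^sup>2" using W by simp
    have "measure G {x \<in> space G. cell (x 0) = j} \<le> measure G {x \<in> space G. (x 0) ^ (2 * 1) \<ge> (real hash_width)\<^sup>2}"
      by (rule G.finite_measure_mono) (use that in auto)
    also have "\<dots> \<le> (\<integral>x. (x 0) ^ (2 * 1) \<partial>G) / (real hash_width)\<^sup>2"
      by (rule integral_Markov_inequality_measure[OF m(1) sets.empty_sets _ W2]) auto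
    also have "\<dots> \<le> 2 / (real hash_width)\<^sup>2"
      using m(2) by (intro divide_right_mono) auto
    also have "\<dots> \<le> 1 / real hash_width"
      using W by (simp add: power2_eq_square field_simps)
    finally show ?thesis .
  qed
  have mem: "k < hash_cells \<and> real k / real hash_width - real hash_width < t \<longleftrightarrow> k < cell t" for k t
    using cell_set[of t] by (auto simp: set_eq_iff)
  consider "j = 0" | "hash_cells \<le> j" | "0 < j" "j < hash_cells" by linarith
  then show ?thesis
  proof cases
    case 1
    have c0: "0 < hash_cells" by (simp add: hash_cells_def)
    show ?thesis
    proof (rule tail)
      fix t assume "cell t = j"
      then have "t \<le> - real hash_width"
        using mem[of 0 t] 1 c0 by auto
      then have "(real hash_width)\<^sup>2 \<le> (- t)\<^sup>2"
        by (intro power_mono) auto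
      then show "(real hash_width)\<^sup>2 \<le> t\<^sup>2" by simp
    qed
  next
    case 2
    show ?thesis
    proof (rule tail)
      fix t assume "cell t = j"
      then have "2 * hash_width\<^sup>2 < cell t" using 2 by (simp add: hash_cells_def)
      then have "real (2 * hash_width\<^sup>2) / real hash_width - real hash_width < t"
        using mem[of "2 * hash_width\<^sup>2" t] by simp
      moreover have "real (2 * hash_width\<^sup>2) / real hash_width - real hash_width = real hash_width"
        using W by (simp add: power2_eq_square)
      ultimately show "(real hash_width)\<^sup>2 \<le> t\<^sup>2"
        by (intro power_mono) auto
    qed
  next
    case 3
    define a where "a = real (j - 1) / real hash_width - real hash_width"
    define b where "b = real j / real hash_width - real hash_width"
    have ba: "b - a = 1 / real hash_width"
      using 3 W by (simp add: a_def b_def of_nat_diff field_simps)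
    have ab: "a \<le> b" using ba W by (smt (verit) divide_nonneg_nonneg)
    have "measure G {x \<in> space G. cell (x 0) = j} \<le> measure G {x \<in> space G. a \<le> x 0 \<and> x 0 \<le> b}"
    proof (rule G.finite_measure_mono)
      show "{x \<in> space G. cell (x 0) = j} \<subseteq> {x \<in> space G. a \<le> x 0 \<and> x 0 \<le> b}"
      proof safe
        fix x :: "nat \<Rightarrow> real" assume c: "j = cell (x 0)"
        show "a \<le> x 0" using mem[of "j - 1" "x 0"] c 3 by (simp add: a_def)
        show "x 0 \<le> b" using mem[of j "x 0"] c 3 by (simp add: b_def)
      qed
    qed measurable
    also have "\<dots> \<le> 1 / 2 * (b - a)"
      by (rule distributed_std_normal_interval(1)[OF G.prob_space_axioms coordinate_distributed ab]) (rule std_normal_density_le_half)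
    also have "\<dots> \<le> 1 / real hash_width"
      using W by (simp add: ba field_simps)
    finally show ?thesis .
  qed
qed

lemma sign_mean: "(\<integral>x. sgn_pm (x 0) \<partial>G) = 0"
proof -
  have sb: "sgn_pm \<in> borel_measurable borel"
    unfolding sgn_pm_def[abs_def] by measurable
  then have m: "sgn_pm \<in> borel_measurable lborel"
    by simp
  have um: "(\<lambda>x::real. - x) \<in> borel_measurable lborel"
    by simp
  define c where "c = (\<integral>x. std_normal_density x * sgn_pm x \<partial>lborel)"
  have "c = \<bar>-1::real\<bar> *\<^sub>R (\<integral>x. std_normal_density (0 + (-1) * x) * sgn_pm (0 + (-1) * x) \<partial>lborel)"
    unfolding c_def by (rule lborel_integral_real_affine) simp
  also have "\<dots> = (\<integral>x. std_normal_density x * sgn_pm (- x) \<partial>lborel)"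
    by (simp add: std_normal_density_def)
  also have "\<dots> = (\<integral>x. - (std_normal_density x * sgn_pm x) \<partial>lborel)"
  proof (rule integral_cong_AE)
    \<comment> \<open>\<open>sgn_pm\<close> is odd except at 0, which is a null set.\<close>
    show "AE x in lborel. std_normal_density x * sgn_pm (- x) = - (std_normal_density x * sgn_pm x)"
      using AE_lborel_singleton[of 0] by eventually_elim (auto simp: sgn_pm_def)
  qed (intro borel_measurable_times borel_measurable_uminus measurable_compose[OF um sb] m; simp)+
  also have "\<dots> = - c" by (simp add: c_def)
  finally have "c = 0" by simp
  then show ?thesis
    using distributed_integral[OF coordinate_distributed m] by (simp add: c_def)
qed

text \<open>The variance is the sum of the squares of \<open>a j\<close>, at most a quarter of the
  sum of squares of \<open>\<mu> j\<close>, hence at most a quarter of the largest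
  \<open>\<mu> j\<close>. Chebyshev's inequality at 1/4 multiplies the resulting 1/4000 by
  16.\<close>

lemma sign_deviation:
  assumes M: "hash_cells < n" and a: "\<And>j. \<bar>a j\<bar> \<le> \<mu> j / 2" "\<And>j. 0 \<le> \<mu> j" "\<And>j. \<mu> j \<le> 1 / 1000"
    and sum: "(\<Sum>j\<le>hash_cells. \<mu> j) = 1"
  shows "{x \<in> space (PiM {..<n} (\<lambda>_. G)). 1 / 4 \<le> \<bar>\<Sum>j\<le>hash_cells. sgn_pm (x j 0) * a j\<bar>} \<in> sets (PiM {..<n} (\<lambda>_. G))"
    and "measure (PiM {..<n} (\<lambda>_. G)) {x \<in> space (PiM {..<n} (\<lambda>_. G)). 1 / 4 \<le> \<bar>\<Sum>j\<le>hash_cells. sgn_pm (x j 0) * a j\<bar>} \<le> 4 / 1000"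
proof -
  let ?P = "PiM {..<n} (\<lambda>_. G)"
  interpret P: prob_space ?P by (intro prob_space_PiM G.prob_space_axioms)
  have d0: "0 < d" using d2 by simp
  note [measurable] = measurable_coordinate[OF d0]
  have m: "(\<lambda>x. sgn_pm (x 0)) \<in> borel_measurable G"
    unfolding sgn_pm_def by measurable
  define g where "g j x = (if j \<le> hash_cells then a j else 0) * sgn_pm (x 0)" for j and x :: "nat \<Rightarrow> real"
  have sq: "(g j x)\<^sup>2 = (if j \<le> hash_cells then (a j)\<^sup>2 else 0)" for j x
    by (simp add: g_def power_mult_distrib sgn_pm_def)
  note S = PiM_sum_square[OF G.prob_space_axioms, of "{..<n}" g]
  have S1: "integrable ?P (\<lambda>x. (\<Sum>j<n. g j (x j))\<^sup>2)"
    and S2: "(\<integral>x. (\<Sum>j<n. g j (x j))\<^sup>2 \<partial>?P) = (\<Sum>j<n. if j \<le> hash_cells then (a j)\<^sup>2 else 0)"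
  proof -
    have g: "g j \<in> borel_measurable G" "integral\<^sup>L G (g j) = 0" for j
      using m by (simp_all add: g_def[abs_def] sign_mean)
    have i: "integrable G (\<lambda>x. (g j x)\<^sup>2)" for j
      unfolding sq by simp
    show "integrable ?P (\<lambda>x. (\<Sum>j<n. g j (x j))\<^sup>2)"
      by (rule S(1)[OF finite_lessThan g(1) i g(2)])
    show "(\<integral>x. (\<Sum>j<n. g j (x j))\<^sup>2 \<partial>?P) = (\<Sum>j<n. if j \<le> hash_cells then (a j)\<^sup>2 else 0)"
      using S(2)[OF finite_lessThan g(1) i g(2)] by (simp add: sq G.prob_space)
  qed
  have eq: "(\<Sum>j<n. g j (x j)) = (\<Sum>j\<le>hash_cells. sgn_pm (x j 0) * a j)" for x
    unfolding g_def using M by (intro sum.mono_neutral_cong_right) auto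
  have "(\<Sum>j<n. if j \<le> hash_cells then (a j)\<^sup>2 else 0) = (\<Sum>j\<le>hash_cells. (a j)\<^sup>2)"
    using M by (intro sum.mono_neutral_cong_right) auto
  also have "\<dots> \<le> (\<Sum>j\<le>hash_cells. 1 / 4000 * \<mu> j)"
  proof (rule sum_mono)
    fix j
    have "(a j)\<^sup>2 \<le> (\<mu> j / 2)\<^sup>2"
      using a(1)[of j] a(2)[of j] by (metis abs_ge_zero power2_abs power_mono)
    also have "\<dots> = \<mu> j * \<mu> j / 4" by (simp add: power2_eq_square)
    also have "\<dots> \<le> 1 / 1000 * \<mu> j / 4"
      using a(2,3)[of j] by (intro divide_right_mono mult_right_mono) auto
    finally show "(a j)\<^sup>2 \<le> 1 / 4000 * \<mu> j" by simp
  qed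
  also have "\<dots> = 1 / 4000"
    by (simp add: sum flip: sum_distrib_left sum_divide_distrib)
  finally have le: "(\<integral>x. (\<Sum>j\<le>hash_cells. sgn_pm (x j 0) * a j)\<^sup>2 \<partial>?P) \<le> 1 / 4000"
    using S2 unfolding eq by simp
  have ev: "{x \<in> space ?P. 1 / 4 \<le> \<bar>\<Sum>j\<le>hash_cells. sgn_pm (x j 0) * a j\<bar>} =
      {x \<in> space ?P. (\<Sum>j\<le>hash_cells. sgn_pm (x j 0) * a j)\<^sup>2 \<ge> (1 / 4)\<^sup>2}"
    using abs_le_square_iff[of "1 / 4 :: real"] by simp
  show "{x \<in> space ?P. 1 / 4 \<le> \<bar>\<Sum>j\<le>hash_cells. sgn_pm (x j 0) * a j\<bar>} \<in> sets ?P"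
    unfolding ev using S1[unfolded eq] by (intro borel_measurable_le) auto
  have "measure ?P {x \<in> space ?P. (\<Sum>j\<le>hash_cells. sgn_pm (x j 0) * a j)\<^sup>2 \<ge> (1 / 4)\<^sup>2} \<le>
      (\<integral>x. (\<Sum>j\<le>hash_cells. sgn_pm (x j 0) * a j)\<^sup>2 \<partial>?P) / (1 / 4)\<^sup>2"
    by (rule integral_Markov_inequality_measure[OF S1[unfolded eq] sets.empty_sets]) auto
  also have "\<dots> \<le> (1 / 4000) / (1 / 4)\<^sup>2"
    using le by (intro divide_right_mono) auto
  finally show "measure ?P {x \<in> space ?P. 1 / 4 \<le> \<bar>\<Sum>j\<le>hash_cells. sgn_pm (x j 0) * a j\<bar>} \<le> 4 / 1000"
    unfolding ev by (simp add: power2_eq_square)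
qed

lemma outcome_large:
  assumes "3 / 4 \<le> \<epsilon>"
  shows "outcome d n \<epsilon> S z = (if inj_on (\<lambda>i. cell (z i 0)) {..<hash_tests} then 4 else 0)"
  using assms by (simp add: outcome_def)

text \<open>If some cell has test mass above 1/1000, two test points probably share it and the
  learner rejects. Otherwise all cells are light and the contributions of their random signs average
  out, so that the agreement stays above 1/4.\<close>

lemma sound_large:
  assumes D': "prob_space D'" "sets D' = sets G" and n: "hash_tests \<le> n" "hash_cells < n" and \<epsilon>: "3 / 4 \<le> \<epsilon>"
  shows "\<P>((S, X) in samples n G D' f. \<forall>h. learn learner evaluator d n \<epsilon> S X = Some h \<longrightarrow>
            {x \<in> space D'. h x \<noteq> f x} \<in> sets D' \<and> \<P>(x in D'. h x \<noteq> f x) \<le> \<epsilon>) \<ge> 1 - 1 / 100"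
proof -
  let ?P = "PiM {..<n} (\<lambda>_. G)" and ?Q = "PiM {..<n} (\<lambda>_. D')"
  interpret D: prob_space D' by (rule D')
  have d0: "0 < d" using d2 by simp
  have \<epsilon>0: "0 < \<epsilon>" using \<epsilon> by simp
  have coord: "(\<lambda>x. x 0) \<in> borel_measurable D'"
    using measurable_coordinate[OF d0] D'(2) by (simp cong: measurable_cong_sets)
  have cellD: "(\<lambda>x. cell (x 0)) \<in> D' \<rightarrow>\<^sub>M count_space UNIV"
    by (rule measurable_compose[OF coord measurable_cell])
  define C where "C j = {x \<in> space D'. cell (x 0) = j}" for j
  define \<mu> where "\<mu> j = measure D' (C j)" for j
  have C: "C j \<in> sets D'" for j
  proof -
    have "Measurable.pred D' (\<lambda>x. cell (x 0) = j)"
      using cellD by (rule measurable_compose) simp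
    then show ?thesis unfolding C_def Measurable.pred_def .
  qed
  show ?thesis
  proof (cases "\<exists>j. 1 / 1000 < \<mu> j")
    case True
    then obtain j where j: "1 / 1000 < \<mu> j" by blast
    let ?B = "{z \<in> space ?Q. 2 * real (card {i \<in> {..<hash_tests}. z i \<in> C j}) \<le> 1 / 1000 * card {..<hash_tests}}"
    have ne: "{..<hash_tests} \<noteq> {}" by (simp add: hash_tests_def lessThan_empty_iff)
    have sub: "{..<hash_tests} \<subseteq> {..<n}" and pos: "0 < (1 / 1000 :: real)" using n by auto
    note B = PiM_count_le_subset[OF D'(1) finite_lessThan sub ne C pos j[unfolded \<mu>_def]]
    have B1: "?B \<in> sets ?Q" by (rule B(2))
    have "measure ?Q ?B \<le> 4 / (1 / 1000 * card {..<hash_tests})" by (rule B(1))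
    also have "\<dots> \<le> 1 / 100" unfolding card_lessThan hash_tests_def by simp
    finally have B2: "measure ?Q ?B \<le> 1 / 100" .
    note e = snd_event[OF D' B1]
    show ?thesis
    proof (rule soundness[OF D' n \<epsilon>0 e(1)])
      show "measure (?P \<Otimes>\<^sub>M ?Q) {\<omega> \<in> space (?P \<Otimes>\<^sub>M ?Q). snd \<omega> \<in> ?B} \<le> 1 / 100"
        unfolding e(2) by (rule B2)
      fix x z assume x: "x \<in> space ?P" and z: "z \<in> space ?Q"
        and nB: "(x, z) \<notin> {\<omega> \<in> space (?P \<Otimes>\<^sub>M ?Q). snd \<omega> \<in> ?B}" and nz: "outcome d n \<epsilon> (lab n x) z \<noteq> 0"
      have inj: "inj_on (\<lambda>i. cell (z i 0)) {..<hash_tests}"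
        using nz unfolding outcome_large[OF \<epsilon>] by (simp split: if_splits)
      \<comment> \<open>Outside \<open>?B\<close> the heavy cell contains more than 500 of the
        inspected points, while injectivity allows a single one.\<close>
      let ?J = "{i \<in> {..<hash_tests}. z i \<in> C j}"
      have "card ?J = card ((\<lambda>i. cell (z i 0)) ` ?J)"
        by (rule card_image[symmetric]) (rule inj_on_subset[OF inj], auto)
      also have "\<dots> \<le> card {j}"
        by (rule card_mono) (auto simp: C_def)
      finally have "card ?J \<le> 1" by simp
      moreover have "1 / 1000 * real hash_tests < 2 * real (card ?J)"
        using nB x z by (simp add: space_pair_measure)
      ultimately have False by (simp add: hash_tests_def)
      then show "err D' (answer d n (lab n x) (outcome d n \<epsilon> (lab n x) z)) \<le> \<epsilon>" ..
    qed
  next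
    case False
    define q where "q j b = measure D' (C j \<inter> {x \<in> space D'. f x = b})" for j b
    \<comment> \<open>Half the advantage of label 1 within the cell: labelling it with s agrees with
      \<open>f\<close> on mass \<open>\<mu> j / 2 + s * a j\<close>.\<close>
    define a where "a j = (q j 1 - q j (-1)) / 2" for j
    have fb: "{x \<in> space D'. f x = b} \<in> sets D'" for b
      using f_D'[OF D'] by (rule borel_measurable_eq) simp
    have qsum: "\<mu> j = q j 1 + q j (-1)" for j
    proof -
      have "C j = (C j \<inter> {x \<in> space D'. f x = 1}) \<union> (C j \<inter> {x \<in> space D'. f x = -1})"
        by (auto simp: C_def f_eq)
      moreover have "measure D' ((C j \<inter> {x \<in> space D'. f x = 1}) \<union> (C j \<inter> {x \<in> space D'. f x = -1})) = q j 1 + q j (-1)"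
        unfolding q_def by (rule D.finite_measure_Union) (use C fb in auto)
      ultimately show ?thesis unfolding \<mu>_def by simp
    qed
    have q0: "0 \<le> q j b" for j b by (simp add: q_def)
    have a1: "\<bar>a j\<bar> \<le> \<mu> j / 2" for j
      using q0[of j 1] q0[of j "-1"] by (simp add: a_def qsum)
    have qa: "q j (sgn_pm t) = \<mu> j / 2 + sgn_pm t * a j" for j t
      by (simp add: sgn_pm_def a_def qsum field_simps)
    have part: "measure D' (\<Union>j\<le>hash_cells. C j \<inter> A j) = (\<Sum>j\<le>hash_cells. measure D' (C j \<inter> A j))" if "\<And>j. A j \<in> sets D'" for A
      by (rule D.finite_measure_finite_Union) (use C that in \<open>auto simp: disjoint_family_on_def C_def\<close>)
    have "(\<Union>j\<le>hash_cells. C j \<inter> space D') = space D'"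
      using cell_le by (auto simp: C_def)
    then have \<mu>1: "(\<Sum>j\<le>hash_cells. \<mu> j) = 1"
      using part[of "\<lambda>_. space D'"] C by (simp add: D.prob_space \<mu>_def)
    let ?B = "{x \<in> space ?P. 1 / 4 \<le> \<bar>\<Sum>j\<le>hash_cells. sgn_pm (x j 0) * a j\<bar>}"
    have B: "?B \<in> sets ?P" "measure ?P ?B \<le> 4 / 1000"
    proof -
      have "0 \<le> \<mu> j" "\<mu> j \<le> 1 / 1000" for j
        using False not_less by (auto simp: \<mu>_def)
      note dev = sign_deviation[OF n(2) a1 this \<mu>1]
      show "?B \<in> sets ?P" by (rule dev(1))
      show "measure ?P ?B \<le> 4 / 1000" by (rule dev(2))
    qed
    note e = fst_event[OF D' B(1)]
    show ?thesis
    proof (rule soundness[OF D' n \<epsilon>0 e(1)])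
      show "measure (?P \<Otimes>\<^sub>M ?Q) {\<omega> \<in> space (?P \<Otimes>\<^sub>M ?Q). fst \<omega> \<in> ?B} \<le> 1 / 100"
        unfolding e(2) using B(2) by simp
      fix x z assume x: "x \<in> space ?P" and z: "z \<in> space ?Q"
        and nB: "(x, z) \<notin> {\<omega> \<in> space (?P \<Otimes>\<^sub>M ?Q). fst \<omega> \<in> ?B}" and nz: "outcome d n \<epsilon> (lab n x) z \<noteq> 0"
      have o: "outcome d n \<epsilon> (lab n x) z = 4"
        using nz unfolding outcome_large[OF \<epsilon>] by (simp split: if_splits)
      have dev: "\<bar>\<Sum>j\<le>hash_cells. sgn_pm (x j 0) * a j\<bar> < 1 / 4"
        using nB x z by (simp add: space_pair_measure)
      let ?h = "answer d n (lab n x) 4"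
      have h: "?h y = sgn_pm (x (cell (y 0)) 0)" for y
      proof -
        have "cell (y 0) < n" using cell_le[of "y 0"] n(2) by simp
        then show ?thesis by (simp add: answer_def lab_def)
      qed
      have "{y \<in> space D'. ?h y = f y} = (\<Union>j\<le>hash_cells. C j \<inter> {y \<in> space D'. f y = sgn_pm (x j 0)})"
        using cell_le by (auto simp: h C_def)
      then have "measure D' {y \<in> space D'. ?h y = f y} = (\<Sum>j\<le>hash_cells. q j (sgn_pm (x j 0)))"
        using part[OF fb] by (simp add: q_def)
      also have "\<dots> = 1 / 2 + (\<Sum>j\<le>hash_cells. sgn_pm (x j 0) * a j)"
        unfolding qa sum.distrib using \<mu>1 by (simp flip: sum_divide_distrib)
      also have "\<dots> \<ge> 1 / 4" using dev by linarith
      finally have agree: "1 / 4 \<le> measure D' {y \<in> space D'. ?h y = f y}" .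
      have ne: "{y \<in> space D'. ?h y \<noteq> f y} \<in> sets D'"
        using measurable_err(2)[OF D' n(2) lab_samples_space[OF D' x z], of 4] by simp
      have "{y \<in> space D'. ?h y = f y} = space D' - {y \<in> space D'. ?h y \<noteq> f y}" by auto
      then have "measure D' {y \<in> space D'. ?h y = f y} = 1 - err D' ?h"
        using D.prob_compl[OF ne] by (simp add: err_def[OF D'])
      then show "err D' (answer d n (lab n x) (outcome d n \<epsilon> (lab n x) z)) \<le> \<epsilon>"
        unfolding o using agree \<epsilon> by simp
    qed
  qed
qed

text \<open>Birthday bound: two independent points share a cell with probability at most the sum of
  the squared cell masses, hence at most the largest mass, and there are at most 10^12 ordered
  pairs.\<close>

lemma complete_large:
  assumes n: "hash_tests \<le> n" "hash_cells < n" and \<epsilon>: "3 / 4 \<le> \<epsilon>"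
  shows "\<P>((S, X) in samples n G G f. learn learner evaluator d n \<epsilon> S X \<noteq> None) \<ge> 1 - 1 / 100"
proof -
  let ?P = "PiM {..<n} (\<lambda>_. G)"
  interpret P: prob_space ?P by (intro prob_space_PiM G.prob_space_axioms)
  have d0: "0 < d" using d2 by simp
  have \<epsilon>0: "0 < \<epsilon>" using \<epsilon> by simp
  note D' = G.prob_space_axioms refl[of "sets G"]
  let ?C = "\<lambda>j. {y \<in> space G. cell (y 0) = j}"
  let ?pairs = "{(i, i'). i < hash_tests \<and> i' < hash_tests \<and> i \<noteq> i'}"
  let ?E = "\<lambda>(i, i') j. {z \<in> space ?P. z i \<in> ?C j \<and> z i' \<in> ?C j}"
  have C: "?C j \<in> sets G" for j
  proof -
    have "Measurable.pred G (\<lambda>x. cell (x 0) = j)"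
      using measurable_compose[OF measurable_coordinate[OF d0] measurable_cell] by (rule measurable_compose) simp
    then show ?thesis unfolding Measurable.pred_def .
  qed
  have psub: "?pairs \<subseteq> {..<hash_tests} \<times> {..<hash_tests}" by auto
  then have fin: "finite ?pairs" by (rule finite_subset) simp
  have E: "?E p j \<in> sets ?P" "measure ?P (?E p j) = (measure G (?C j))\<^sup>2" if "p \<in> ?pairs" for p j
    using PiM_pair_prob[OF G.prob_space_axioms _ _ _ C, of "fst p" "{..<n}" "snd p" j] that n
    by (auto simp: split_beta)
  have total: "(\<Sum>j\<le>hash_cells. measure G (?C j)) = 1"
  proof -
    have "measure G (\<Union>j\<le>hash_cells. ?C j) = (\<Sum>j\<le>hash_cells. measure G (?C j))"
      by (rule G.finite_measure_finite_Union) (use C in \<open>auto simp: disjoint_family_on_def\<close>)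
    moreover have "(\<Union>j\<le>hash_cells. ?C j) = space G"
      using cell_le by auto
    ultimately show ?thesis by (simp add: G.prob_space)
  qed
  have pair: "measure ?P (\<Union>j\<le>hash_cells. ?E p j) \<le> 1 / real hash_width" if p: "p \<in> ?pairs" for p
  proof -
    have "measure ?P (\<Union>j\<le>hash_cells. ?E p j) \<le> (\<Sum>j\<le>hash_cells. measure ?P (?E p j))"
      by (rule P.finite_measure_subadditive_finite) (use E(1)[OF p] in auto)
    also have "\<dots> = (\<Sum>j\<le>hash_cells. measure G (?C j) * measure G (?C j))"
      using E(2)[OF p] by (simp add: power2_eq_square)
    also have "\<dots> \<le> (\<Sum>j\<le>hash_cells. 1 / real hash_width * measure G (?C j))"
      by (intro sum_mono mult_right_mono cell_prob) auto
    also have "\<dots> = 1 / real hash_width"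
      using total by (simp flip: sum_divide_distrib)
    finally show ?thesis .
  qed
  let ?B = "\<Union>p\<in>?pairs. \<Union>j\<le>hash_cells. ?E p j"
  have Bp: "(\<Union>j\<le>hash_cells. ?E p j) \<in> sets ?P" if "p \<in> ?pairs" for p
    by (intro sets.finite_UN finite_atMost E(1)[OF that])
  have B: "?B \<in> sets ?P"
    by (intro sets.finite_UN fin Bp)
  have "measure ?P ?B \<le> (\<Sum>p\<in>?pairs. measure ?P (\<Union>j\<le>hash_cells. ?E p j))"
    by (rule P.finite_measure_subadditive_finite[OF fin]) (use Bp in auto)
  also have "\<dots> \<le> (\<Sum>p\<in>?pairs. 1 / real hash_width)"
    by (rule sum_mono) (rule pair)
  also have "\<dots> = real (card ?pairs) / real hash_width" by simp
  also have "\<dots> \<le> real (card ({..<hash_tests} \<times> {..<hash_tests})) / real hash_width"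
    using card_mono[OF _ psub] by (intro divide_right_mono) (simp_all only: of_nat_le_iff finite_SigmaI finite_lessThan of_nat_0_le_iff)
  also have "\<dots> = 1 / 100"
    by (simp add: card_cartesian_product hash_tests_def hash_width_def)
  finally have Ble: "measure ?P ?B \<le> 1 / 100" .
  note e = snd_event[OF D' B]
  show ?thesis
  proof (rule completeness[OF D' n \<epsilon>0 e(1)])
    show "measure (?P \<Otimes>\<^sub>M ?P) {\<omega> \<in> space (?P \<Otimes>\<^sub>M ?P). snd \<omega> \<in> ?B} \<le> 1 / 100"
      unfolding e(2) by (rule Ble)
    fix x z assume x: "x \<in> space ?P" and z: "z \<in> space ?P" and nB: "(x, z) \<notin> {\<omega> \<in> space (?P \<Otimes>\<^sub>M ?P). snd \<omega> \<in> ?B}"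
    have zG: "z i \<in> space G" if "i < hash_tests" for i
      using z n that by (auto simp: space_PiM PiE_iff)
    have "inj_on (\<lambda>i. cell (z i 0)) {..<hash_tests}"
    proof (rule inj_onI, rule ccontr)
      fix i i' assume i: "i \<in> {..<hash_tests}" "i' \<in> {..<hash_tests}" "cell (z i 0) = cell (z i' 0)" "i \<noteq> i'"
      then have "(i, i') \<in> ?pairs" "cell (z i 0) \<in> {..hash_cells}" "z \<in> ?E (i, i') (cell (z i 0))"
        using z zG cell_le by auto
      then have "z \<in> ?B" by blast
      then show False using nB x z by (simp add: space_pair_measure)
    qed
    then show "outcome d n \<epsilon> (lab n x) z \<noteq> 0"
      unfolding outcome_large[OF \<epsilon>] by simp
  qed
qed

end

section \<open>Assembly and choice of the constants\<close>

lemma tds_learner_learn: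
  assumes d: "2 \<le> d" and \<epsilon>: "0 < \<epsilon>" and n: "hash_tests \<le> n" "hash_cells < n"
    and big: "\<epsilon> < 3 / 4 \<Longrightarrow> d ^ (150 * deg \<epsilon>) \<le> n"
  shows "tds_learner (learn learner evaluator d n \<epsilon>) n (halfspaces d) (std_gaussian d) \<epsilon> (1 / 100)"
  unfolding tds_learner_def
proof (intro ballI conjI allI impI)
  fix g assume "g \<in> halfspaces d"
  then obtain v \<tau> where g: "g = (\<lambda>x. sgn_pm ((\<Sum>i<d. v i * x i) - \<tau>))" and v: "(\<Sum>i<d. (v i)\<^sup>2) = 1"
    by (auto simp: halfspaces_def)
  interpret halfspace d v \<tau> by unfold_locales (fact v d)+
  have f: "g = f" by (simp add: g f_def[abs_def] lin_def)
  have L: "halfspace_learning d v \<epsilon> n" if "\<epsilon> < 3 / 4"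
    by unfold_locales (use \<epsilon> that big in auto)
  show "1 - 1 / 100 \<le> \<P>((S, X) in samples n (std_gaussian d) (std_gaussian d) g. learn learner evaluator d n \<epsilon> S X \<noteq> None)"
    unfolding f using halfspace_learning.complete_small[OF L n, where \<tau> = \<tau>] complete_large[OF n] by (cases "\<epsilon> < 3 / 4") auto
  fix D' :: "(nat \<Rightarrow> real) measure" assume "prob_space D' \<and> sets D' = sets (std_gaussian d)"
  then have D': "prob_space D'" "sets D' = sets (std_gaussian d)" by auto
  show "1 - 1 / 100 \<le> \<P>((S, X) in samples n (std_gaussian d) D' g. \<forall>h. learn learner evaluator d n \<epsilon> S X = Some h \<longrightarrow>
      {x \<in> space D'. h x \<noteq> g x} \<in> sets D' \<and> \<P>(x in D'. h x \<noteq> g x) \<le> \<epsilon>)"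
    unfolding f using halfspace_learning.sound_small[OF L D' n, where \<tau> = \<tau>] sound_large[OF D' n] by (cases "\<epsilon> < 3 / 4") auto
qed

text \<open>Minimality of the degree gives 2^(k - 1) < 10^6 / epsilon < 2^20 / epsilon, hence k
  \<le> 21 + 2 ln (1 / epsilon). As the logarithm is at least 1/4, the summand 21 is at most 84
  times the logarithm.\<close>

lemma deg_le_ln:
  assumes "0 < \<epsilon>" "\<epsilon> < 3 / 4"
  shows "real (deg \<epsilon>) \<le> 90 * ln (1 / \<epsilon>)" "1 / 4 \<le> ln (1 / \<epsilon>)"
proof -
  define L where "L = ln (1 / \<epsilon>)"
  have "ln \<epsilon> \<le> \<epsilon> - 1" using assms by (intro ln_le_minus_one)
  then show L: "1 / 4 \<le> ln (1 / \<epsilon>)" using assms by (simp add: ln_div)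
  have k: "20 \<le> deg \<epsilon>" by (rule deg_ge_20) (use assms in auto)
  then have "\<epsilon> * 2 ^ (deg \<epsilon> - 1) < 1000000" by (intro less_deg) simp
  then have "2 ^ (deg \<epsilon> - 1) < 1000000 * (1 / \<epsilon>)" using assms by (simp add: field_simps)
  then have "(2::real) ^ (deg \<epsilon> - 1) < 2 ^ 20 * (1 / \<epsilon>)"
    by (rule less_le_trans) (use assms in \<open>intro mult_right_mono; simp\<close>)
  then have "ln ((2::real) ^ (deg \<epsilon> - 1)) \<le> ln (2 ^ 20 * (1 / \<epsilon>))"
    using assms by (subst ln_le_cancel_iff) auto
  moreover have "ln (2 ^ 20 * (1 / \<epsilon>)) = 20 * ln 2 + L"
    using assms ln_realpow[of 2 20] by (subst ln_mult_pos) (simp_all add: L_def)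
  ultimately have "real (deg \<epsilon> - 1) * ln 2 \<le> 20 * ln 2 + L"
    using ln_realpow[of 2 "deg \<epsilon> - 1"] by linarith
  then have "(real (deg \<epsilon>) - 21) * ln 2 \<le> L"
    using k by (simp add: of_nat_diff algebra_simps)
  moreover have "1 / 2 \<le> ln (2::real)" using ln2_ge_two_thirds by simp
  ultimately have "real (deg \<epsilon>) - 21 \<le> 2 * L"
  proof (cases "real (deg \<epsilon>) \<le> 21")
    case False
    then have "(real (deg \<epsilon>) - 21) * (1 / 2) \<le> (real (deg \<epsilon>) - 21) * ln 2"
      using \<open>1 / 2 \<le> ln 2\<close> by (intro mult_left_mono) auto
    then show ?thesis using \<open>(real (deg \<epsilon>) - 21) * ln 2 \<le> L\<close> by simp
  qed (use L in \<open>simp add: L_def\<close>)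
  then show "real (deg \<epsilon>) \<le> 90 * ln (1 / \<epsilon>)"
    using L by (simp add: L_def)
qed

text \<open>After expansion every monomial is at most n^3, and the coefficients, including the
  constant, add up to 211.\<close>

lemma time_le:
  assumes "1 \<le> n" "d \<le> n" "k \<le> n"
  shows "Suc (time d n k) \<le> 250 * n ^ 3"
proof -
  have n2: "n \<le> n ^ 2" "n ^ 2 \<le> n ^ 3" using assms(1) by (simp_all add: power_increasing[of 1 2 n, simplified] power_increasing)
  have a: "d * n \<le> n ^ 2" "n * d \<le> n ^ 2" using assms(2) by (simp_all add: power2_eq_square)
  have b: "n * (n * d) \<le> n ^ 3" "n * (n * k) \<le> n ^ 3" using assms by (simp_all add: power3_eq_cube)
  have "Suc (time d n k) = 101 + 4 * k + 6 * d + 3 * (d * n) + 34 * n + 9 * (n * d) + 27 * n ^ 2 + 9 * (n * (n * d)) + 18 * (n * (n * k))"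
    by (simp add: time_def algebra_simps power2_eq_square)
  also have "\<dots> \<le> 250 * n ^ 3"
    using n2 a b assms by linarith
  finally show ?thesis .
qed

text \<open>The same two programs serve every \<open>C\<close>, since they read n from memory; only
  \<open>K\<close> is chosen depending on \<open>C\<close>.\<close>

theorem theorem2p7:
  shows "\<exists>C\<^sub>0::real. C\<^sub>0 > 0 \<and> (\<forall>C\<ge>C\<^sub>0. \<exists>L H. \<exists>K::real. K > 0 \<and>
    (\<forall>(d::nat) (\<epsilon>::real) (n::nat).
      d \<ge> 2 \<and> 0 < \<epsilon> \<and> \<epsilon> < 1 \<and> n = nat \<lceil>C * real d powr (C * ln (1 / \<epsilon>))\<rceil> \<longrightarrow>
        tds_learner (learn L H d n \<epsilon>) n (halfspaces d) (std_gaussian d) \<epsilon> (1 / 100) \<and>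
        runs_within L H d n \<epsilon> (K * real d powr (K * ln (1 / \<epsilon>)))))"
proof -
  \<comment> \<open>13501 exceeds 150 * 90, the exponent that
    \<open>d ^ (150 * deg \<epsilon>)\<close> needs after \<open>deg_le_ln\<close>. The other two
    summands keep n above the fixed sizes of the cell construction even as \<open>\<epsilon>\<close>
    tends to 1 and the power of d degenerates.\<close>
  define C\<^sub>0 where "C\<^sub>0 = real (hash_tests + hash_cells + 13501)"
  have "\<exists>K::real. K > 0 \<and>
    (\<forall>(d::nat) (\<epsilon>::real) (n::nat).
      d \<ge> 2 \<and> 0 < \<epsilon> \<and> \<epsilon> < 1 \<and> n = nat \<lceil>C * real d powr (C * ln (1 / \<epsilon>))\<rceil> \<longrightarrow>
        tds_learner (learn learner evaluator d n \<epsilon>) n (halfspaces d) (std_gaussian d) \<epsilon> (1 / 100) \<and>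
        runs_within learner evaluator d n \<epsilon> (K * real d powr (K * ln (1 / \<epsilon>))))"
    if C: "C\<^sub>0 \<le> C" for C
  proof -
    \<comment> \<open>\<open>hash_time\<close> serves \<open>\<epsilon> \<ge> 3 / 4\<close>.
      Elsewhere the time is at most \<open>250 * n ^ 3\<close> with
      \<open>n \<le> 2 * C * R\<close>, which puts \<open>250 * (2 * C) ^ 3\<close> into the
      coefficient and \<open>3 * C\<close> into the exponent.\<close>
    define K where "K = real hash_time + 250 * (2 * C) ^ 3 + 3 * C"
    have C1: "13501 \<le> C" "real hash_tests \<le> C" "real hash_cells < C"
      using C by (simp_all add: C\<^sub>0_def)
    have K: "0 < K" "real hash_time \<le> K" "250 * (2 * C) ^ 3 \<le> K" "3 * C \<le> K"
      using C1 by (simp_all add: K_def add_nonneg_pos)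
    have "tds_learner (learn learner evaluator d n \<epsilon>) n (halfspaces d) (std_gaussian d) \<epsilon> (1 / 100) \<and>
        runs_within learner evaluator d n \<epsilon> (K * real d powr (K * ln (1 / \<epsilon>)))"
      if d: "2 \<le> d" and \<epsilon>: "0 < \<epsilon>" "\<epsilon> < 1" and n: "n = nat \<lceil>C * real d powr (C * ln (1 / \<epsilon>))\<rceil>" for d :: nat and \<epsilon> :: real and n :: nat
    proof -
      define L where "L = ln (1 / \<epsilon>)"
      have L0: "0 \<le> L" using \<epsilon> by (simp add: L_def ln_div)
      have d1: "1 \<le> real d" using d by simp
      define R where "R = real d powr (C * L)"
      have R1: "1 \<le> R"
        unfolding R_def using d1 L0 C1 by (intro ge_one_powr_ge_zero) auto
      have CR: "C \<le> C * R" using R1 C1 by simp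
      have nR: "C * R \<le> real n" "real n \<le> 2 * C * R"
      proof -
        have "0 \<le> C * R" using CR C1 by linarith
        then have n': "real n = of_int \<lceil>C * R\<rceil>"
          unfolding n R_def[unfolded L_def, symmetric] by simp
        show "C * R \<le> real n" unfolding n' by (rule le_of_int_ceiling)
        have "of_int \<lceil>C * R\<rceil> \<le> C * R + 1" by (rule of_int_ceiling_le_add_one)
        also have "\<dots> \<le> 2 * C * R" using CR C1 by linarith
        finally show "real n \<le> 2 * C * R" unfolding n' .
      qed
      have nC: "C \<le> real n" using nR(1) CR by linarith
      have h: "hash_tests \<le> n" "hash_cells < n"
        using nC C1 by linarith+
      have pow: "real d ^ m \<le> real n" if "real m \<le> 13500 * L" for m
      proof -
        have "real d ^ m = real d powr (real m)"
          using d by (simp add: powr_realpow)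
        also have "\<dots> \<le> R"
          unfolding R_def
        proof (intro powr_mono)
          have "13500 * L \<le> C * L" using C1 L0 by (intro mult_right_mono) auto
          then show "real m \<le> C * L" using that by simp
        qed (use d1 in auto)
        also have "\<dots> \<le> C * R" using C1 R1 by simp
        finally show ?thesis using nR(1) by (rule order_trans)
      qed
      have big: "d ^ (150 * deg \<epsilon>) \<le> n" if "\<epsilon> < 3 / 4"
      proof -
        have "real (150 * deg \<epsilon>) \<le> 13500 * L"
          using deg_le_ln(1)[OF \<epsilon>(1) that] by (simp add: L_def)
        from pow[OF this] have "real (d ^ (150 * deg \<epsilon>)) \<le> real n" by simp
        then show ?thesis by (simp only: of_nat_le_iff)
      qed
      have KL: "1 \<le> real d powr (K * L)"
        using d1 L0 K by (intro ge_one_powr_ge_zero) auto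
      have "runs_within learner evaluator d n \<epsilon> (K * real d powr (K * L))"
      proof (rule runs_within_learner[OF \<epsilon>(1) h])
        show "real (if \<epsilon> < 3 / 4 then Suc (time d n (deg \<epsilon>)) else hash_time) \<le> K * real d powr (K * L)"
        proof (cases "\<epsilon> < 3 / 4")
          case False
          have "K * 1 \<le> K * real d powr (K * L)" using KL K by (intro mult_left_mono) auto
          then have "real hash_time \<le> K * real d powr (K * L)" using K by linarith
          then show ?thesis using False by (simp only: if_False)
        next
          case True
          \<comment> \<open>Below 3/4 the logarithm is at least 1/4, so n is at least the first
            power of d and whole points can be read.\<close>
          have dn: "d \<le> n"
            using pow[of 1] deg_le_ln(2)[OF \<epsilon>(1) True] by (simp add: L_def)
          have kn: "deg \<epsilon> \<le> n"
          proof -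
            have "deg \<epsilon> \<le> 2 ^ (150 * deg \<epsilon>)"
              by (rule order_trans[of _ "2 ^ deg \<epsilon>"]) (auto intro: less_imp_le less_exp power_increasing)
            also have "\<dots> \<le> d ^ (150 * deg \<epsilon>)" using d by (intro power_mono) auto
            finally show ?thesis using big[OF True] by simp
          qed
          have "1 \<le> n" using nC C1 by linarith
          then have "real (Suc (time d n (deg \<epsilon>))) \<le> real (250 * n ^ 3)"
            using time_le[OF _ dn kn] by (simp only: of_nat_le_iff)
          also have "\<dots> = 250 * real n ^ 3" by simp
          also have "\<dots> \<le> 250 * (2 * C * R) ^ 3"
            using nR(2) by (intro mult_left_mono power_mono) auto
          also have "\<dots> = 250 * (2 * C) ^ 3 * R ^ 3"
            by (simp add: power_mult_distrib)
          also have "R ^ 3 = real d powr (3 * (C * L))"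
            using d by (simp add: R_def powr_power mult.commute)
          also have "\<dots> \<le> real d powr (K * L)"
            using d1 K L0 mult_right_mono[OF K(4) L0] by (intro powr_mono) auto
          finally have "real (Suc (time d n (deg \<epsilon>))) \<le> 250 * (2 * C) ^ 3 * real d powr (K * L)"
            using C1 by (simp add: mult_left_mono)
          also have "\<dots> \<le> K * real d powr (K * L)"
            using K by (intro mult_right_mono) auto
          finally show ?thesis using True by simp
        qed
      qed (use d in simp)
      moreover have "tds_learner (learn learner evaluator d n \<epsilon>) n (halfspaces d) (std_gaussian d) \<epsilon> (1 / 100)"
        by (rule tds_learner_learn[OF d \<epsilon>(1) h big])
      ultimately show ?thesis by (simp add: L_def)
    qed
    then show ?thesis
      by (intro exI[of _ K] conjI[OF K(1)] allI impI) (elim conjE)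
  qed
  note main = this
  show ?thesis
  proof (rule exI[of _ C\<^sub>0], intro conjI allI impI, goal_cases)
    case 1
    show ?case by (simp add: C\<^sub>0_def)
  next
    case (2 C)
    show ?case
      by (rule exI[of _ learner], rule exI[of _ evaluator], rule main[OF 2])
  qed
qed

end
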